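(* Let $\Omega$, $h$, $f$ satisfy the standing assumptions given in the context, and let $\alpha\in[0,\infty)$. Then the dynamical system $(\mathcal H,S^\alpha(t))$ generated by the weak solutions of problem (P) is a gradient dynamical system.
   Context: $\Omega\subset\mathbb R^3$ is a bounded domain with smooth boundary. $\|\cdot\|$ and $(\cdot,\cdot)$ are the norm and inner product of $L^2(\Omega)$; $\lambda_1>0$ is the first eigenvalue of the Dirichlet Laplacian. Problem (P), for $\alpha\in[0,\infty)$ (with $\|\nabla u_t\|^0=1$), is $$u_{tt}-\Delta u-\|\nabla u_t(t)\|^{\alpha}\Delta u_t+f(u)=h\ \text{ in }\Omega\times(0,\infty),\quad u=0\text{ on }\partial\Omega\times(0,\infty),\quad (u,u_t)|_{t=0}=(u_0,u_1).$$ Standing assumptions: $h\in L^2(\Omega)$; $f\in C^2(\mathbb R)$, $f(0)=0$; there is $L_f>0$ with $|f''(s)|\le L_f(1+|s|^3)$ for all $s\in\mathbb R$; and $\lim_{|s|\to\infty} f(s)/s>-\lambda_1$ (the limit may be $+\infty$). $\mathcal H=H_0^1(\Omega)\times L^2(\Omega)$ with $\|(u,v)\|_{\mathcal H}^2=\|\nabla u\|^2+\|v\|^2$. For each $U_0=(u_0,u_1)\in\mathcal H$, (P) has a unique weak solution with $(u,u_t)\in C([0,T];\mathcal H)$, $u_t\in L^{\alpha+2}(0,T;H_0^1(\Omega))$ for all $T>0$, i.e. for all $\psi\in H_0^1(\Omega)$, $t\ge0$: $(u_t(t),\psi)+\int_0^t[(\nabla u,\nabla\psi)+\|\nabla u_t\|^\alpha(\nabla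 u_t,\nabla\psi)+(f(u),\psi)]\,d\tau=(u_1,\psi)+\int_0^t(h,\psi)\,d\tau$. Set $S^\alpha(t)U_0=(u(t),u_t(t))$. A dynamical system $(X,S(t))$ is gradient if it possesses a strict Lyapunov function, i.e. a continuous functional $\Phi:X\to\mathbb R$ such that (i) $t\mapsto\Phi(S(t)y)$ is nonincreasing for every $y\in X$; and (ii) if $\Phi(S(t)y)=\Phi(y)$ for all $t>0$ and some $y\in X$, then $S(t)y=y$ for all $t>0$. *)

theory Defs
  imports "HOL-Analysis.Analysis"
begin

section \<open>Smooth functions and smoothly bounded domains\<close>

text \<open>\<open>Ck_on k f U\<close>: \<open>f\<close> is \<open>k\<close> times continuously differentiable on the open set \<open>U\<close>.\<close>

primrec Ck_on :: "nat \<Rightarrow> ('a::euclidean_space \<Rightarrow> real) \<Rightarrow> 'a set \<Rightarrow> bool" where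
  "Ck_on 0 f U \<longleftrightarrow> continuous_on U f"
| "Ck_on (Suc k) f U \<longleftrightarrow> (\<forall>x\<in>U. f differentiable (at x)) \<and>
     (\<forall>b\<in>Basis. Ck_on k (\<lambda>x. frechet_derivative f (at x) b) U)"

definition smooth_on :: "('a::euclidean_space \<Rightarrow> real) \<Rightarrow> 'a set \<Rightarrow> bool" where
  "smooth_on f U \<longleftrightarrow> (\<forall>k. Ck_on k f U)"

definition grad :: "(real^3 \<Rightarrow> real) \<Rightarrow> real^3 \<Rightarrow> real^3" where
  "grad f x = (\<chi> i. frechet_derivative f (at x) (axis i 1))"

text \<open>Smoothness of the boundary is expressed by local defining functions; the boundary near
  \<open>p\<close> is then the regular level set \<open>\<rho> = 0\<close> and the domain lies on one side of it.\<close>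

definition smooth_boundary :: "(real^3) set \<Rightarrow> bool" where
  "smooth_boundary \<Omega> \<longleftrightarrow> (\<forall>p\<in>frontier \<Omega>. \<exists>V \<rho>. open V \<and> p \<in> V \<and> smooth_on \<rho> V \<and>
     (\<forall>x\<in>V. grad \<rho> x \<noteq> 0) \<and> \<Omega> \<inter> V = {x\<in>V. \<rho> x < 0})"

definition smooth_bounded_domain :: "(real^3) set \<Rightarrow> bool" where
  "smooth_bounded_domain \<Omega> \<longleftrightarrow>
     open \<Omega> \<and> connected \<Omega> \<and> \<Omega> \<noteq> {} \<and> bounded \<Omega> \<and> smooth_boundary \<Omega>"


section \<open>Lebesgue and Sobolev spaces\<close>

text \<open>Elements of \<open>L\<^sup>2(\<Omega>)\<close> are represented by functions on the whole space, of which only the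
  values in \<open>\<Omega>\<close>, up to null sets, matter: the norms below are seminorms on representatives,
  and two representatives denote the same element iff their distance is \<open>0\<close>.
  Scalar fields and vector fields (gradients) are treated uniformly.\<close>

definition L2 :: "(real^3) set \<Rightarrow> (real^3 \<Rightarrow> 'b::euclidean_space) set" where
  "L2 \<Omega> = {g. g \<in> borel_measurable (lebesgue_on \<Omega>) \<and>
              integrable (lebesgue_on \<Omega>) (\<lambda>x. (norm (g x))\<^sup>2)}"

definition L2_inner ::
    "(real^3) set \<Rightarrow> (real^3 \<Rightarrow> 'b::euclidean_space) \<Rightarrow> (real^3 \<Rightarrow> 'b) \<Rightarrow> real" where
  "L2_inner \<Omega> f g = (LINT x|lebesgue_on \<Omega>. f x \<bullet> g x)"

definition L2_norm :: "(real^3) set \<Rightarrow> (real^3 \<Rightarrow> 'b::euclidean_space) \<Rightarrow> real" where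
  "L2_norm \<Omega> f = sqrt (L2_inner \<Omega> f f)"

definition test_function :: "(real^3) set \<Rightarrow> (real^3 \<Rightarrow> real) \<Rightarrow> bool" where
  "test_function \<Omega> \<phi> \<longleftrightarrow> smooth_on \<phi> UNIV \<and>
     compact (closure {x. \<phi> x \<noteq> 0}) \<and> closure {x. \<phi> x \<noteq> 0} \<subseteq> \<Omega>"

definition is_weak_gradient ::
    "(real^3) set \<Rightarrow> (real^3 \<Rightarrow> real) \<Rightarrow> (real^3 \<Rightarrow> real^3) \<Rightarrow> bool" where
  "is_weak_gradient \<Omega> u g \<longleftrightarrow> g \<in> L2 \<Omega> \<and>
     (\<forall>\<phi>. test_function \<Omega> \<phi> \<longrightarrow>
        (LINT x|lebesgue_on \<Omega>. u x *\<^sub>R grad \<phi> x) = - (LINT x|lebesgue_on \<Omega>. \<phi> x *\<^sub>R g x))"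

definition H1 :: "(real^3) set \<Rightarrow> (real^3 \<Rightarrow> real) set" where
  "H1 \<Omega> = {u \<in> L2 \<Omega>. \<exists>g. is_weak_gradient \<Omega> u g}"

text \<open>Meaningful only for \<open>u \<in> H1 \<Omega>\<close>, where it is unique up to a null set.\<close>

definition weak_grad :: "(real^3) set \<Rightarrow> (real^3 \<Rightarrow> real) \<Rightarrow> real^3 \<Rightarrow> real^3" where
  "weak_grad \<Omega> u = (SOME g. is_weak_gradient \<Omega> u g)"

definition H10 :: "(real^3) set \<Rightarrow> (real^3 \<Rightarrow> real) set" where
  "H10 \<Omega> = {u \<in> H1 \<Omega>. \<forall>\<epsilon>>0. \<exists>\<phi>. test_function \<Omega> \<phi> \<and>
     L2_norm \<Omega> (\<lambda>x. u x - \<phi> x) < \<epsilon> \<and> L2_norm \<Omega> (\<lambda>x. weak_grad \<Omega> u x - grad \<phi> x) < \<epsilon>}"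

definition dirichlet_eigenvalue :: "(real^3) set \<Rightarrow> real \<Rightarrow> bool" where
  "dirichlet_eigenvalue \<Omega> l \<longleftrightarrow> (\<exists>e\<in>H10 \<Omega>. L2_norm \<Omega> e \<noteq> 0 \<and>
     (\<forall>\<psi>\<in>H10 \<Omega>. L2_inner \<Omega> (weak_grad \<Omega> e) (weak_grad \<Omega> \<psi>) = l * L2_inner \<Omega> e \<psi>))"

definition lambda1 :: "(real^3) set \<Rightarrow> real" where
  "lambda1 \<Omega> = (LEAST l. dirichlet_eigenvalue \<Omega> l)"


section \<open>The nonlinearity\<close>

text \<open>The limit of \<open>f s / s\<close> is taken in the extended reals, since it may be \<open>\<infinity>\<close>;
  the filter \<open>at_infinity\<close> on the reals is \<open>\<bar>s\<bar> \<rightarrow> \<infinity>\<close>.\<close>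

definition admissible_nonlinearity :: "(real^3) set \<Rightarrow> (real \<Rightarrow> real) \<Rightarrow> bool" where
  "admissible_nonlinearity \<Omega> f \<longleftrightarrow> Ck_on 2 f UNIV \<and> f 0 = 0 \<and>
     (\<exists>L>0. \<forall>s. \<bar>deriv (deriv f) s\<bar> \<le> L * (1 + \<bar>s\<bar> ^ 3)) \<and>
     (\<exists>l::ereal. ((\<lambda>s. ereal (f s / s)) \<longlongrightarrow> l) at_infinity \<and> l > ereal (- lambda1 \<Omega>))"


section \<open>The phase space\<close>

type_synonym state = "(real^3 \<Rightarrow> real) \<times> (real^3 \<Rightarrow> real)"

definition phase_space :: "(real^3) set \<Rightarrow> state set" where
  "phase_space \<Omega> = H10 \<Omega> \<times> L2 \<Omega>"

definition phase_norm :: "(real^3) set \<Rightarrow> state \<Rightarrow> real" where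
  "phase_norm \<Omega> U = sqrt ((L2_norm \<Omega> (weak_grad \<Omega> (fst U)))\<^sup>2 + (L2_norm \<Omega> (snd U))\<^sup>2)"

definition phase_dist :: "(real^3) set \<Rightarrow> state \<Rightarrow> state \<Rightarrow> real" where
  "phase_dist \<Omega> U V = phase_norm \<Omega> (\<lambda>x. fst U x - fst V x, \<lambda>x. snd U x - snd V x)"


section \<open>Weak solutions\<close>

text \<open>The damping coefficient \<open>r\<^sup>\<alpha>\<close> with \<open>r\<^sup>0 = 1\<close> also for \<open>r = 0\<close> (whereas \<open>0 powr 0 = 0\<close>).\<close>

definition damping_power :: "real \<Rightarrow> real \<Rightarrow> real" where
  "damping_power r \<alpha> = (if \<alpha> = 0 then 1 else r powr \<alpha>)"

text \<open>\<open>v \<in> L\<^sup>p(0,T;H\<^sub>0\<^sup>1(\<Omega>))\<close> in the sense of Bochner: \<open>v\<close> is almost everywhere the limit in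
  \<open>H\<^sub>0\<^sup>1\<close> of measurable simple functions, and the \<open>p\<close>-th power of its norm is integrable.\<close>

definition Bochner_Lp_H10 ::
    "(real^3) set \<Rightarrow> real \<Rightarrow> real \<Rightarrow> (real \<Rightarrow> real^3 \<Rightarrow> real) \<Rightarrow> bool" where
  "Bochner_Lp_H10 \<Omega> p T v \<longleftrightarrow>
     (AE t in lebesgue_on {0..T}. v t \<in> H10 \<Omega>) \<and>
     (\<exists>s :: nat \<Rightarrow> real \<Rightarrow> real^3 \<Rightarrow> real.
        (\<forall>n. finite (range (s n)) \<and> range (s n) \<subseteq> H10 \<Omega> \<and>
             (\<forall>w. {t\<in>{0..T}. s n t = w} \<in> sets lebesgue)) \<and>
        (AE t in lebesgue_on {0..T}.
           (\<lambda>n. L2_norm \<Omega> (weak_grad \<Omega> (\<lambda>x. s n t x - v t x))) \<longlonglongrightarrow> 0)) \<and>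
     integrable (lebesgue_on {0..T}) (\<lambda>t. L2_norm \<Omega> (weak_grad \<Omega> (v t)) powr p)"

text \<open>\<open>U t\<close> is the pair \<open>(u(t), u\<^sub>t(t))\<close>. As \<open>u\<^sub>t\<close> is continuous into \<open>L\<^sup>2\<close>, the time derivative is
  the strong derivative in \<open>L\<^sup>2\<close> (one-sided at \<open>t = 0\<close>). The term \<open>(f(u), \<psi>)\<close> is the integral of
  \<open>f(u)\<psi>\<close>; \<open>f(u)\<close> itself need not be square integrable.\<close>

definition weak_solution ::
    "(real^3) set \<Rightarrow> real \<Rightarrow> (real \<Rightarrow> real) \<Rightarrow> (real^3 \<Rightarrow> real) \<Rightarrow> state \<Rightarrow> (real \<Rightarrow> state) \<Rightarrow> bool" where
  "weak_solution \<Omega> \<alpha> f h U\<^sub>0 U \<longleftrightarrow>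
     (let u = (\<lambda>t. fst (U t)); v = (\<lambda>t. snd (U t)) in
     (\<forall>t\<ge>0. U t \<in> phase_space \<Omega>) \<and>
     (\<forall>t\<ge>0. ((\<lambda>s. phase_dist \<Omega> (U s) (U t)) \<longlongrightarrow> 0) (at t within {0..})) \<and>
     (\<forall>t\<ge>0. ((\<lambda>s. L2_norm \<Omega> (\<lambda>x. (u s x - u t x) / (s - t) - v t x)) \<longlongrightarrow> 0)
               (at t within {0..})) \<and>
     (\<forall>T>0. Bochner_Lp_H10 \<Omega> (\<alpha> + 2) T v) \<and>
     phase_dist \<Omega> (U 0) U\<^sub>0 = 0 \<and>
     (\<forall>\<psi>\<in>H10 \<Omega>. \<forall>t\<ge>0.
        L2_inner \<Omega> (v t) \<psi>
        + (LINT \<tau>|lebesgue_on {0..t}.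
             L2_inner \<Omega> (weak_grad \<Omega> (u \<tau>)) (weak_grad \<Omega> \<psi>)
             + damping_power (L2_norm \<Omega> (weak_grad \<Omega> (v \<tau>))) \<alpha>
                 * L2_inner \<Omega> (weak_grad \<Omega> (v \<tau>)) (weak_grad \<Omega> \<psi>)
             + L2_inner \<Omega> (\<lambda>x. f (u \<tau> x)) \<psi>)
        = L2_inner \<Omega> (snd U\<^sub>0) \<psi> + (LINT \<tau>|lebesgue_on {0..t}. L2_inner \<Omega> h \<psi>)))"

definition well_posed ::
    "(real^3) set \<Rightarrow> real \<Rightarrow> (real \<Rightarrow> real) \<Rightarrow> (real^3 \<Rightarrow> real) \<Rightarrow> bool" where
  "well_posed \<Omega> \<alpha> f h \<longleftrightarrow> (\<forall>U\<^sub>0\<in>phase_space \<Omega>.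
     (\<exists>U. weak_solution \<Omega> \<alpha> f h U\<^sub>0 U) \<and>
     (\<forall>U V. weak_solution \<Omega> \<alpha> f h U\<^sub>0 U \<longrightarrow> weak_solution \<Omega> \<alpha> f h U\<^sub>0 V \<longrightarrow>
        (\<forall>t\<ge>0. phase_dist \<Omega> (U t) (V t) = 0)))"

definition solution_operator ::
    "(real^3) set \<Rightarrow> real \<Rightarrow> (real \<Rightarrow> real) \<Rightarrow> (real^3 \<Rightarrow> real) \<Rightarrow> real \<Rightarrow> state \<Rightarrow> state" where
  "solution_operator \<Omega> \<alpha> f h t U\<^sub>0 = (SOME U. weak_solution \<Omega> \<alpha> f h U\<^sub>0 U) t"


section \<open>Gradient dynamical systems\<close>

text \<open>Here \<open>X\<close> carries a pseudometric \<open>d\<close>; points at distance \<open>0\<close> are identified. Continuity of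
  \<open>\<Phi>\<close> with respect to \<open>d\<close> makes it constant on such classes.\<close>

definition evolution_semigroup ::
    "'a set \<Rightarrow> ('a \<Rightarrow> 'a \<Rightarrow> real) \<Rightarrow> (real \<Rightarrow> 'a \<Rightarrow> 'a) \<Rightarrow> bool" where
  "evolution_semigroup X d S \<longleftrightarrow>
     (\<forall>t\<ge>0. \<forall>y\<in>X. S t y \<in> X) \<and>
     (\<forall>y\<in>X. d (S 0 y) y = 0) \<and>
     (\<forall>s\<ge>0. \<forall>t\<ge>0. \<forall>y\<in>X. d (S (t + s) y) (S t (S s y)) = 0) \<and>
     (\<forall>y\<in>X. \<forall>t\<ge>0. ((\<lambda>s. d (S s y) (S t y)) \<longlongrightarrow> 0) (at t within {0..}))"

definition strict_lyapunov ::
    "'a set \<Rightarrow> ('a \<Rightarrow> 'a \<Rightarrow> real) \<Rightarrow> (real \<Rightarrow> 'a \<Rightarrow> 'a) \<Rightarrow> ('a \<Rightarrow> real) \<Rightarrow> bool" where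
  "strict_lyapunov X d S \<Phi> \<longleftrightarrow>
     (\<forall>y\<in>X. \<forall>\<epsilon>>0. \<exists>\<delta>>0. \<forall>z\<in>X. d z y < \<delta> \<longrightarrow> \<bar>\<Phi> z - \<Phi> y\<bar> < \<epsilon>) \<and>
     (\<forall>y\<in>X. \<forall>s t. 0 \<le> s \<longrightarrow> s \<le> t \<longrightarrow> \<Phi> (S t y) \<le> \<Phi> (S s y)) \<and>
     (\<forall>y\<in>X. (\<forall>t>0. \<Phi> (S t y) = \<Phi> y) \<longrightarrow> (\<forall>t>0. d (S t y) y = 0))"

definition gradient_system ::
    "'a set \<Rightarrow> ('a \<Rightarrow> 'a \<Rightarrow> real) \<Rightarrow> (real \<Rightarrow> 'a \<Rightarrow> 'a) \<Rightarrow> bool" where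
  "gradient_system X d S \<longleftrightarrow> evolution_semigroup X d S \<and> (\<exists>\<Phi>. strict_lyapunov X d S \<Phi>)"

end

(* The Lyapunov function is the energy
   Phi(u, v) = |grad u|^2 / 2 + |v|^2 / 2 + int F(u) - (h, u) with F' = f, F(0) = 0.
   Since f has quintic growth, Phi is well defined and continuous by the Sobolev inequality
   |u|_6 <= C |grad u|, which comes from a Loomis-Whitney argument for test functions.

   The energy inequality for weak solutions avoids any identification of u_tt in a dual space:
   the weak form between t and t + d is tested with (v(t) + v(t + d)) / 2, which produces the exact
   increment of |v|^2 / 2; the remaining terms differ from the increments of the other parts of Phi
   by the oscillation of u and of v over [t, t + d] in the norm of H10. Averaging over t and letting
   d tend to 0, these errors vanish, because v can be approximated in L^(alpha + 2)(0, T; H10) by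
   continuous functions. Constant energy then forces grad v = 0 for almost all times, so v = 0 and u
   is constant in time. *)
theory Submission
  imports Defs
begin

text \<open>The obstacle is that \<open>v t\<close> lies in \<open>H10\<close> only for almost every
  \<open>t\<close>, with a gradient norm that is merely integrable to the power
  \<open>\<alpha> + 2\<close>. So \<open>v\<close> may serve as a test function only at almost all
  times, and the error of a step involves the distance of \<open>v\<close> at its two ends from a
  continuous approximation; this is small in the mean over \<open>t\<close>, not at a given
  \<open>t\<close>. Hence the average over starting times; continuity of the energy then leads back
  to two prescribed times. Moreover \<open>u\<close> is differentiable in time only in the norm of
  L2. That the increment of \<open>gip (u t) \<psi>\<close> is the time integral of
  \<open>gip (v t) \<psi>\<close> is therefore obtained from functionals that are represented by L2
  functions. In space the exponent 6 is critical: a cubic bound for f'' makes \<open>f\<close>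
  Lipschitz with weight \<open>1 + a^4 + b^4\<close>, and 4 + 1 + 1 = 6 allows weight, increment and
  test function to be estimated by gradient norms alone. Finally, weak gradients are picked by
  \<open>SOME\<close>, so \<open>weak_grad\<close> is linear only almost everywhere.\<close>

section \<open>Square integrable functions\<close>

lemma L2_borel: "f \<in> L2 \<Omega> \<Longrightarrow> f \<in> borel_measurable (lebesgue_on \<Omega>)"
  by (simp add: L2_def)

lemma L2_integrable_sq: "f \<in> L2 \<Omega> \<Longrightarrow> integrable (lebesgue_on \<Omega>) (\<lambda>x. (norm (f x))\<^sup>2)"
  by (simp add: L2_def)

lemma L2_integrable_inner:
  assumes "f \<in> L2 \<Omega>" "g \<in> L2 \<Omega>"
  shows "integrable (lebesgue_on \<Omega>) (\<lambda>x. f x \<bullet> g x)"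
proof (rule Bochner_Integration.integrable_bound)
  show "integrable (lebesgue_on \<Omega>) (\<lambda>x. (norm (f x))\<^sup>2 + (norm (g x))\<^sup>2)"
    using assms by (intro Bochner_Integration.integrable_add L2_integrable_sq)
  show "(\<lambda>x. f x \<bullet> g x) \<in> borel_measurable (lebesgue_on \<Omega>)"
    using assms[THEN L2_borel] by measurable
  have "norm (f x \<bullet> g x) \<le> norm ((norm (f x))\<^sup>2 + (norm (g x))\<^sup>2)" for x
  proof -
    have "\<bar>f x \<bullet> g x\<bar> \<le> norm (f x) * norm (g x)"
      by (rule Cauchy_Schwarz_ineq2)
    also have "\<dots> \<le> (norm (f x))\<^sup>2 + (norm (g x))\<^sup>2"
      using sum_squares_bound[of "norm (f x)" "norm (g x)"]
        mult_nonneg_nonneg[OF norm_ge_zero[of "f x"] norm_ge_zero[of "g x"]] by linarith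
    finally show ?thesis by simp
  qed
  then show "AE x in lebesgue_on \<Omega>. norm (f x \<bullet> g x) \<le> norm ((norm (f x))\<^sup>2 + (norm (g x))\<^sup>2)"
    by simp
qed

lemma L2_add:
  assumes "f \<in> L2 \<Omega>" "g \<in> L2 \<Omega>"
  shows "(\<lambda>x. f x + g x) \<in> L2 \<Omega>"
proof -
  have "integrable (lebesgue_on \<Omega>) (\<lambda>x. (norm (f x))\<^sup>2 + (norm (g x))\<^sup>2 + 2 * (f x \<bullet> g x))"
    using assms by (intro Bochner_Integration.integrable_add L2_integrable_sq
        integrable_mult_right L2_integrable_inner)
  moreover have "(norm (f x + g x))\<^sup>2 = (norm (f x))\<^sup>2 + (norm (g x))\<^sup>2 + 2 * (f x \<bullet> g x)" for x
    by (simp add: power2_norm_eq_inner inner_add_left inner_add_right inner_commute)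
  ultimately show ?thesis
    using assms[THEN L2_borel] by (simp add: L2_def)
qed

lemma L2_scale:
  assumes "f \<in> L2 \<Omega>" shows "(\<lambda>x. c *\<^sub>R f x) \<in> L2 \<Omega>"
  using L2_borel[OF assms] integrable_mult_right[OF L2_integrable_sq[OF assms], of "c\<^sup>2"]
  by (simp add: L2_def power_mult_distrib)

lemma L2_zero: "(\<lambda>x. 0) \<in> L2 \<Omega>"
  by (simp add: L2_def)

lemma L2_diff:
  assumes "f \<in> L2 \<Omega>" "g \<in> L2 \<Omega>"
  shows "(\<lambda>x. f x - g x) \<in> L2 \<Omega>"
  using L2_add[OF assms(1) L2_scale[OF assms(2), of "-1"]] by simp

lemma L2_mult:
  fixes f :: "real^3 \<Rightarrow> real"
  shows "f \<in> L2 \<Omega> \<Longrightarrow> (\<lambda>x. c * f x) \<in> L2 \<Omega>"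
  using L2_scale[of f \<Omega> c] by simp

lemma L2_inner_commute: "L2_inner \<Omega> f g = L2_inner \<Omega> g f"
  by (simp add: L2_inner_def inner_commute)

lemma L2_inner_add_left:
  assumes "f \<in> L2 \<Omega>" "g \<in> L2 \<Omega>" "k \<in> L2 \<Omega>"
  shows "L2_inner \<Omega> (\<lambda>x. f x + g x) k = L2_inner \<Omega> f k + L2_inner \<Omega> g k"
  using assms by (simp add: L2_inner_def inner_add_left L2_integrable_inner)

lemma L2_inner_diff_left:
  assumes "f \<in> L2 \<Omega>" "g \<in> L2 \<Omega>" "k \<in> L2 \<Omega>"
  shows "L2_inner \<Omega> (\<lambda>x. f x - g x) k = L2_inner \<Omega> f k - L2_inner \<Omega> g k"
  using assms by (simp add: L2_inner_def inner_diff_left L2_integrable_inner)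

lemma L2_inner_scale_left: "L2_inner \<Omega> (\<lambda>x. c *\<^sub>R f x) k = c * L2_inner \<Omega> f k"
  by (simp add: L2_inner_def)

lemma L2_inner_mult_left:
  fixes f :: "real^3 \<Rightarrow> real"
  shows "L2_inner \<Omega> (\<lambda>x. c * f x) k = c * L2_inner \<Omega> f k"
  using L2_inner_scale_left[of \<Omega> c f k] by simp

lemma L2_inner_add_right:
  assumes "f \<in> L2 \<Omega>" "g \<in> L2 \<Omega>" "k \<in> L2 \<Omega>"
  shows "L2_inner \<Omega> k (\<lambda>x. f x + g x) = L2_inner \<Omega> k f + L2_inner \<Omega> k g"
  using L2_inner_add_left[OF assms] by (simp add: L2_inner_commute)

lemma L2_inner_diff_right:
  assumes "f \<in> L2 \<Omega>" "g \<in> L2 \<Omega>" "k \<in> L2 \<Omega>"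
  shows "L2_inner \<Omega> k (\<lambda>x. f x - g x) = L2_inner \<Omega> k f - L2_inner \<Omega> k g"
  using L2_inner_diff_left[OF assms] by (simp add: L2_inner_commute)

lemma L2_inner_mult_right:
  fixes f :: "real^3 \<Rightarrow> real"
  shows "L2_inner \<Omega> k (\<lambda>x. c * f x) = c * L2_inner \<Omega> k f"
  using L2_inner_mult_left[of \<Omega> c f k] by (simp add: L2_inner_commute)

lemma L2_inner_self: "L2_inner \<Omega> f f = (LINT x|lebesgue_on \<Omega>. (norm (f x))\<^sup>2)"
  by (simp add: L2_inner_def power2_norm_eq_inner)

lemma L2_inner_self_nonneg: "0 \<le> L2_inner \<Omega> f f"
  by (simp add: L2_inner_self)

lemma L2_norm_nonneg: "0 \<le> L2_norm \<Omega> f"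
  by (simp add: L2_norm_def L2_inner_self_nonneg)

lemma L2_norm_sq: "(L2_norm \<Omega> f)\<^sup>2 = L2_inner \<Omega> f f"
  by (simp add: L2_norm_def L2_inner_self_nonneg)

lemma L2_norm_scale: "L2_norm \<Omega> (\<lambda>x. c *\<^sub>R f x) = \<bar>c\<bar> * L2_norm \<Omega> f"
proof -
  have "L2_inner \<Omega> (\<lambda>x. c *\<^sub>R f x) (\<lambda>x. c *\<^sub>R f x) = c\<^sup>2 * L2_inner \<Omega> f f"
    by (simp add: L2_inner_self power_mult_distrib)
  then show ?thesis by (simp add: L2_norm_def real_sqrt_mult)
qed

lemma L2_inner_cong_AE:
  assumes "f \<in> borel_measurable (lebesgue_on \<Omega>)" "f' \<in> borel_measurable (lebesgue_on \<Omega>)"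
    and "g \<in> borel_measurable (lebesgue_on \<Omega>)" "g' \<in> borel_measurable (lebesgue_on \<Omega>)"
    and "AE x in lebesgue_on \<Omega>. f x = f' x" "AE x in lebesgue_on \<Omega>. g x = g' x"
  shows "L2_inner \<Omega> f g = L2_inner \<Omega> f' g'"
  unfolding L2_inner_def
proof (rule integral_cong_AE)
  show "AE x in lebesgue_on \<Omega>. f x \<bullet> g x = f' x \<bullet> g' x"
    using assms(5,6) by eventually_elim simp
qed (use assms in measurable)

lemma L2_norm_cong_AE:
  assumes "f \<in> borel_measurable (lebesgue_on \<Omega>)" "g \<in> borel_measurable (lebesgue_on \<Omega>)"
    and "AE x in lebesgue_on \<Omega>. f x = g x"
  shows "L2_norm \<Omega> f = L2_norm \<Omega> g"
  using L2_inner_cong_AE[OF assms(1,2,1,2,3,3)] by (simp add: L2_norm_def)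

lemma L2_norm_zero_iff:
  assumes "f \<in> L2 \<Omega>"
  shows "L2_norm \<Omega> f = 0 \<longleftrightarrow> (AE x in lebesgue_on \<Omega>. f x = 0)"
proof -
  have "L2_norm \<Omega> f = 0 \<longleftrightarrow> (LINT x|lebesgue_on \<Omega>. (norm (f x))\<^sup>2) = 0"
    by (simp add: L2_norm_def L2_inner_self)
  also have "\<dots> \<longleftrightarrow> (AE x in lebesgue_on \<Omega>. (norm (f x))\<^sup>2 = 0)"
    by (rule integral_nonneg_eq_0_iff_AE) (use L2_integrable_sq[OF assms] in auto)
  finally show ?thesis by simp
qed

text \<open>The minimum of the quadratic lies at \<open>t = - b / c\<close> and has the value
  \<open>a - b\<^sup>2 / c\<close>. If \<open>c = 0\<close>, an affine function that is bounded
  below must be constant.\<close>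

lemma discriminant_bound:
  fixes a b c :: real
  assumes "\<And>t. 0 \<le> a + 2 * t * b + t\<^sup>2 * c" "0 \<le> c"
  shows "b\<^sup>2 \<le> a * c"
proof (cases "c = 0")
  case True
  then have nn: "0 \<le> a + 2 * t * b" for t using assms(1)[of t] by simp
  have "b = 0"
  proof (rule ccontr)
    assume "b \<noteq> 0"
    \<comment> \<open>This choice of \<open>t\<close> would give the affine function the value
      -1.\<close>
    then have "2 * (- (a + 1) / (2 * b)) * b = - (a + 1)" by (simp add: field_simps)
    with nn[of "- (a + 1) / (2 * b)"] show False by linarith
  qed
  then show ?thesis using True by simp
next
  case False
  then have "c > 0" using assms(2) by simp
  have "0 \<le> a + 2 * (- b / c) * b + (- b / c)\<^sup>2 * c" by (rule assms(1))
  also have "\<dots> = a - b\<^sup>2 / c" using \<open>c > 0\<close> by (simp add: field_simps power2_eq_square)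
  finally show ?thesis using \<open>c > 0\<close> by (simp add: field_simps)
qed

text \<open>The squared norm of f + t g is a nonnegative quadratic in t. The discriminant argument
  includes representatives \<open>g\<close> of seminorm zero.\<close>

lemma L2_Cauchy_Schwarz:
  assumes f: "f \<in> L2 \<Omega>" and g: "g \<in> L2 \<Omega>"
  shows "\<bar>L2_inner \<Omega> f g\<bar> \<le> L2_norm \<Omega> f * L2_norm \<Omega> g"
proof -
  have "0 \<le> L2_inner \<Omega> f f + 2 * t * L2_inner \<Omega> f g + t\<^sup>2 * L2_inner \<Omega> g g" for t
  proof -
    let ?g = "\<lambda>x. t *\<^sub>R g x"
    have tg: "?g \<in> L2 \<Omega>" by (rule L2_scale[OF g])
    have s: "(\<lambda>x. f x + ?g x) \<in> L2 \<Omega>" by (rule L2_add[OF f tg])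
    have "0 \<le> L2_inner \<Omega> (\<lambda>x. f x + ?g x) (\<lambda>x. f x + ?g x)"
      by (rule L2_inner_self_nonneg)
    also have "\<dots> = L2_inner \<Omega> f f + L2_inner \<Omega> f ?g + (L2_inner \<Omega> ?g f + L2_inner \<Omega> ?g ?g)"
      by (simp only: L2_inner_add_left[OF f tg s] L2_inner_add_right[OF f tg f]
          L2_inner_add_right[OF f tg tg])
    also have "\<dots> = L2_inner \<Omega> f f + 2 * t * L2_inner \<Omega> f g + t\<^sup>2 * L2_inner \<Omega> g g"
      by (simp only: L2_inner_scale_left L2_inner_commute[of \<Omega> f ?g] L2_inner_commute[of \<Omega> g ?g]
          L2_inner_commute[of \<Omega> g f]) (simp add: power2_eq_square)
    finally show ?thesis .
  qed
  then have "(L2_inner \<Omega> f g)\<^sup>2 \<le> L2_inner \<Omega> f f * L2_inner \<Omega> g g"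
    by (rule discriminant_bound) (rule L2_inner_self_nonneg)
  also have "\<dots> = (L2_norm \<Omega> f * L2_norm \<Omega> g)\<^sup>2"
    by (simp add: power_mult_distrib L2_norm_sq)
  finally show ?thesis
    by (rule abs_le_square_iff[THEN iffD2, of "L2_inner \<Omega> f g" "L2_norm \<Omega> f * L2_norm \<Omega> g",
        THEN order_trans]) (simp add: L2_norm_nonneg)
qed

lemma L2_norm_triangle:
  assumes f: "f \<in> L2 \<Omega>" and g: "g \<in> L2 \<Omega>"
  shows "L2_norm \<Omega> (\<lambda>x. f x + g x) \<le> L2_norm \<Omega> f + L2_norm \<Omega> g"
proof (rule power2_le_imp_le)
  have s: "(\<lambda>x. f x + g x) \<in> L2 \<Omega>" by (rule L2_add[OF f g])
  have "(L2_norm \<Omega> (\<lambda>x. f x + g x))\<^sup>2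
      = L2_inner \<Omega> f f + 2 * L2_inner \<Omega> f g + L2_inner \<Omega> g g"
    by (simp add: L2_norm_sq L2_inner_add_left[OF f g s] L2_inner_add_right[OF f g f]
          L2_inner_add_right[OF f g g] L2_inner_commute[of \<Omega> g f])
  also have "\<dots> \<le> (L2_norm \<Omega> f + L2_norm \<Omega> g)\<^sup>2"
    using L2_Cauchy_Schwarz[OF f g] by (simp add: power2_sum L2_norm_sq)
  finally show "(L2_norm \<Omega> (\<lambda>x. f x + g x))\<^sup>2 \<le> (L2_norm \<Omega> f + L2_norm \<Omega> g)\<^sup>2" .
qed (simp add: L2_norm_nonneg)

lemma L2_norm_minus_commute: "L2_norm \<Omega> (\<lambda>x. f x - g x) = L2_norm \<Omega> (\<lambda>x. g x - f x)"
  using L2_norm_scale[of \<Omega> "-1" "\<lambda>x. f x - g x"] by simp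

lemma L2_norm_triangle_diff:
  assumes "f \<in> L2 \<Omega>" "g \<in> L2 \<Omega>" "k \<in> L2 \<Omega>"
  shows "L2_norm \<Omega> (\<lambda>x. f x - g x) \<le> L2_norm \<Omega> (\<lambda>x. f x - k x) + L2_norm \<Omega> (\<lambda>x. k x - g x)"
  using L2_norm_triangle[OF L2_diff[OF assms(1,3)] L2_diff[OF assms(3,2)]] by simp

section \<open>Smooth functions\<close>

lemma Ck_on_continuous: "Ck_on k f UNIV \<Longrightarrow> continuous_on UNIV f"
  by (cases k) (auto intro!: continuous_at_imp_continuous_on differentiable_imp_continuous_within)

lemma Ck_on_SucD: "Ck_on (Suc k) f UNIV \<Longrightarrow> Ck_on k f UNIV"
proof (induction k arbitrary: f)
  case 0
  then show ?case using Ck_on_continuous by (metis Ck_on.simps(1))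
next
  case (Suc k)
  then show ?case by (metis Ck_on.simps(2))
qed

lemma Ck_on_const: "Ck_on k (\<lambda>x. c) UNIV"
  by (induction k arbitrary: c) (auto simp: frechet_derivative_const)

lemma frechet_derivative_at': "(f has_derivative f') (at x) \<Longrightarrow> frechet_derivative f (at x) = f'"
  using frechet_derivative_at by metis

lemma Ck_on_add: "Ck_on k f UNIV \<Longrightarrow> Ck_on k g UNIV \<Longrightarrow> Ck_on k (\<lambda>x. f x + g x) UNIV"
proof (induction k arbitrary: f g)
  case (Suc k)
  have "frechet_derivative (\<lambda>x. f x + g x) (at x) =
      (\<lambda>b. frechet_derivative f (at x) b + frechet_derivative g (at x) b)" for x
    using Suc.prems by (intro frechet_derivative_at' has_derivative_add)
      (auto simp flip: frechet_derivative_works)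
  then show ?case using Suc by (auto intro: differentiable_add)
qed (auto intro: continuous_on_add)

text \<open>The product rule brings back the undifferentiated factors, so the induction also uses
  that \<open>Ck_on\<close> descends from \<open>Suc k\<close> to \<open>k\<close>.\<close>

lemma Ck_on_mult: "Ck_on k f UNIV \<Longrightarrow> Ck_on k g UNIV \<Longrightarrow> Ck_on k (\<lambda>x. f x * g x) UNIV"
proof (induction k arbitrary: f g)
  case (Suc k)
  have "frechet_derivative (\<lambda>x. f x * g x) (at x) =
      (\<lambda>b. f x * frechet_derivative g (at x) b + frechet_derivative f (at x) b * g x)" for x
    using Suc.prems by (intro frechet_derivative_at' has_derivative_mult)
      (auto simp flip: frechet_derivative_works)
  moreover have "Ck_on k f UNIV" "Ck_on k g UNIV"
    using Suc.prems by (auto intro: Ck_on_SucD)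
  ultimately show ?case using Suc by (auto intro!: differentiable_mult Ck_on_add)
qed (auto intro: continuous_on_mult)

lemma Ck_on_prod:
  "finite I \<Longrightarrow> (\<And>i. i \<in> I \<Longrightarrow> Ck_on k (f i) UNIV) \<Longrightarrow> Ck_on k (\<lambda>x. \<Prod>i\<in>I. f i x) UNIV"
  by (induction I rule: finite_induct) (auto intro: Ck_on_const Ck_on_mult)

text \<open>Derivatives of the standard flat function stay in the span of this family.\<close>

definition flat_exp :: "nat \<Rightarrow> real \<Rightarrow> real" where
  "flat_exp m x = (if 0 < x then exp (- inverse x) * inverse x ^ m else 0)"

text \<open>With y = 1 / x the limit from the right is that of y^m / exp y at infinity; on the left
  the function vanishes.\<close>

lemma flat_exp_tendsto_0: "(flat_exp m \<longlongrightarrow> 0) (at 0)"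
proof -
  have "((\<lambda>x. inverse x ^ m / exp (inverse x)) \<longlongrightarrow> (0::real)) (at_right 0)"
    using filterlim_compose[OF tendsto_power_div_exp_0 filterlim_inverse_at_top_right] .
  then have right: "(flat_exp m \<longlongrightarrow> 0) (at_right 0)"
  proof (rule Lim_transform_eventually)
    show "\<forall>\<^sub>F x in at_right 0. inverse x ^ m / exp (inverse x) = flat_exp m x"
      by (auto simp: flat_exp_def eventually_at_filter exp_minus divide_inverse)
  qed
  have left: "(flat_exp m \<longlongrightarrow> 0) (at_left 0)"
    by (rule Lim_transform_eventually[OF tendsto_const])
      (auto simp: flat_exp_def eventually_at_filter)
  show ?thesis using left right by (rule filterlim_split_at)
qed

text \<open>For positive \<open>x\<close> this is the product rule. At 0 the difference quotient of
  \<open>flat_exp m\<close> is exactly \<open>flat_exp (m + 1)\<close>, whose limit is already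
  known.\<close>

lemma flat_exp_deriv:
  "(flat_exp m has_real_derivative (flat_exp (m + 2) x - real m * flat_exp (m + 1) x)) (at x)"
proof (cases x "0::real" rule: linorder_cases)
  case greater
  have i: "(inverse has_real_derivative - (inverse x)\<^sup>2) (at x)"
    using DERIV_inverse[of x] greater by (simp add: numeral_2_eq_2)
  have "((\<lambda>x. exp (- inverse x) * inverse x ^ m) has_real_derivative
      exp (- inverse x) * - (- (inverse x)\<^sup>2) * inverse x ^ m +
      (real m * (- (inverse x)\<^sup>2 * inverse x ^ (m - Suc 0))) * exp (- inverse x)) (at x)"
    using DERIV_mult[OF DERIV_fun_exp[OF DERIV_minus[OF i]] DERIV_power[OF i, of m]] by simp
  also have "exp (- inverse x) * - (- (inverse x)\<^sup>2) * inverse x ^ m +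
      (real m * (- (inverse x)\<^sup>2 * inverse x ^ (m - Suc 0))) * exp (- inverse x)
      = flat_exp (m + 2) x - real m * flat_exp (m + 1) x"
    using greater by (cases m) (simp_all add: flat_exp_def power2_eq_square)
  finally have "((\<lambda>x. exp (- inverse x) * inverse x ^ m) has_real_derivative
      (flat_exp (m + 2) x - real m * flat_exp (m + 1) x)) (at x)" .
  then show ?thesis
  proof (rule has_field_derivative_transform_within_open[where S = "{0<..}"])
  qed (use greater in \<open>auto simp: flat_exp_def\<close>)
next
  case less
  have "((\<lambda>x. 0) has_real_derivative 0) (at x)" by simp
  then have "(flat_exp m has_real_derivative 0) (at x)"
  proof (rule has_field_derivative_transform_within_open[where S = "{..<0}"])
  qed (use less in \<open>auto simp: flat_exp_def\<close>)
  then show ?thesis using less by (simp add: flat_exp_def)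
next
  case equal
  have "(\<lambda>y. (flat_exp m y - flat_exp m 0) / (y - 0)) = flat_exp (m + 1)"
    by (auto simp: flat_exp_def divide_inverse)
  then have "(flat_exp m has_real_derivative 0) (at 0)"
    using flat_exp_tendsto_0[of "m + 1"] by (simp add: has_field_derivative_iff)
  then show ?thesis using equal by (simp add: flat_exp_def)
qed

text \<open>Differentiation only changes \<open>m\<close>, hence the induction for arbitrary
  \<open>m\<close>. The affine argument will be the scaled distance to a face of a box.\<close>

lemma flat_exp_affine_Ck: "Ck_on k (\<lambda>x::'a::euclidean_space. flat_exp m (c + x \<bullet> w)) UNIV"
proof (induction k arbitrary: m)
  case 0
  have "continuous_on UNIV (flat_exp m)"
    by (rule DERIV_continuous_on) (rule has_field_derivative_at_within[OF flat_exp_deriv])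
  then have "continuous_on UNIV (\<lambda>x. flat_exp m (c + x \<bullet> w))"
    by (rule continuous_on_compose2) (auto intro!: continuous_intros)
  then show ?case by simp
next
  case (Suc k)
  have d: "((\<lambda>x. flat_exp m (c + x \<bullet> w)) has_derivative
     (\<lambda>b. (flat_exp (m + 2) (c + x \<bullet> w) - real m * flat_exp (m + 1) (c + x \<bullet> w)) * (b \<bullet> w))) (at x)" for x
  proof (rule has_derivative_compose[where f = "\<lambda>x. c + x \<bullet> w" and g = "flat_exp m"
        and f' = "\<lambda>b. b \<bullet> w" and g' = "(*) (flat_exp (m + 2) (c + x \<bullet> w)
          - real m * flat_exp (m + 1) (c + x \<bullet> w))"])
    show "((\<lambda>x. c + x \<bullet> w) has_derivative (\<lambda>b. b \<bullet> w)) (at x)"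
      using has_derivative_add[OF has_derivative_const
          bounded_linear_imp_has_derivative[OF bounded_linear_inner_left]] by simp
    show "(flat_exp m has_derivative (*) (flat_exp (m + 2) (c + x \<bullet> w)
        - real m * flat_exp (m + 1) (c + x \<bullet> w))) (at (c + x \<bullet> w))"
      using flat_exp_deriv by (rule has_field_derivative_imp_has_derivative)
  qed
  have eq: "frechet_derivative (\<lambda>x. flat_exp m (c + x \<bullet> w)) (at x) b =
     (flat_exp (m + 2) (c + x \<bullet> w) + (- real m) * flat_exp (m + 1) (c + x \<bullet> w)) * (b \<bullet> w)" for x b
    by (simp add: frechet_derivative_at'[OF d])
  show ?case
    unfolding Ck_on.simps eq
    by (intro conjI ballI differentiableI[OF d] Ck_on_mult Ck_on_add Ck_on_const Suc)
qed

section \<open>Test functions\<close>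

lemma test_function_Ck: "test_function \<Omega> \<phi> \<Longrightarrow> Ck_on k \<phi> UNIV"
  by (simp add: test_function_def smooth_on_def)

lemma test_function_continuous: "test_function \<Omega> \<phi> \<Longrightarrow> continuous_on UNIV \<phi>"
  using Ck_on_continuous[OF test_function_Ck[of _ _ 0]] .

lemma test_function_deriv:
  "test_function \<Omega> \<phi> \<Longrightarrow> (\<phi> has_derivative frechet_derivative \<phi> (at x)) (at x)"
  using test_function_Ck[of \<Omega> \<phi> 1] by (simp flip: frechet_derivative_works)

lemma test_functionI:
  assumes "\<And>k. Ck_on k \<phi> UNIV" "closed K" "bounded K" "K \<subseteq> \<Omega>" "\<And>x. x \<notin> K \<Longrightarrow> \<phi> x = 0"
  shows "test_function \<Omega> \<phi>"
proof -
  have "closure {x. \<phi> x \<noteq> 0} \<subseteq> K"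
    using assms(2,5) by (intro closure_minimal) auto
  then show ?thesis
    using assms(1,3,4) by (auto simp: test_function_def smooth_on_def compact_eq_bounded_closed
        intro: bounded_subset)
qed

text \<open>The complement of the closed support is open, so the function vanishes near each of its
  points; this makes the derivatives vanish there as well.\<close>

lemma test_function_support:
  assumes "test_function \<Omega> \<phi>"
  obtains K where "compact K" "K \<subseteq> \<Omega>" "\<And>x. x \<notin> K \<Longrightarrow> \<phi> x = 0"
    "\<And>x b. x \<notin> K \<Longrightarrow> frechet_derivative \<phi> (at x) b = 0"
proof -
  define K where "K = closure {x. \<phi> x \<noteq> 0}"
  have K: "compact K" "K \<subseteq> \<Omega>"
    using assms by (auto simp: test_function_def K_def)
  have z: "\<phi> x = 0" if "x \<notin> K" for x
    using that closure_subset[of "{x. \<phi> x \<noteq> 0}"] by (auto simp: K_def)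
  have "frechet_derivative \<phi> (at x) b = 0" if "x \<notin> K" for x b
  proof -
    have "((\<lambda>x. 0::real) has_derivative (\<lambda>b. 0)) (at x)" by simp
    then have "(\<phi> has_derivative (\<lambda>b. 0)) (at x)"
      by (rule has_derivative_transform_within_open[where s = "- K"])
        (use K z that in \<open>auto simp: compact_imp_closed open_Compl\<close>)
    then show ?thesis by (simp add: frechet_derivative_at')
  qed
  then show ?thesis using that K z by blast
qed

lemma continuous_compact_support_bounded:
  fixes f :: "'a::topological_space \<Rightarrow> 'b::real_normed_vector"
  assumes "continuous_on UNIV f" "compact K" "\<And>x. x \<notin> K \<Longrightarrow> f x = 0"
  shows "\<exists>B\<ge>0. \<forall>x. norm (f x) \<le> B"
proof -
  have "bounded (f ` K)"
    by (intro compact_imp_bounded compact_continuous_image continuous_on_subset[OF assms(1)] assms(2)) simp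
  then obtain B where "\<forall>y\<in>f ` K. norm y \<le> B" by (auto simp: bounded_iff)
  then have "norm (f x) \<le> max B 0" for x
    using assms(3)[of x] by (cases "x \<in> K") (auto intro: max.coboundedI1)
  then show ?thesis by (intro exI[of _ "max B 0"]) simp
qed

lemma test_function_bounded:
  assumes "test_function \<Omega> \<phi>"
  obtains B where "B \<ge> 0" "\<And>x. \<bar>\<phi> x\<bar> \<le> B"
proof -
  obtain K where "compact K" "\<And>x. x \<notin> K \<Longrightarrow> \<phi> x = 0"
    using test_function_support[OF assms] by metis
  then show ?thesis
    using continuous_compact_support_bounded[OF test_function_continuous[OF assms]] that
    by (metis real_norm_def)
qed

text \<open>This allows a partial derivative to be inserted into the definition of the weak
  gradient, which is how second derivatives enter later.\<close>

lemma test_function_partial: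
  assumes "test_function \<Omega> \<phi>"
  shows "test_function \<Omega> (\<lambda>x. frechet_derivative \<phi> (at x) (axis i 1))"
proof -
  obtain K where K: "compact K" "K \<subseteq> \<Omega>" "\<And>x b. x \<notin> K \<Longrightarrow> frechet_derivative \<phi> (at x) b = 0"
    using test_function_support[OF assms] by metis
  have "axis i 1 \<in> (Basis :: (real^3) set)" by (simp add: axis_in_Basis_iff)
  then have "Ck_on k (\<lambda>x. frechet_derivative \<phi> (at x) (axis i 1)) UNIV" for k
    using test_function_Ck[OF assms, of "Suc k"] by simp
  then show ?thesis
    using K by (intro test_functionI[of _ K]) (simp_all add: compact_eq_bounded_closed)
qed

lemma test_function_mult:
  assumes "test_function \<Omega> \<phi>" shows "test_function \<Omega> (\<lambda>x. c * \<phi> x)"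
proof -
  obtain K where K: "compact K" "K \<subseteq> \<Omega>" "\<And>x. x \<notin> K \<Longrightarrow> \<phi> x = 0"
    using test_function_support[OF assms] by metis
  then show ?thesis
    using test_function_Ck[OF assms]
    by (intro test_functionI[of _ K] Ck_on_mult Ck_on_const) (simp_all add: compact_eq_bounded_closed)
qed

lemma test_function_add:
  assumes "test_function \<Omega> \<phi>" "test_function \<Omega> \<psi>"
  shows "test_function \<Omega> (\<lambda>x. \<phi> x + \<psi> x)"
proof -
  obtain K where K: "compact K" "K \<subseteq> \<Omega>" "\<And>x. x \<notin> K \<Longrightarrow> \<phi> x = 0"
    using test_function_support[OF assms(1)] by metis
  obtain L where L: "compact L" "L \<subseteq> \<Omega>" "\<And>x. x \<notin> L \<Longrightarrow> \<psi> x = 0"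
    using test_function_support[OF assms(2)] by metis
  show ?thesis
    using assms[THEN test_function_Ck] K L compact_Un[OF K(1) L(1)]
    by (intro test_functionI[of _ "K \<union> L"] Ck_on_add) (simp_all add: compact_eq_bounded_closed)
qed

lemma grad_nth: "grad \<phi> x $ i = frechet_derivative \<phi> (at x) (axis i 1)"
  by (simp add: grad_def)

lemma grad_add_mult:
  assumes "test_function \<Omega> \<phi>" "test_function \<Omega> \<psi>"
  shows "grad (\<lambda>x. \<phi> x + c * \<psi> x) x = grad \<phi> x + c *\<^sub>R grad \<psi> x"
proof -
  have "((\<lambda>x. \<phi> x + c * \<psi> x) has_derivative (\<lambda>b. frechet_derivative \<phi> (at x) b
      + c * frechet_derivative \<psi> (at x) b)) (at x)"
    using assms by (intro has_derivative_add has_derivative_mult_right test_function_deriv)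
  then show ?thesis by (simp add: vec_eq_iff grad_nth frechet_derivative_at')
qed

lemma grad_continuous:
  assumes "test_function \<Omega> \<phi>"
  shows "continuous_on UNIV (grad \<phi>)"
  unfolding grad_def
  by (intro continuous_on_vec_lambda test_function_continuous[OF test_function_partial[OF assms]])

lemma grad_bounded:
  assumes "test_function \<Omega> \<phi>"
  obtains B where "B \<ge> 0" "\<And>x. norm (grad \<phi> x) \<le> B"
proof -
  obtain K where K: "compact K" "\<And>x b. x \<notin> K \<Longrightarrow> frechet_derivative \<phi> (at x) b = 0"
    using test_function_support[OF assms] by metis
  then have "grad \<phi> x = 0" if "x \<notin> K" for x
    using that by (simp add: vec_eq_iff grad_nth)
  then show ?thesis
    using continuous_compact_support_bounded[OF grad_continuous[OF assms] K(1)] that by metis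
qed

lemma continuous_borel_lebesgue_on:
  fixes f :: "'a::euclidean_space \<Rightarrow> 'b::euclidean_space"
  shows "continuous_on UNIV f \<Longrightarrow> f \<in> borel_measurable (lebesgue_on S)"
  by (intro measurable_restrict_space1 measurable_completion)
    (simp add: borel_measurable_continuous_onI)

text \<open>A smooth function that lives on the box between \<open>a\<close> and \<open>b\<close>.
  Each factor is exp (- 1 / s) of the distance to a face, magnified by \<open>n\<close>, so that it
  approaches 1 inside the box as \<open>n\<close> grows.\<close>

definition bump :: "real^3 \<Rightarrow> real^3 \<Rightarrow> nat \<Rightarrow> real^3 \<Rightarrow> real" where
  "bump a b n x = (\<Prod>i\<in>UNIV. flat_exp 0 (real n * (x $ i - a $ i)) * flat_exp 0 (real n * (b $ i - x $ i)))"

lemma bump_Ck: "Ck_on k (bump a b n) UNIV"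
proof -
  have "bump a b n = (\<lambda>x. \<Prod>i\<in>UNIV. flat_exp 0 (- real n * a $ i + x \<bullet> (real n *\<^sub>R axis i 1))
      * flat_exp 0 (real n * b $ i + x \<bullet> (- real n *\<^sub>R axis i 1)))"
    by (simp add: bump_def fun_eq_iff inner_axis algebra_simps)
  then show ?thesis
    by (simp only:) (intro Ck_on_prod Ck_on_mult flat_exp_affine_Ck finite)
qed

lemma bump_test_function:
  assumes "cbox a b \<subseteq> \<Omega>" shows "test_function \<Omega> (bump a b n)"
proof (rule test_functionI[of _ "cbox a b"])
  fix x :: "real^3" assume "x \<notin> cbox a b"
  then obtain i where "x $ i < a $ i \<or> b $ i < x $ i"
    by (auto simp: mem_box_cart not_le)
  then have "real n * (x $ i - a $ i) \<le> 0 \<or> real n * (b $ i - x $ i) \<le> 0"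
    by (auto simp: mult_nonneg_nonpos)
  then have "flat_exp 0 (real n * (x $ i - a $ i)) * flat_exp 0 (real n * (b $ i - x $ i)) = 0"
    by (auto simp: flat_exp_def)
  then show "bump a b n x = 0" unfolding bump_def by (intro prod_zero) auto
qed (use assms bump_Ck in \<open>auto simp: bounded_cbox closed_cbox\<close>)

lemma flat_exp_0_bound: "0 \<le> flat_exp 0 t \<and> flat_exp 0 t \<le> 1"
  by (simp add: flat_exp_def)

lemma bump_bound: "\<bar>bump a b n x\<bar> \<le> 1"
proof -
  have "norm (bump a b n x) \<le> 1" unfolding bump_def prod_norm[symmetric]
    by (intro prod_le_1) (auto simp: flat_exp_0_bound abs_mult intro!: mult_le_one)
  then show ?thesis by simp
qed

text \<open>For positive t, exp (- 1 / (n t)) tends to 1, while the factor is 0 for t at most 0;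
  boundary points therefore get the limit 0 and the limit is the indicator of the open box.\<close>

lemma bump_tendsto: "(\<lambda>n. bump a b n x) \<longlonglongrightarrow> indicat_real (box a b) x"
proof -
  have lim: "(\<lambda>n. flat_exp 0 (real n * t)) \<longlonglongrightarrow> (if 0 < t then 1 else 0)" for t
  proof (cases "0 < t")
    case True
    have "(\<lambda>n. exp (- (inverse (real n) * inverse t))) \<longlonglongrightarrow> exp (- (0 * inverse t))"
      by (intro tendsto_intros lim_inverse_n)
    then have "(\<lambda>n. exp (- inverse (real n * t))) \<longlonglongrightarrow> 1" by simp
    \<comment> \<open>The two sequences differ at \<open>n = 0\<close>: there
      \<open>inverse 0 = 0\<close> gives 1, but \<open>flat_exp 0 0 = 0\<close>. They agree from 1
      on.\<close>
    then have "(\<lambda>n. flat_exp 0 (real n * t)) \<longlonglongrightarrow> 1"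
      by (rule Lim_transform_eventually)
        (use True in \<open>auto simp: flat_exp_def eventually_sequentially intro!: exI[of _ 1]\<close>)
    then show ?thesis using True by simp
  next
    case False
    then have "flat_exp 0 (real n * t) = 0" for n by (simp add: flat_exp_def mult_nonneg_nonpos not_less)
    then show ?thesis using False by simp
  qed
  have "(\<lambda>n. bump a b n x) \<longlonglongrightarrow>
    (\<Prod>i\<in>UNIV. (if 0 < x $ i - a $ i then 1 else 0) * (if 0 < b $ i - x $ i then 1 else 0))"
    unfolding bump_def by (intro tendsto_prod tendsto_mult lim)
  also have "(\<Prod>i\<in>UNIV. (if 0 < x $ i - a $ i then 1 else 0) * (if 0 < b $ i - x $ i then 1 else 0))
      = indicat_real (box a b) x"
    by (cases "x \<in> box a b") (auto simp: mem_box_cart intro!: prod_zero prod.neutral)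
  finally show ?thesis .
qed

section \<open>Weak gradients and the space of functions vanishing on the boundary\<close>

locale bounded_open_set =
  fixes \<Omega> :: "(real^3) set"
  assumes open_dom: "open \<Omega>" and bounded_dom: "bounded \<Omega>"
begin

lemma dom_lebesgue [simp]: "\<Omega> \<in> sets lebesgue"
  using open_dom by simp

lemma finite_measure_dom: "finite_measure (lebesgue_on \<Omega>)"
  by (intro finite_measure_lebesgue_on bounded_set_imp_lmeasurable bounded_dom dom_lebesgue)

lemma integrable_const_dom: "integrable (lebesgue_on \<Omega>) (\<lambda>x. c::real)"
  using finite_measure.integrable_const[OF finite_measure_dom] .

lemma L2_bounded:
  assumes "f \<in> borel_measurable (lebesgue_on \<Omega>)" "\<And>x. norm (f x) \<le> B"
  shows "f \<in> L2 \<Omega>"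
proof -
  have "integrable (lebesgue_on \<Omega>) (\<lambda>x. (norm (f x))\<^sup>2)"
  proof (rule Bochner_Integration.integrable_bound[OF integrable_const_dom[of "B\<^sup>2"]])
    show "AE x in lebesgue_on \<Omega>. norm ((norm (f x))\<^sup>2) \<le> norm (B\<^sup>2)"
      using assms(2) by (auto intro!: AE_I2 power_mono)
  qed (use assms(1) in measurable)
  then show ?thesis using assms(1) by (simp add: L2_def)
qed

text \<open>A bounded domain has finite measure, and r is at most 1 + r^2 for every r.\<close>

lemma L2_integrable:
  assumes "f \<in> L2 \<Omega>" shows "integrable (lebesgue_on \<Omega>) f"
proof (rule Bochner_Integration.integrable_bound)
  show "integrable (lebesgue_on \<Omega>) (\<lambda>x. 1 + (norm (f x))\<^sup>2)"
    by (intro Bochner_Integration.integrable_add integrable_const_dom L2_integrable_sq assms)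
  have "norm (f x) \<le> 1 + (norm (f x))\<^sup>2" for x
  proof -
    have "0 \<le> (norm (f x) - 1)\<^sup>2" by simp
    then have "2 * norm (f x) \<le> 1 + (norm (f x))\<^sup>2" by (simp add: power2_diff)
    then show ?thesis using norm_ge_zero[of "f x"] by linarith
  qed
  then show "AE x in lebesgue_on \<Omega>. norm (f x) \<le> norm (1 + (norm (f x))\<^sup>2)"
    by (auto intro: order_trans[OF _ abs_ge_self])
qed (rule L2_borel[OF assms])

lemma L2_test_function: "test_function \<Omega> \<phi> \<Longrightarrow> \<phi> \<in> L2 \<Omega>"
  by (metis L2_bounded continuous_borel_lebesgue_on real_norm_def test_function_bounded test_function_continuous)

lemma L2_grad: "test_function \<Omega> \<phi> \<Longrightarrow> grad \<phi> \<in> L2 \<Omega>"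
  by (metis L2_bounded continuous_borel_lebesgue_on grad_bounded grad_continuous)

lemma L2_integrable_scaleR:
  fixes u :: "real^3 \<Rightarrow> real" and g :: "real^3 \<Rightarrow> 'b::euclidean_space"
  assumes u: "u \<in> L2 \<Omega>" and g: "g \<in> L2 \<Omega>"
  shows "integrable (lebesgue_on \<Omega>) (\<lambda>x. u x *\<^sub>R g x)"
proof (rule Bochner_Integration.integrable_bound)
  have ng: "(\<lambda>x. norm (g x)) \<in> L2 \<Omega>"
    using g by (auto simp: L2_def)
  show "integrable (lebesgue_on \<Omega>) (\<lambda>x. u x \<bullet> norm (g x))"
    by (rule L2_integrable_inner[OF u ng])
  show "(\<lambda>x. u x *\<^sub>R g x) \<in> borel_measurable (lebesgue_on \<Omega>)"
    using u[THEN L2_borel] g[THEN L2_borel] by measurable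
qed (simp add: abs_mult)

text \<open>Bumps converge to indicators of boxes, and the averages over small boxes converge
  to the function almost everywhere.\<close>

lemma fundamental_lemma:
  fixes g :: "real^3 \<Rightarrow> 'b::euclidean_space"
  assumes g: "g \<in> L2 \<Omega>"
    and zero: "\<And>\<phi>. test_function \<Omega> \<phi> \<Longrightarrow> (LINT x|lebesgue_on \<Omega>. \<phi> x *\<^sub>R g x) = 0"
  shows "AE x in lebesgue_on \<Omega>. g x = 0"
proof -
  \<comment> \<open>Extension by zero makes averages over boxes in the whole space
    available.\<close>
  define f where "f x = (if x \<in> \<Omega> then g x else 0)" for x
  have f_int: "integrable lebesgue f"
    unfolding f_def by (subst Lebesgue_Measure.integrable_restrict_UNIV) (auto intro: L2_integrable g)
  have box_zero: "integral (cbox a b) f = 0" if ab: "cbox a b \<subseteq> \<Omega>" for a b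
  proof -
    have "(\<lambda>n. LINT x|lebesgue_on \<Omega>. bump a b n x *\<^sub>R g x)
        \<longlonglongrightarrow> (LINT x|lebesgue_on \<Omega>. indicat_real (box a b) x *\<^sub>R g x)"
    proof (rule integral_dominated_convergence[where w = "\<lambda>x. norm (g x)"])
      show "(\<lambda>x. indicat_real (box a b) x *\<^sub>R g x) \<in> borel_measurable (lebesgue_on \<Omega>)"
        by (intro borel_measurable_scaleR L2_borel[OF g] measurable_restrict_space1
            borel_measurable_indicator) simp
      show "(\<lambda>x. bump a b n x *\<^sub>R g x) \<in> borel_measurable (lebesgue_on \<Omega>)" for n
        by (intro borel_measurable_scaleR L2_borel[OF g] continuous_borel_lebesgue_on
            test_function_continuous[OF bump_test_function[OF ab]])
      show "integrable (lebesgue_on \<Omega>) (\<lambda>x. norm (g x))"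
        using L2_integrable[OF g] by simp
      show "AE x in lebesgue_on \<Omega>. (\<lambda>n. bump a b n x *\<^sub>R g x) \<longlonglongrightarrow> indicat_real (box a b) x *\<^sub>R g x"
        by (intro AE_I2 tendsto_scaleR bump_tendsto tendsto_const)
      show "AE x in lebesgue_on \<Omega>. norm (bump a b n x *\<^sub>R g x) \<le> norm (g x)" for n
        using bump_bound[of a b n] by (auto intro!: mult_left_le_one_le)
    qed
    then have "(LINT x|lebesgue_on \<Omega>. indicat_real (box a b) x *\<^sub>R g x) = 0"
      by (simp add: zero[OF bump_test_function[OF ab]] LIMSEQ_const_iff)
    moreover have "(LINT x|lebesgue_on \<Omega>. indicat_real (box a b) x *\<^sub>R g x)
        = (LINT x|lebesgue. indicat_real (box a b) x *\<^sub>R f x)"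
      by (subst integral_restrict_space) (auto simp: f_def intro!: Bochner_Integration.integral_cong split: split_indicator)
    moreover have "\<dots> = integral (box a b) f"
    proof -
      have "set_integrable lebesgue (box a b) f"
        unfolding set_integrable_def by (intro integrable_mult_indicator f_int) simp
      then show ?thesis
        using set_lebesgue_integral_eq_integral(2)[of "box a b" f] by (simp add: set_lebesgue_integral_def)
    qed
    ultimately show ?thesis by (simp add: integral_open_interval)
  qed
  have "f integrable_on cbox a b" for a b
    using integrable_on_lebesgue_on[of "cbox a b" f] integrable_restrict_space[of "cbox a b" lebesgue f]
      integrable_mult_indicator[OF _ f_int, of "cbox a b"] by auto
  \<comment> \<open>Lebesgue differentiation: off the null set \<open>N\<close>, the averages over
    cubes with corner \<open>x\<close> converge to \<open>f x\<close>.\<close>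
  from integrable_ccontinuous_explicit[OF this] obtain N where N: "negligible N"
    and lim: "\<And>x e. \<lbrakk>x \<notin> N; 0 < e\<rbrakk> \<Longrightarrow> \<exists>d>0. \<forall>h. 0 < h \<and> h < d \<longrightarrow>
       norm (integral (cbox x (x + h *\<^sub>R One)) f /\<^sub>R h ^ DIM(real^3) - f x) < e"
    by blast
  have "g x = 0" if x: "x \<in> \<Omega>" "x \<notin> N" for x
  proof (rule ccontr)
    assume "g x \<noteq> 0"
    then have "0 < norm (f x)" using x by (simp add: f_def)
    \<comment> \<open>The tolerance is \<open>norm (f x)\<close> itself: an average equal to zero
      misses \<open>f x\<close> by exactly that much, contradicting the strict inequality.\<close>
    from lim[OF x(2) this] obtain d where d: "d > 0" and dd: "\<And>h. 0 < h \<Longrightarrow> h < d \<Longrightarrow>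
       norm (integral (cbox x (x + h *\<^sub>R One)) f /\<^sub>R h ^ DIM(real^3) - f x) < norm (f x)" by blast
    from open_dom x(1) obtain r where r: "r > 0" "ball x r \<subseteq> \<Omega>"
      by (auto simp: open_contains_ball)
    \<comment> \<open>\<open>n\<close> exceeds the diameter of the unit cube, so the cube of side
      \<open>h\<close> at \<open>x\<close> stays inside the ball of radius \<open>r\<close>.\<close>
    define n where "n = norm (One :: real^3) + 1"
    have n: "n > 0" by (simp add: n_def add_nonneg_pos)
    define h where "h = min (d / 2) (r / (2 * n))"
    have h: "0 < h" "h < d" "h * n < r"
      using d r n by (auto simp: h_def min_def field_simps)
    have "cbox x (x + h *\<^sub>R One) \<subseteq> \<Omega>"
    proof
      fix y assume y: "y \<in> cbox x (x + h *\<^sub>R One)"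
      have "norm (y - x) \<le> norm (h *\<^sub>R One :: real^3)"
        using y h(1) by (intro norm_le_componentwise) (auto simp: mem_box inner_diff_left inner_add_left)
      also have "\<dots> \<le> h * n" using h(1) by (simp add: n_def algebra_simps)
      finally have "y \<in> ball x r" using h(3) by (simp add: dist_norm norm_minus_commute)
      then show "y \<in> \<Omega>" using r(2) by blast
    qed
    with dd[OF h(1,2)] box_zero show False by simp
  qed
  then have "\<forall>x\<in>\<Omega>. x \<notin> N \<longrightarrow> g x = 0" by blast
  moreover have "AE x in lebesgue. x \<notin> N"
    using N by (intro AE_not_in) (simp add: negligible_iff_null_sets)
  ultimately show ?thesis
    by (subst AE_restrict_space_iff) auto
qed

text \<open>The difference of two weak gradients integrates to zero against every test function.
  Every computation with the choice made by \<open>weak_grad\<close> rests on this.\<close>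

lemma weak_gradient_unique:
  assumes "is_weak_gradient \<Omega> u g" "is_weak_gradient \<Omega> u g'"
  shows "AE x in lebesgue_on \<Omega>. g x = g' x"
proof -
  have L: "g \<in> L2 \<Omega>" "g' \<in> L2 \<Omega>"
    using assms by (auto simp: is_weak_gradient_def)
  have "AE x in lebesgue_on \<Omega>. g x - g' x = 0"
  proof (rule fundamental_lemma[OF L2_diff[OF L]])
    fix \<phi> assume t: "test_function \<Omega> \<phi>"
    have "(LINT x|lebesgue_on \<Omega>. \<phi> x *\<^sub>R g x) = (LINT x|lebesgue_on \<Omega>. \<phi> x *\<^sub>R g' x)"
      using assms t by (auto simp: is_weak_gradient_def)
    then show "(LINT x|lebesgue_on \<Omega>. \<phi> x *\<^sub>R (g x - g' x)) = 0"
      using L2_integrable_scaleR[OF L2_test_function[OF t] L(1)]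
        L2_integrable_scaleR[OF L2_test_function[OF t] L(2)]
      by (simp add: scaleR_diff_right)
  qed
  then show ?thesis by eventually_elim simp
qed

lemma H1_weak_grad: "u \<in> H1 \<Omega> \<Longrightarrow> is_weak_gradient \<Omega> u (weak_grad \<Omega> u)"
  unfolding H1_def weak_grad_def by (simp add: someI_ex)

lemma H10_H1: "u \<in> H10 \<Omega> \<Longrightarrow> u \<in> H1 \<Omega>" by (simp add: H10_def)
lemma H10_L2: "u \<in> H10 \<Omega> \<Longrightarrow> u \<in> L2 \<Omega>" by (simp add: H10_def H1_def)
lemma H10_weak_grad_L2: "u \<in> H10 \<Omega> \<Longrightarrow> weak_grad \<Omega> u \<in> L2 \<Omega>"
  using H1_weak_grad[OF H10_H1] by (simp add: is_weak_gradient_def)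

lemma is_weak_gradient_add_mult:
  assumes u: "u \<in> L2 \<Omega>" "is_weak_gradient \<Omega> u g" and w: "w \<in> L2 \<Omega>" "is_weak_gradient \<Omega> w k"
  shows "is_weak_gradient \<Omega> (\<lambda>x. u x + c * w x) (\<lambda>x. g x + c *\<^sub>R k x)"
proof -
  have L: "g \<in> L2 \<Omega>" "k \<in> L2 \<Omega>"
    using assms by (auto simp: is_weak_gradient_def)
  have "(LINT x|lebesgue_on \<Omega>. (u x + c * w x) *\<^sub>R grad \<phi> x)
      = - (LINT x|lebesgue_on \<Omega>. \<phi> x *\<^sub>R (g x + c *\<^sub>R k x))" if t: "test_function \<Omega> \<phi>" for \<phi>
  proof -
    note i = L2_integrable_scaleR[OF u(1) L2_grad[OF t]] L2_integrable_scaleR[OF w(1) L2_grad[OF t]]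
      L2_integrable_scaleR[OF L2_test_function[OF t] L(1)] L2_integrable_scaleR[OF L2_test_function[OF t] L(2)]
    have "(LINT x|lebesgue_on \<Omega>. (u x + c * w x) *\<^sub>R grad \<phi> x)
       = (LINT x|lebesgue_on \<Omega>. u x *\<^sub>R grad \<phi> x + c *\<^sub>R (w x *\<^sub>R grad \<phi> x))"
      by (simp add: scaleR_add_left)
    also have "\<dots> = (LINT x|lebesgue_on \<Omega>. u x *\<^sub>R grad \<phi> x) + c *\<^sub>R (LINT x|lebesgue_on \<Omega>. w x *\<^sub>R grad \<phi> x)"
      using i by (simp del: scaleR_scaleR)
    also have "\<dots> = - ((LINT x|lebesgue_on \<Omega>. \<phi> x *\<^sub>R g x) + c *\<^sub>R (LINT x|lebesgue_on \<Omega>. \<phi> x *\<^sub>R k x))"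
      using u(2) w(2) t by (simp add: is_weak_gradient_def)
    also have "(LINT x|lebesgue_on \<Omega>. \<phi> x *\<^sub>R g x) + c *\<^sub>R (LINT x|lebesgue_on \<Omega>. \<phi> x *\<^sub>R k x)
       = (LINT x|lebesgue_on \<Omega>. \<phi> x *\<^sub>R g x + c *\<^sub>R (\<phi> x *\<^sub>R k x))"
      using i by (simp del: scaleR_scaleR)
    also have "\<dots> = (LINT x|lebesgue_on \<Omega>. \<phi> x *\<^sub>R (g x + c *\<^sub>R k x))"
      by (simp add: scaleR_add_right mult.commute)
    finally show ?thesis .
  qed
  then show ?thesis
    using L2_add[OF L(1) L2_scale[OF L(2)]] by (simp add: is_weak_gradient_def)
qed

text \<open>The combination \<open>u x + c * w x\<close> yields sums, differences and multiples at
  once. Approximating test functions for \<open>u\<close> and \<open>w\<close> are combined in the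
  same way.\<close>

lemma weak_grad_add_mult:
  assumes "u \<in> H10 \<Omega>" "w \<in> H10 \<Omega>"
  shows "(\<lambda>x. u x + c * w x) \<in> H10 \<Omega>"
    and "AE x in lebesgue_on \<Omega>. weak_grad \<Omega> (\<lambda>x. u x + c * w x) x = weak_grad \<Omega> u x + c *\<^sub>R weak_grad \<Omega> w x"
proof -
  let ?s = "\<lambda>x. u x + c * w x"
  note L = H10_L2[OF assms(1)] H10_L2[OF assms(2)]
  note G = H10_weak_grad_L2[OF assms(1)] H10_weak_grad_L2[OF assms(2)]
  have g: "is_weak_gradient \<Omega> ?s (\<lambda>x. weak_grad \<Omega> u x + c *\<^sub>R weak_grad \<Omega> w x)"
    by (intro is_weak_gradient_add_mult L H1_weak_grad H10_H1 assms)
  have s: "?s \<in> L2 \<Omega>" by (intro L2_add L2_mult L)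
  have H1: "?s \<in> H1 \<Omega>" using g s by (auto simp: H1_def)
  show eq: "AE x in lebesgue_on \<Omega>. weak_grad \<Omega> ?s x = weak_grad \<Omega> u x + c *\<^sub>R weak_grad \<Omega> w x"
    by (rule weak_gradient_unique[OF H1_weak_grad[OF H1] g])
  have wgs: "weak_grad \<Omega> ?s \<in> L2 \<Omega>"
    using H1_weak_grad[OF H1] by (simp add: is_weak_gradient_def)
  show "?s \<in> H10 \<Omega>"
    unfolding H10_def
  proof (intro CollectI conjI H1 allI impI)
    fix e :: real assume e: "e > 0"
    \<comment> \<open>The two errors enter with the factors 1 and \<open>\<bar>c\<bar>\<close>, so
      this share of \<open>e\<close> suffices for both.\<close>
    define d where "d = e / (1 + \<bar>c\<bar>)"
    have d: "d > 0" using e by (simp add: d_def)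
    have "(1 + \<bar>c\<bar>) * d = e" using abs_ge_zero[of c] by (simp add: d_def)
    then have dc: "d + \<bar>c\<bar> * d = e" by (simp add: algebra_simps)
    obtain \<phi> where \<phi>: "test_function \<Omega> \<phi>" "L2_norm \<Omega> (\<lambda>x. u x - \<phi> x) < d"
      "L2_norm \<Omega> (\<lambda>x. weak_grad \<Omega> u x - grad \<phi> x) < d"
      using assms(1) d by (auto simp: H10_def)
    obtain \<psi> where \<psi>: "test_function \<Omega> \<psi>" "L2_norm \<Omega> (\<lambda>x. w x - \<psi> x) < d"
      "L2_norm \<Omega> (\<lambda>x. weak_grad \<Omega> w x - grad \<psi> x) < d"
      using assms(2) d by (auto simp: H10_def)
    have sum_less: "a + \<bar>c\<bar> * b < e" if "a < d" "b < d" for a b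
      using that mult_left_mono[of b d "\<bar>c\<bar>"] dc by linarith
    let ?\<chi> = "\<lambda>x. \<phi> x + c * \<psi> x"
    have t: "test_function \<Omega> ?\<chi>" by (intro test_function_add test_function_mult \<phi> \<psi>)
    have "L2_norm \<Omega> (\<lambda>x. ?s x - ?\<chi> x) = L2_norm \<Omega> (\<lambda>x. (u x - \<phi> x) + c *\<^sub>R (w x - \<psi> x))"
      by (simp add: algebra_simps)
    also have "\<dots> \<le> L2_norm \<Omega> (\<lambda>x. u x - \<phi> x) + L2_norm \<Omega> (\<lambda>x. c *\<^sub>R (w x - \<psi> x))"
      by (intro L2_norm_triangle L2_diff L2_scale L L2_test_function \<phi> \<psi>)
    also have "\<dots> < e" using sum_less[OF \<phi>(2) \<psi>(2)] by (simp only: L2_norm_scale)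
    finally have 1: "L2_norm \<Omega> (\<lambda>x. ?s x - ?\<chi> x) < e" .
    have "L2_norm \<Omega> (\<lambda>x. weak_grad \<Omega> ?s x - grad ?\<chi> x)
        = L2_norm \<Omega> (\<lambda>x. (weak_grad \<Omega> u x - grad \<phi> x) + c *\<^sub>R (weak_grad \<Omega> w x - grad \<psi> x))"
    proof (rule L2_norm_cong_AE)
      show "AE x in lebesgue_on \<Omega>. weak_grad \<Omega> ?s x - grad ?\<chi> x
          = weak_grad \<Omega> u x - grad \<phi> x + c *\<^sub>R (weak_grad \<Omega> w x - grad \<psi> x)"
        using eq by eventually_elim (simp add: grad_add_mult[OF \<phi>(1) \<psi>(1)] algebra_simps)
    qed (intro L2_borel L2_add L2_diff L2_scale G L2_grad \<phi> \<psi> wgs t)+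
    also have "\<dots> \<le> L2_norm \<Omega> (\<lambda>x. weak_grad \<Omega> u x - grad \<phi> x)
        + L2_norm \<Omega> (\<lambda>x. c *\<^sub>R (weak_grad \<Omega> w x - grad \<psi> x))"
      by (intro L2_norm_triangle L2_diff L2_scale G L2_grad \<phi> \<psi>)
    also have "\<dots> < e" using sum_less[OF \<phi>(3) \<psi>(3)] by (simp only: L2_norm_scale)
    finally show "\<exists>\<phi>. test_function \<Omega> \<phi> \<and> L2_norm \<Omega> (\<lambda>x. ?s x - \<phi> x) < e \<and>
        L2_norm \<Omega> (\<lambda>x. weak_grad \<Omega> ?s x - grad \<phi> x) < e"
      using 1 t by blast
  qed
qed

end

section \<open>The Sobolev inequality for test functions\<close>

lemma prod_UNIV_3:
  fixes i j k :: 3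
  assumes "i \<noteq> j" "i \<noteq> k" "j \<noteq> k"
  shows "(\<Prod>l\<in>UNIV. f l) = f i * f j * (f k :: 'a :: comm_monoid_mult)"
proof -
  have "card {i, j, k} = CARD(3)" using assms by simp
  then have "{i, j, k} = (UNIV :: 3 set)" by (intro card_subset_eq) auto
  then have "(\<Prod>l\<in>UNIV. f l) = (\<Prod>l\<in>{i, j, k}. f l)" by simp
  then show ?thesis using assms by (simp add: mult.assoc)
qed

text \<open>Both measures give a box the product of its side lengths, which determines Lebesgue
  measure. The order of the axes is a parameter because the Sobolev argument integrates in three
  different orders.\<close>

lemma lborel_real3_distr:
  fixes i j k :: 3
  assumes "i \<noteq> j" "i \<noteq> k" "j \<noteq> k"
  shows "lborel = distr lborel borel (\<lambda>(p, q, r). p *\<^sub>R axis i 1 + q *\<^sub>R axis j 1 + r *\<^sub>R axis k (1::real))"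
    (is "_ = distr _ _ ?T")
proof (rule lborel_eqI)
  have cont: "continuous_on UNIV ?T"
    by (auto simp: case_prod_beta intro!: continuous_intros)
  have meas: "?T \<in> borel_measurable borel"
    by (rule borel_measurable_continuous_onI[OF cont])
  fix l u :: "real^3" assume "\<And>b. b \<in> Basis \<Longrightarrow> l \<bullet> b \<le> u \<bullet> b"
  then have le: "l $ m \<le> u $ m" for m by (metis axis_in_Basis_iff inner_axis inner_real_def mult.right_neutral
    Basis_real_def singletonI)
  have UN: "UNIV = {i, j, k}"
    using card_subset_eq[of "UNIV :: 3 set" "{i, j, k}"] assms by auto
  have "?T -` box l u = {l $ i <..< u $ i} \<times> {l $ j <..< u $ j} \<times> {l $ k <..< u $ k}"
  proof -
    have "?T (p, q, r) \<in> box l u \<longleftrightarrow> (p, q, r) \<in> {l $ i <..< u $ i} \<times> {l $ j <..< u $ j} \<times> {l $ k <..< u $ k}" for p q r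
    proof -
      have "(\<forall>m. P m) \<longleftrightarrow> P i \<and> P j \<and> P k" for P using UN by (metis UNIV_I insertE singletonD)
      then show ?thesis using assms by (simp add: mem_box_cart axis_def)
    qed
    then show ?thesis by (auto simp del: case_prod_conv)
  qed
  then have "emeasure (distr lborel borel ?T) (box l u)
      = emeasure lborel ({l $ i <..< u $ i} \<times> {l $ j <..< u $ j} \<times> {l $ k <..< u $ k})"
    using meas by (subst emeasure_distr) auto
  also have "\<dots> = ennreal (u $ i - l $ i) * (ennreal (u $ j - l $ j) * ennreal (u $ k - l $ k))"
    by (simp add: lborel_prod[symmetric] lborel.emeasure_pair_measure_Times lborel_pair.sigma_finite_measure_axioms
      sigma_finite_measure.emeasure_pair_measure_Times le)
  also have "\<dots> = ennreal ((u - l) $ i * (u - l) $ j * (u - l) $ k)"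
    using le by (simp add: ennreal_mult mult.assoc)
  also have "(u - l) $ i * (u - l) $ j * (u - l) $ k = (\<Prod>m\<in>UNIV. (u - l) $ m)"
    by (simp add: prod_UNIV_3[OF assms])
  also have "\<dots> = (\<Prod>b\<in>Basis. (u - l) \<bullet> b)"
  proof -
    have inj: "inj (\<lambda>m::3. axis m (1::real))" by (auto simp: inj_def axis_eq_axis)
    have B: "Basis = range (\<lambda>m::3. axis m (1::real))" by (auto simp: Basis_vec_def)
    show ?thesis unfolding B prod.reindex[OF inj] by (simp add: inner_axis)
  qed
  finally show "emeasure (distr lborel borel ?T) (box l u) = ennreal (\<Prod>b\<in>Basis. (u - l) \<bullet> b)" .
qed simp

text \<open>Tonelli's theorem, with \<open>i\<close> as the outermost direction and \<open>k\<close>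
  as the innermost.\<close>

lemma nn_integral_real3:
  fixes i j k :: 3 and f :: "real^3 \<Rightarrow> ennreal"
  assumes ijk: "i \<noteq> j" "i \<noteq> k" "j \<noteq> k" and f[measurable]: "f \<in> borel_measurable borel"
  shows "(\<integral>\<^sup>+x. f x \<partial>lborel) = (\<integral>\<^sup>+p. \<integral>\<^sup>+q. \<integral>\<^sup>+r. f (p *\<^sub>R axis i 1 + q *\<^sub>R axis j 1 + r *\<^sub>R axis k 1)
      \<partial>lborel \<partial>lborel \<partial>lborel)"
proof -
  let ?T = "\<lambda>(p, q, r). p *\<^sub>R axis i 1 + q *\<^sub>R axis j 1 + r *\<^sub>R axis k (1::real)"
  have cont: "continuous_on UNIV ?T"
    by (auto simp: case_prod_beta intro!: continuous_intros)
  have T[measurable]: "?T \<in> borel_measurable borel"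
    by (rule borel_measurable_continuous_onI[OF cont])
  have fT: "(\<lambda>x. f (?T x)) \<in> borel_measurable borel" by measurable
  have "(\<integral>\<^sup>+x. f x \<partial>lborel) = (\<integral>\<^sup>+x. f x \<partial>distr lborel borel ?T)"
    using lborel_real3_distr[OF ijk] by simp
  also have "\<dots> = (\<integral>\<^sup>+x. f (?T x) \<partial>lborel)"
    by (rule nn_integral_distr) simp_all
  also have "\<dots> = (\<integral>\<^sup>+x. f (?T x) \<partial>(lborel \<Otimes>\<^sub>M lborel))"
    by (simp add: lborel_prod)
  also have "\<dots> = (\<integral>\<^sup>+p. \<integral>\<^sup>+y. f (?T (p, y)) \<partial>lborel \<partial>lborel)"
    using fT by (intro lborel.nn_integral_fst[symmetric]) (simp add: lborel_prod)
  also have "\<dots> = (\<integral>\<^sup>+p. \<integral>\<^sup>+q. \<integral>\<^sup>+r. f (?T (p, q, r)) \<partial>lborel \<partial>lborel \<partial>lborel)"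
  proof (intro nn_integral_cong)
    fix p :: real
    have "(\<lambda>y. f (?T (p, y))) \<in> borel_measurable borel"
      using measurable_compose[OF _ fT, of "\<lambda>y. (p, y)" borel]
      by (simp add: borel_measurable_continuous_onI continuous_intros)
    then have "(\<integral>\<^sup>+q. \<integral>\<^sup>+r. f (?T (p, q, r)) \<partial>lborel \<partial>lborel) = (\<integral>\<^sup>+y. f (?T (p, y)) \<partial>(lborel \<Otimes>\<^sub>M lborel))"
      by (intro lborel.nn_integral_fst) (simp add: lborel_prod)
    then show "(\<integral>\<^sup>+y. f (?T (p, y)) \<partial>lborel) = (\<integral>\<^sup>+q. \<integral>\<^sup>+r. f (?T (p, q, r)) \<partial>lborel \<partial>lborel)"
      by (simp add: lborel_prod)
  qed
  finally show ?thesis by simp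
qed

text \<open>Each factor misses one variable. Cauchy-Schwarz in (y, z) separates \<open>f\<close>
  from \<open>K y z\<close>, the integral of \<open>g\<close> times \<open>h\<close> over x;
  Cauchy-Schwarz in x bounds the square of \<open>K y z\<close> by \<open>G z * H y\<close>, whose
  double integral factorises.\<close>

lemma Loomis_Whitney:
  fixes f g h :: "real \<times> real \<Rightarrow> ennreal"
  assumes [measurable]: "f \<in> borel_measurable borel" "g \<in> borel_measurable borel" "h \<in> borel_measurable borel"
  shows "(\<integral>\<^sup>+y. \<integral>\<^sup>+z. \<integral>\<^sup>+x. f (y, z) * g (x, z) * h (x, y) \<partial>lborel \<partial>lborel \<partial>lborel)\<^sup>2
    \<le> (\<integral>\<^sup>+y. \<integral>\<^sup>+z. (f (y, z))\<^sup>2 \<partial>lborel \<partial>lborel) * ((\<integral>\<^sup>+z. \<integral>\<^sup>+x. (g (x, z))\<^sup>2 \<partial>lborel \<partial>lborel)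
      * (\<integral>\<^sup>+y. \<integral>\<^sup>+x. (h (x, y))\<^sup>2 \<partial>lborel \<partial>lborel))"
proof -
  have [measurable]: "f \<in> borel_measurable (borel \<Otimes>\<^sub>M borel)" "g \<in> borel_measurable (borel \<Otimes>\<^sub>M borel)"
    "h \<in> borel_measurable (borel \<Otimes>\<^sub>M borel)"
    using assms by (simp_all add: borel_prod)
  define K where "K y z = (\<integral>\<^sup>+x. g (x, z) * h (x, y) \<partial>lborel)" for y z
  define G where "G z = (\<integral>\<^sup>+x. (g (x, z))\<^sup>2 \<partial>lborel)" for z
  define H where "H y = (\<integral>\<^sup>+x. (h (x, y))\<^sup>2 \<partial>lborel)" for y
  have [measurable]: "(\<lambda>(y, z). K y z) \<in> borel_measurable (borel \<Otimes>\<^sub>M borel)"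
    unfolding K_def by measurable
  have [measurable]: "G \<in> borel_measurable borel" "H \<in> borel_measurable borel"
    unfolding G_def H_def by measurable
  have "(\<integral>\<^sup>+y. \<integral>\<^sup>+z. \<integral>\<^sup>+x. f (y, z) * g (x, z) * h (x, y) \<partial>lborel \<partial>lborel \<partial>lborel)
      = (\<integral>\<^sup>+y. \<integral>\<^sup>+z. f (y, z) * K y z \<partial>lborel \<partial>lborel)"
    unfolding K_def by (simp add: mult.assoc nn_integral_cmult)
  also have "\<dots> = (\<integral>\<^sup>+w. f w * (\<lambda>(y, z). K y z) w \<partial>(lborel \<Otimes>\<^sub>M lborel))"
    by (subst lborel.nn_integral_fst[symmetric]) simp_all
  also have "\<dots>\<^sup>2 \<le> (\<integral>\<^sup>+w. (f w)\<^sup>2 \<partial>(lborel \<Otimes>\<^sub>M lborel)) * (\<integral>\<^sup>+w. ((\<lambda>(y, z). K y z) w)\<^sup>2 \<partial>(lborel \<Otimes>\<^sub>M lborel))"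
    by (rule Cauchy_Schwarz_nn_integral) simp_all
  also have "(\<integral>\<^sup>+w. (f w)\<^sup>2 \<partial>(lborel \<Otimes>\<^sub>M lborel)) = (\<integral>\<^sup>+y. \<integral>\<^sup>+z. (f (y, z))\<^sup>2 \<partial>lborel \<partial>lborel)"
    by (subst lborel.nn_integral_fst[symmetric]) simp_all
  also have "(\<integral>\<^sup>+w. ((\<lambda>(y, z). K y z) w)\<^sup>2 \<partial>(lborel \<Otimes>\<^sub>M lborel)) = (\<integral>\<^sup>+y. \<integral>\<^sup>+z. (K y z)\<^sup>2 \<partial>lborel \<partial>lborel)"
    by (subst lborel.nn_integral_fst[symmetric]) simp_all
  also have "\<dots> \<le> (\<integral>\<^sup>+y. \<integral>\<^sup>+z. G z * H y \<partial>lborel \<partial>lborel)"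
    unfolding K_def G_def H_def by (intro nn_integral_mono Cauchy_Schwarz_nn_integral) measurable
  also have "\<dots> = (\<integral>\<^sup>+z. G z \<partial>lborel) * (\<integral>\<^sup>+y. H y \<partial>lborel)"
    by (simp add: nn_integral_multc nn_integral_cmult)
  finally show ?thesis by (simp add: G_def H_def mult_left_mono)
qed

text \<open>A square root with value \<open>top\<close> at \<open>top\<close>: the line integrals to
  which it is applied are not known to be finite.\<close>

definition ennreal_sqrt :: "ennreal \<Rightarrow> ennreal" where
  "ennreal_sqrt a = (if a = top then top else ennreal (sqrt (enn2real a)))"

lemma ennreal_sqrt_sq: "(ennreal_sqrt a)\<^sup>2 = a"
  by (cases a) (auto simp: ennreal_sqrt_def ennreal_power ennreal_top_mult power2_eq_square ennreal_mult[symmetric])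

lemma le_ennreal_sqrt:
  assumes "0 \<le> b" "ennreal (b\<^sup>2) \<le> a" shows "ennreal b \<le> ennreal_sqrt a"
  using assms by (cases a) (auto simp: ennreal_sqrt_def real_le_rsqrt)

lemma ennreal_sqrt_measurable [measurable]: "ennreal_sqrt \<in> borel_measurable borel"
  unfolding ennreal_sqrt_def by measurable

text \<open>The fundamental theorem of calculus, started at a zero \<open>a\<close> to the left of
  \<open>x\<close>. In \<open>ennreal\<close> the integral over the whole line makes sense before
  any integrability is known.\<close>

lemma compact_support_le_nn_integral_deriv:
  fixes w w' :: "real \<Rightarrow> real"
  assumes d: "\<And>s. (w has_real_derivative w' s) (at s)" and c: "continuous_on UNIV w'"
    and a: "a < x" "w a = 0"
  shows "ennreal \<bar>w x\<bar> \<le> (\<integral>\<^sup>+s. ennreal \<bar>w' s\<bar> \<partial>lborel)"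
proof -
  have "(w' has_integral (w x - w a)) {a..x}"
    using a d by (intro fundamental_theorem_of_calculus)
      (auto simp: has_real_derivative_iff_has_vector_derivative[symmetric] intro: has_field_derivative_at_within)
  then have w: "(w' has_integral w x) {a..x}" using a by simp
  have c': "continuous_on {a..x} (\<lambda>s. \<bar>w' s\<bar>)"
    using c by (intro continuous_intros) (auto intro: continuous_on_subset)
  then have i: "(\<lambda>s. \<bar>w' s\<bar>) integrable_on {a..x}" by (rule integrable_continuous_real)
  have "norm (integral {a..x} w') \<le> integral {a..x} (\<lambda>s. \<bar>w' s\<bar>)"
    using w i by (intro integral_norm_bound_integral) auto
  then have "\<bar>w x\<bar> \<le> integral {a..x} (\<lambda>s. \<bar>w' s\<bar>)" using integral_unique[OF w] by simp
  then have "ennreal \<bar>w x\<bar> \<le> ennreal (integral {a..x} (\<lambda>s. \<bar>w' s\<bar>))" by (rule ennreal_leI)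
  also have "\<dots> = (\<integral>\<^sup>+s. ennreal (indicator {a..x} s * \<bar>w' s\<bar>) \<partial>lborel)"
    using nn_integral_has_integral_lebesgue[OF _ integrable_integral[OF i]] by simp
  also have "\<dots> \<le> (\<integral>\<^sup>+s. ennreal \<bar>w' s\<bar> \<partial>lborel)"
    by (intro nn_integral_mono ennreal_leI) (auto split: split_indicator)
  finally show ?thesis .
qed

text \<open>The derivative of \<open>\<phi>^4\<close> along an axis is 4 \<open>\<phi>^3\<close>
  times a component of the gradient. The power 4 is chosen because the square of
  \<open>\<phi>^3\<close> is again the sixth power that is to be estimated.\<close>

lemma test_function_line_bound:
  fixes Q :: "real^3"
  assumes t: "test_function \<Omega> \<phi>"
  shows "ennreal ((\<phi> (Q + x *\<^sub>R axis i 1))^4)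
    \<le> (\<integral>\<^sup>+s. ennreal (4 * \<bar>\<phi> (Q + s *\<^sub>R axis i 1)\<bar>^3 * norm (grad \<phi> (Q + s *\<^sub>R axis i 1))) \<partial>lborel)"
proof -
  define w where "w s = (\<phi> (Q + s *\<^sub>R axis i 1))^4" for s
  define w' where "w' s = 4 * (\<phi> (Q + s *\<^sub>R axis i 1))^3 * grad \<phi> (Q + s *\<^sub>R axis i 1) $ i" for s
  have "(w has_real_derivative w' s) (at s)" for s
  proof -
    have "((\<lambda>s. Q + s *\<^sub>R axis i 1) has_derivative (\<lambda>h. h *\<^sub>R axis i 1)) (at s)"
      by (auto intro!: derivative_eq_intros)
    from has_derivative_compose[OF this test_function_deriv[OF t]]
    have "((\<lambda>s. \<phi> (Q + s *\<^sub>R axis i 1)) has_derivative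
        (\<lambda>h. frechet_derivative \<phi> (at (Q + s *\<^sub>R axis i 1)) (h *\<^sub>R axis i 1))) (at s)" .
    moreover have "frechet_derivative \<phi> (at p) (h *\<^sub>R axis i 1) = grad \<phi> p $ i * h" for p h
      using linear_cmul[OF has_derivative_linear[OF test_function_deriv[OF t]]]
      by (simp add: grad_nth mult.commute)
    ultimately have "((\<lambda>s. \<phi> (Q + s *\<^sub>R axis i 1)) has_real_derivative grad \<phi> (Q + s *\<^sub>R axis i 1) $ i) (at s)"
      by (simp add: has_field_derivative_def)
    from DERIV_power[OF this, of 4] show ?thesis
      by (simp add: w_def[abs_def] w'_def mult_ac)
  qed
  moreover have "continuous_on UNIV w'"
  proof -
    have "continuous_on UNIV (\<lambda>s. \<phi> (Q + s *\<^sub>R axis i 1))" "continuous_on UNIV (\<lambda>s. grad \<phi> (Q + s *\<^sub>R axis i 1))"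
      by (auto intro!: continuous_intros continuous_on_compose2[OF test_function_continuous[OF t]]
          continuous_on_compose2[OF grad_continuous[OF t]])
    then show ?thesis unfolding w'_def by (intro continuous_intros)
  qed
  moreover obtain a where "a < x" "w a = 0"
  proof -
    obtain K where K: "compact K" "\<And>x. x \<notin> K \<Longrightarrow> \<phi> x = 0"
      using test_function_support[OF t] by metis
    then obtain B where B: "\<And>y. y \<in> K \<Longrightarrow> norm y \<le> B"
      using compact_imp_bounded bounded_iff by metis
    \<comment> \<open>So far to the left that the \<open>i\<close>-th coordinate of the point alone
      exceeds the radius of the support.\<close>
    define a where "a = - (\<bar>B\<bar> + \<bar>Q $ i\<bar> + \<bar>x\<bar> + 1)"
    have "\<bar>B\<bar> < \<bar>(Q + a *\<^sub>R axis i 1) $ i\<bar>" by (simp add: a_def)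
    also have "\<dots> \<le> norm (Q + a *\<^sub>R axis i 1)" by (rule component_le_norm_cart)
    finally have "Q + a *\<^sub>R axis i 1 \<notin> K" using B by force
    then have "w a = 0" using K by (simp add: w_def)
    moreover have "a < x" by (simp add: a_def)
    ultimately show ?thesis using that by blast
  qed
  ultimately have "ennreal \<bar>w x\<bar> \<le> (\<integral>\<^sup>+s. ennreal \<bar>w' s\<bar> \<partial>lborel)"
    by (rule compact_support_le_nn_integral_deriv)
  also have "\<dots> \<le> (\<integral>\<^sup>+s. ennreal (4 * \<bar>\<phi> (Q + s *\<^sub>R axis i 1)\<bar>^3 * norm (grad \<phi> (Q + s *\<^sub>R axis i 1))) \<partial>lborel)"
    by (intro nn_integral_mono ennreal_leI)
      (auto simp: w'_def abs_mult power_abs intro!: mult_left_mono component_le_norm_cart)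
  finally show ?thesis by (simp add: w_def)
qed

text \<open>The one-dimensional bound for \<open>\<phi>\<^sup>4\<close> along the three coordinate directions gives
  \<open>\<phi>\<^sup>6 = \<phi>\<^sup>2 \<phi>\<^sup>2 \<phi>\<^sup>2\<close> as a product of Loomis--Whitney type.\<close>

lemma Sobolev_test_function:
  fixes \<phi> :: "real^3 \<Rightarrow> real"
  assumes t: "test_function \<Omega> \<phi>"
  shows "(\<integral>\<^sup>+x. ennreal ((\<phi> x)^6) \<partial>lborel) \<le> 4096 * (\<integral>\<^sup>+x. ennreal ((norm (grad \<phi> x))\<^sup>2) \<partial>lborel)^3"
proof -
  define D where "D x = ennreal (4 * \<bar>\<phi> x\<bar>^3 * norm (grad \<phi> x))" for x
  define S where "S = (\<integral>\<^sup>+x. ennreal ((\<phi> x)^6) \<partial>lborel)"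
  define G where "G = (\<integral>\<^sup>+x. ennreal ((norm (grad \<phi> x))\<^sup>2) \<partial>lborel)"
  define I where "I = (\<integral>\<^sup>+x. D x \<partial>lborel)"
  have [measurable]: "\<phi> \<in> borel_measurable borel" "grad \<phi> \<in> borel_measurable borel"
    by (auto intro: borel_measurable_continuous_onI test_function_continuous[OF t] grad_continuous[OF t])
  have D[measurable]: "D \<in> borel_measurable borel"
    unfolding D_def by measurable
  let ?e1 = "axis 1 1 :: real^3" and ?e2 = "axis 2 1 :: real^3" and ?e3 = "axis 3 1 :: real^3"
  \<comment> \<open>\<open>a\<close>, \<open>b\<close> and \<open>c\<close> integrate
    \<open>D\<close> along the lines in the directions 1, 2 and 3; each is independent of the
    coordinate integrated out, as the Loomis-Whitney inequality requires.\<close>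
  define a where "a = (\<lambda>(y, z). \<integral>\<^sup>+s. D (y *\<^sub>R ?e2 + z *\<^sub>R ?e3 + s *\<^sub>R ?e1) \<partial>lborel)"
  define b where "b = (\<lambda>(x, z). \<integral>\<^sup>+s. D (z *\<^sub>R ?e3 + x *\<^sub>R ?e1 + s *\<^sub>R ?e2) \<partial>lborel)"
  define c where "c = (\<lambda>(x, y). \<integral>\<^sup>+s. D (y *\<^sub>R ?e2 + x *\<^sub>R ?e1 + s *\<^sub>R ?e3) \<partial>lborel)"
  have m: "a \<in> borel_measurable (borel \<Otimes>\<^sub>M borel)" "b \<in> borel_measurable (borel \<Otimes>\<^sub>M borel)"
    "c \<in> borel_measurable (borel \<Otimes>\<^sub>M borel)"
    unfolding a_def b_def c_def by measurable
  then have [measurable]: "a \<in> borel_measurable borel" "b \<in> borel_measurable borel" "c \<in> borel_measurable borel"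
    by (simp_all add: borel_prod)
  have ne: "(1::3) \<noteq> 2" "(1::3) \<noteq> 3" "(2::3) \<noteq> 3" by simp_all
  \<comment> \<open>Integrating over the two remaining coordinates recovers the full integral of
    \<open>D\<close>; each of the three cases uses its own order of the axes.\<close>
  have Ia: "(\<integral>\<^sup>+y. \<integral>\<^sup>+z. a (y, z) \<partial>lborel \<partial>lborel) = I"
    unfolding a_def I_def using nn_integral_real3[OF ne(3) ne(1)[symmetric] ne(2)[symmetric] D] by simp
  have Ib: "(\<integral>\<^sup>+z. \<integral>\<^sup>+x. b (x, z) \<partial>lborel \<partial>lborel) = I"
    unfolding b_def I_def using nn_integral_real3[OF ne(2)[symmetric] ne(3)[symmetric] ne(1) D] by simp
  have Ic: "(\<integral>\<^sup>+y. \<integral>\<^sup>+x. c (x, y) \<partial>lborel \<partial>lborel) = I"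
    unfolding c_def I_def using nn_integral_real3[OF ne(1)[symmetric] ne(3) ne(2) D] by simp
  have S_eq: "S = (\<integral>\<^sup>+y. \<integral>\<^sup>+z. \<integral>\<^sup>+x. ennreal ((\<phi> (y *\<^sub>R ?e2 + z *\<^sub>R ?e3 + x *\<^sub>R ?e1))^6) \<partial>lborel \<partial>lborel \<partial>lborel)"
    unfolding S_def by (rule nn_integral_real3[OF ne(3) ne(1)[symmetric] ne(2)[symmetric]]) measurable
  have "S \<le> (\<integral>\<^sup>+y. \<integral>\<^sup>+z. \<integral>\<^sup>+x. ennreal_sqrt (a (y, z)) * ennreal_sqrt (b (x, z)) * ennreal_sqrt (c (x, y))
      \<partial>lborel \<partial>lborel \<partial>lborel)"
    unfolding S_eq
  proof (intro nn_integral_mono)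
    fix x y z :: real
    let ?p = "\<phi> (y *\<^sub>R ?e2 + z *\<^sub>R ?e3 + x *\<^sub>R ?e1)"
    have p4: "(?p\<^sup>2)\<^sup>2 = ?p^4" by simp
    have 1: "ennreal (?p\<^sup>2) \<le> ennreal_sqrt (a (y, z))"
      using test_function_line_bound[OF t, of "y *\<^sub>R ?e2 + z *\<^sub>R ?e3" x 1]
      by (intro le_ennreal_sqrt) (simp_all add: a_def D_def p4)
    have 2: "ennreal (?p\<^sup>2) \<le> ennreal_sqrt (b (x, z))"
      using test_function_line_bound[OF t, of "z *\<^sub>R ?e3 + x *\<^sub>R ?e1" y 2]
      by (intro le_ennreal_sqrt) (simp_all add: b_def D_def p4 add_ac)
    have 3: "ennreal (?p\<^sup>2) \<le> ennreal_sqrt (c (x, y))"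
      using test_function_line_bound[OF t, of "y *\<^sub>R ?e2 + x *\<^sub>R ?e1" z 3]
      by (intro le_ennreal_sqrt) (simp_all add: c_def D_def p4 add_ac)
    have "?p^6 = ?p\<^sup>2 * ?p\<^sup>2 * ?p\<^sup>2" by (simp add: power_add[symmetric] flip: power_mult)
    then have "ennreal (?p^6) = ennreal (?p\<^sup>2) * ennreal (?p\<^sup>2) * ennreal (?p\<^sup>2)"
      by (simp only: ennreal_mult zero_le_power2 mult_nonneg_nonneg)
    also have "\<dots> \<le> ennreal_sqrt (a (y, z)) * ennreal_sqrt (b (x, z)) * ennreal_sqrt (c (x, y))"
      by (intro mult_mono 1 2 3) auto
    finally show "ennreal (?p^6) \<le> ennreal_sqrt (a (y, z)) * ennreal_sqrt (b (x, z)) * ennreal_sqrt (c (x, y))" .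
  qed
  then have "S\<^sup>2 \<le> (\<integral>\<^sup>+y. \<integral>\<^sup>+z. \<integral>\<^sup>+x. ennreal_sqrt (a (y, z)) * ennreal_sqrt (b (x, z)) * ennreal_sqrt (c (x, y))
      \<partial>lborel \<partial>lborel \<partial>lborel)\<^sup>2" by (intro power_mono) auto
  also have "\<dots> \<le> (\<integral>\<^sup>+y. \<integral>\<^sup>+z. (ennreal_sqrt (a (y, z)))\<^sup>2 \<partial>lborel \<partial>lborel)
      * ((\<integral>\<^sup>+z. \<integral>\<^sup>+x. (ennreal_sqrt (b (x, z)))\<^sup>2 \<partial>lborel \<partial>lborel)
      * (\<integral>\<^sup>+y. \<integral>\<^sup>+x. (ennreal_sqrt (c (x, y)))\<^sup>2 \<partial>lborel \<partial>lborel))"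
    by (rule Loomis_Whitney) measurable
  also have "\<dots> = I^3" by (simp add: ennreal_sqrt_sq Ia Ib Ic power3_eq_cube mult.assoc)
  finally have SI: "S\<^sup>2 \<le> I^3" .
  have "I = (\<integral>\<^sup>+x. ennreal (4 * \<bar>\<phi> x\<bar>^3) * ennreal (norm (grad \<phi> x)) \<partial>lborel)"
    by (simp add: I_def D_def ennreal_mult)
  also have "\<dots>\<^sup>2 \<le> (\<integral>\<^sup>+x. (ennreal (4 * \<bar>\<phi> x\<bar>^3))\<^sup>2 \<partial>lborel) * (\<integral>\<^sup>+x. (ennreal (norm (grad \<phi> x)))\<^sup>2 \<partial>lborel)"
    by (rule Cauchy_Schwarz_nn_integral) measurable
  also have "(\<integral>\<^sup>+x. (ennreal (norm (grad \<phi> x)))\<^sup>2 \<partial>lborel) = G"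
    by (simp add: G_def ennreal_power)
  also have "(\<integral>\<^sup>+x. (ennreal (4 * \<bar>\<phi> x\<bar>^3))\<^sup>2 \<partial>lborel) = (\<integral>\<^sup>+x. 16 * ennreal ((\<phi> x)^6) \<partial>lborel)"
  proof (intro nn_integral_cong)
    fix x
    have "(4 * \<bar>\<phi> x\<bar>^3)\<^sup>2 = 16 * (\<phi> x)^6"
      by (simp add: power_mult_distrib flip: power_mult)
    then show "(ennreal (4 * \<bar>\<phi> x\<bar>^3))\<^sup>2 = 16 * ennreal ((\<phi> x)^6)"
      by (simp add: ennreal_power ennreal_mult)
  qed
  also have "\<dots> = 16 * S" by (simp add: S_def nn_integral_cmult)
  finally have IS: "I\<^sup>2 \<le> 16 * S * G" .
  \<comment> \<open>From S^2 \<le> I^3 and I^2 \<le> 16 S G follows S^4 \<le> I^6 \<le> 16^3 S^3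
    G^3, where 16^3 = 4096. Finiteness of \<open>S\<close> allows \<open>S^3\<close> to be
    cancelled.\<close>
  have "S < top"
  proof -
    obtain K where K: "compact K" "\<And>x. x \<notin> K \<Longrightarrow> \<phi> x = 0"
      using test_function_support[OF t] by metis
    obtain B where B: "B \<ge> 0" "\<And>x. \<bar>\<phi> x\<bar> \<le> B" using test_function_bounded[OF t] by metis
    have "S \<le> (\<integral>\<^sup>+x. ennreal (B^6) * indicator K x \<partial>lborel)"
      unfolding S_def
    proof (intro nn_integral_mono)
      fix x show "ennreal ((\<phi> x)^6) \<le> ennreal (B^6) * indicator K x"
        using power_mono[OF B(2)[of x], of 6] K(2)[of x] by (auto split: split_indicator intro: ennreal_leI)
    qed
    also have "\<dots> = ennreal (B^6) * emeasure lborel K"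
      using K(1) by (intro nn_integral_cmult_indicator) (simp add: borel_compact)
    also have "\<dots> < top" using emeasure_compact_finite[OF K(1)] by (simp add: ennreal_mult_less_top)
    finally show ?thesis .
  qed
  moreover have "S * S^3 \<le> (4096 * G^3) * S^3"
  proof -
    have "S * S^3 = (S\<^sup>2)\<^sup>2" by (simp add: power_numeral_reduce mult_ac)
    also have "\<dots> \<le> (I^3)\<^sup>2" by (intro power_mono SI) simp
    also have "\<dots> = (I\<^sup>2)^3" by (simp flip: power_mult)
    also have "\<dots> \<le> (16 * S * G)^3" by (intro power_mono IS) simp
    also have "\<dots> = (4096 * G^3) * S^3" by (simp add: power_mult_distrib mult_ac)
    finally show ?thesis .
  qed
  ultimately have "S \<le> 4096 * G^3"
    by (cases "S = 0") (auto simp: ennreal_mult_le_mult_iff mult.commute[of _ "S^3"] power_eq_top_ennreal less_top)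
  then show ?thesis by (simp add: S_def G_def)
qed

section \<open>The Dirichlet inner product and the Sobolev inequality on \<open>H10\<close>\<close>

context bounded_open_set
begin

abbreviation gip :: "(real^3 \<Rightarrow> real) \<Rightarrow> (real^3 \<Rightarrow> real) \<Rightarrow> real" where
  "gip u w \<equiv> L2_inner \<Omega> (weak_grad \<Omega> u) (weak_grad \<Omega> w)"

abbreviation gnorm :: "(real^3 \<Rightarrow> real) \<Rightarrow> real" where
  "gnorm u \<equiv> L2_norm \<Omega> (weak_grad \<Omega> u)"

text \<open>\<open>weak_grad\<close> of the zero function is some weak gradient, so its norm
  vanishes by uniqueness and not by computation.\<close>

lemma H10_zero: "(\<lambda>x. 0) \<in> H10 \<Omega>" and gnorm_zero: "gnorm (\<lambda>x. 0) = 0"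
proof -
  have z: "is_weak_gradient \<Omega> (\<lambda>x. 0) (\<lambda>x. 0)" by (simp add: is_weak_gradient_def L2_zero)
  then have H1: "(\<lambda>x. 0) \<in> H1 \<Omega>" by (auto simp: H1_def L2_zero)
  have L: "weak_grad \<Omega> (\<lambda>x. 0) \<in> L2 \<Omega>"
    using H1_weak_grad[OF H1] by (simp add: is_weak_gradient_def)
  show g: "gnorm (\<lambda>x. 0) = 0"
    using weak_gradient_unique[OF H1_weak_grad[OF H1] z] by (simp add: L2_norm_zero_iff[OF L])
  have n: "L2_norm \<Omega> (\<lambda>x. 0::real) = 0" by (simp add: L2_norm_def L2_inner_def)
  have t: "test_function \<Omega> (\<lambda>x. 0)" by (rule test_functionI[of _ "{}"]) (auto intro: Ck_on_const)
  have gr: "grad (\<lambda>x. 0) x = 0" for x by (simp add: grad_def vec_eq_iff frechet_derivative_const)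
  show "(\<lambda>x. 0) \<in> H10 \<Omega>"
    unfolding H10_def using H1 t g n gr by (auto intro!: exI[of _ "\<lambda>x. 0"])
qed

lemma H10_add: "u \<in> H10 \<Omega> \<Longrightarrow> w \<in> H10 \<Omega> \<Longrightarrow> (\<lambda>x. u x + w x) \<in> H10 \<Omega>"
  using weak_grad_add_mult(1)[of u w 1] by simp

lemma H10_diff: "u \<in> H10 \<Omega> \<Longrightarrow> w \<in> H10 \<Omega> \<Longrightarrow> (\<lambda>x. u x - w x) \<in> H10 \<Omega>"
  using weak_grad_add_mult(1)[of u w "-1"] by simp

lemma H10_mult: "u \<in> H10 \<Omega> \<Longrightarrow> (\<lambda>x. c * u x) \<in> H10 \<Omega>"
  using weak_grad_add_mult(1)[OF H10_zero, of u c] by simp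

lemma gip_add_mult_left:
  assumes "u \<in> H10 \<Omega>" "w \<in> H10 \<Omega>" "z \<in> H10 \<Omega>"
  shows "gip (\<lambda>x. u x + c * w x) z = gip u z + c * gip w z"
proof -
  have "gip (\<lambda>x. u x + c * w x) z = L2_inner \<Omega> (\<lambda>x. weak_grad \<Omega> u x + c *\<^sub>R weak_grad \<Omega> w x) (weak_grad \<Omega> z)"
    by (intro L2_inner_cong_AE weak_grad_add_mult assms L2_borel L2_add L2_scale H10_weak_grad_L2) simp
  then show ?thesis
    by (simp only: L2_inner_add_left[OF H10_weak_grad_L2[OF assms(1)] L2_scale[OF H10_weak_grad_L2[OF assms(2)]]
      H10_weak_grad_L2[OF assms(3)]] L2_inner_scale_left)
qed

lemma gip_commute: "gip u w = gip w u" by (rule L2_inner_commute)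

lemma gip_add_left: "u \<in> H10 \<Omega> \<Longrightarrow> w \<in> H10 \<Omega> \<Longrightarrow> z \<in> H10 \<Omega> \<Longrightarrow> gip (\<lambda>x. u x + w x) z = gip u z + gip w z"
  using gip_add_mult_left[of u w z 1] by simp

lemma gip_diff_left: "u \<in> H10 \<Omega> \<Longrightarrow> w \<in> H10 \<Omega> \<Longrightarrow> z \<in> H10 \<Omega> \<Longrightarrow> gip (\<lambda>x. u x - w x) z = gip u z - gip w z"
  using gip_add_mult_left[of u w z "-1"] by simp

lemma gip_zero_left: "z \<in> H10 \<Omega> \<Longrightarrow> gip (\<lambda>x. 0) z = 0"
  using gip_diff_left[OF H10_zero H10_zero, of z] by simp

lemma gip_mult_left: "u \<in> H10 \<Omega> \<Longrightarrow> z \<in> H10 \<Omega> \<Longrightarrow> gip (\<lambda>x. c * u x) z = c * gip u z"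
  using gip_add_mult_left[OF H10_zero, of u z c] by (simp add: gip_zero_left)

lemma gip_add_right: "u \<in> H10 \<Omega> \<Longrightarrow> w \<in> H10 \<Omega> \<Longrightarrow> z \<in> H10 \<Omega> \<Longrightarrow> gip z (\<lambda>x. u x + w x) = gip z u + gip z w"
  unfolding gip_commute[of z] by (rule gip_add_left)

lemma gip_diff_right: "u \<in> H10 \<Omega> \<Longrightarrow> w \<in> H10 \<Omega> \<Longrightarrow> z \<in> H10 \<Omega> \<Longrightarrow> gip z (\<lambda>x. u x - w x) = gip z u - gip z w"
  unfolding gip_commute[of z] by (rule gip_diff_left)

lemma gip_mult_right: "u \<in> H10 \<Omega> \<Longrightarrow> z \<in> H10 \<Omega> \<Longrightarrow> gip z (\<lambda>x. c * u x) = c * gip z u"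
  unfolding gip_commute[of z] by (rule gip_mult_left)

lemma gnorm_nonneg: "0 \<le> gnorm u" by (rule L2_norm_nonneg)

lemma gnorm_sq: "(gnorm u)\<^sup>2 = gip u u" by (rule L2_norm_sq)

lemma gip_bound: "u \<in> H10 \<Omega> \<Longrightarrow> w \<in> H10 \<Omega> \<Longrightarrow> \<bar>gip u w\<bar> \<le> gnorm u * gnorm w"
  by (intro L2_Cauchy_Schwarz H10_weak_grad_L2)

lemma gnorm_add_mult:
  assumes u: "u \<in> H10 \<Omega>" "w \<in> H10 \<Omega>"
  shows "gnorm (\<lambda>x. u x + c * w x) \<le> gnorm u + \<bar>c\<bar> * gnorm w"
proof -
  have "gnorm (\<lambda>x. u x + c * w x) = L2_norm \<Omega> (\<lambda>x. weak_grad \<Omega> u x + c *\<^sub>R weak_grad \<Omega> w x)"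
    by (intro L2_norm_cong_AE weak_grad_add_mult u L2_borel L2_add L2_scale H10_weak_grad_L2)
  also have "\<dots> \<le> gnorm u + L2_norm \<Omega> (\<lambda>x. c *\<^sub>R weak_grad \<Omega> w x)"
    by (intro L2_norm_triangle L2_scale H10_weak_grad_L2 u)
  finally show ?thesis by (simp only: L2_norm_scale)
qed

lemma gnorm_add: "u \<in> H10 \<Omega> \<Longrightarrow> w \<in> H10 \<Omega> \<Longrightarrow> gnorm (\<lambda>x. u x + w x) \<le> gnorm u + gnorm w"
  using gnorm_add_mult[of u w 1] by simp

lemma gnorm_diff: "u \<in> H10 \<Omega> \<Longrightarrow> w \<in> H10 \<Omega> \<Longrightarrow> gnorm (\<lambda>x. u x - w x) \<le> gnorm u + gnorm w"
  using gnorm_add_mult[of u w "-1"] by simp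

lemma gnorm_mult:
  assumes u: "u \<in> H10 \<Omega>" shows "gnorm (\<lambda>x. c * u x) = \<bar>c\<bar> * gnorm u"
proof -
  have "(gnorm (\<lambda>x. c * u x))\<^sup>2 = (\<bar>c\<bar> * gnorm u)\<^sup>2"
    unfolding power_mult_distrib gnorm_sq
    by (simp add: gip_mult_left[OF u H10_mult[OF u]] gip_mult_right[OF u u] power2_eq_square)
  then show ?thesis by (simp add: gnorm_nonneg)
qed

lemma gnorm_minus_commute:
  "u \<in> H10 \<Omega> \<Longrightarrow> w \<in> H10 \<Omega> \<Longrightarrow> gnorm (\<lambda>x. u x - w x) = gnorm (\<lambda>x. w x - u x)"
  using gnorm_mult[OF H10_diff, of w u "-1"] by simp

lemma gnorm_triangle_diff:
  "u \<in> H10 \<Omega> \<Longrightarrow> w \<in> H10 \<Omega> \<Longrightarrow> z \<in> H10 \<Omega> \<Longrightarrow>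
    gnorm (\<lambda>x. u x - w x) \<le> gnorm (\<lambda>x. u x - z x) + gnorm (\<lambda>x. z x - w x)"
  using gnorm_add[OF H10_diff H10_diff, of u z z w] by simp

lemma gnorm_abs_diff:
  assumes "u \<in> H10 \<Omega>" "w \<in> H10 \<Omega>" shows "\<bar>gnorm u - gnorm w\<bar> \<le> gnorm (\<lambda>x. u x - w x)"
proof -
  have "gnorm u \<le> gnorm w + gnorm (\<lambda>x. u x - w x)"
    using gnorm_add[OF assms(2) H10_diff[OF assms]] by simp
  moreover have "gnorm w \<le> gnorm u + gnorm (\<lambda>x. u x - w x)"
    using gnorm_diff[OF assms(1) H10_diff[OF assms]] by simp
  ultimately show ?thesis by linarith
qed

lemma nn_integral_dom_le:
  "(\<integral>\<^sup>+x. f x \<partial>lebesgue_on \<Omega>) \<le> (\<integral>\<^sup>+x. f x \<partial>lborel)"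
proof -
  have "(\<integral>\<^sup>+x. f x \<partial>lebesgue_on \<Omega>) = (\<integral>\<^sup>+x. f x * indicator \<Omega> x \<partial>lebesgue)"
    by (simp add: nn_integral_restrict_space)
  also have "\<dots> \<le> (\<integral>\<^sup>+x. f x \<partial>lebesgue)"
    by (intro nn_integral_mono) (auto split: split_indicator)
  finally show ?thesis by (simp add: nn_integral_completion)
qed

text \<open>The gradient vanishes outside the domain, so the integral over the whole space is the
  squared norm over \<open>\<Omega>\<close>; its cube is the sixth power.\<close>

lemma Sobolev_test_function_dom:
  assumes t: "test_function \<Omega> \<phi>"
  shows "(\<integral>\<^sup>+x. ennreal ((\<phi> x)^6) \<partial>lebesgue_on \<Omega>) \<le> ennreal (4096 * (L2_norm \<Omega> (grad \<phi>))^6)"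
proof -
  obtain K where K: "K \<subseteq> \<Omega>" "\<And>x b. x \<notin> K \<Longrightarrow> frechet_derivative \<phi> (at x) b = 0"
    using test_function_support[OF t] by metis
  then have z: "grad \<phi> x = 0" if "x \<notin> \<Omega>" for x
    using that by (auto simp: vec_eq_iff grad_nth)
  have "(\<integral>\<^sup>+x. ennreal ((norm (grad \<phi> x))\<^sup>2) \<partial>lborel) = (\<integral>\<^sup>+x. ennreal ((norm (grad \<phi> x))\<^sup>2) * indicator \<Omega> x \<partial>lebesgue)"
    unfolding nn_integral_completion by (intro nn_integral_cong) (auto split: split_indicator simp: z)
  also have "\<dots> = (\<integral>\<^sup>+x. ennreal ((norm (grad \<phi> x))\<^sup>2) \<partial>lebesgue_on \<Omega>)"
    by (simp add: nn_integral_restrict_space)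
  also have "\<dots> = ennreal (LINT x|lebesgue_on \<Omega>. (norm (grad \<phi> x))\<^sup>2)"
    by (intro nn_integral_eq_integral L2_integrable_sq L2_grad t) simp
  also have "\<dots> = ennreal ((L2_norm \<Omega> (grad \<phi>))\<^sup>2)"
    by (simp add: L2_norm_sq L2_inner_self)
  finally have eq: "(\<integral>\<^sup>+x. ennreal ((norm (grad \<phi> x))\<^sup>2) \<partial>lborel) = ennreal ((L2_norm \<Omega> (grad \<phi>))\<^sup>2)" .
  have "(\<integral>\<^sup>+x. ennreal ((\<phi> x)^6) \<partial>lebesgue_on \<Omega>) \<le> 4096 * (ennreal ((L2_norm \<Omega> (grad \<phi>))\<^sup>2))^3"
    using nn_integral_dom_le Sobolev_test_function[OF t] unfolding eq by (rule order_trans)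
  also have "\<dots> = ennreal (4096 * (L2_norm \<Omega> (grad \<phi>))^6)"
    by (simp add: ennreal_power ennreal_mult flip: power_mult)
  finally show ?thesis .
qed

text \<open>Fatou's lemma along approximating test functions. Working with
  \<open>nn_integral\<close> yields finiteness of the sixth moment together with the bound.\<close>

lemma H10_Sobolev_nn:
  assumes u: "u \<in> H10 \<Omega>"
  shows "(\<integral>\<^sup>+x. ennreal ((u x)^6) \<partial>lebesgue_on \<Omega>) \<le> ennreal (4096 * (gnorm u)^6)"
proof -
  have "\<exists>\<phi>. test_function \<Omega> \<phi> \<and> L2_norm \<Omega> (\<lambda>x. u x - \<phi> x) < inverse (real (Suc n))
      \<and> L2_norm \<Omega> (\<lambda>x. weak_grad \<Omega> u x - grad \<phi> x) < inverse (real (Suc n))" for n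
    using u by (simp add: H10_def)
  then obtain \<phi> where t: "\<And>n. test_function \<Omega> (\<phi> n)"
    and a: "\<And>n. L2_norm \<Omega> (\<lambda>x. u x - \<phi> n x) < inverse (real (Suc n))"
    and b: "\<And>n. L2_norm \<Omega> (\<lambda>x. weak_grad \<Omega> u x - grad (\<phi> n) x) < inverse (real (Suc n))"
    by metis
  note L = H10_L2[OF u] H10_weak_grad_L2[OF u] L2_test_function[OF t] L2_grad[OF t]
  have i0: "(\<lambda>n. inverse (real (Suc n))) \<longlonglongrightarrow> 0" by (rule LIMSEQ_inverse_real_of_nat)
  have "(\<lambda>n. (LINT x|lebesgue_on \<Omega>. norm ((norm (u x - \<phi> n x))\<^sup>2))) \<longlonglongrightarrow> 0"
  proof (rule tendsto_sandwich[OF _ _ tendsto_const])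
    show "(\<lambda>n. (inverse (real (Suc n)))\<^sup>2) \<longlonglongrightarrow> 0" using tendsto_power[OF i0, of 2] by simp
    have "(LINT x|lebesgue_on \<Omega>. norm ((norm (u x - \<phi> n x))\<^sup>2)) = (L2_norm \<Omega> (\<lambda>x. u x - \<phi> n x))\<^sup>2" for n
      by (simp add: L2_norm_sq L2_inner_self)
    then show "\<forall>\<^sub>F n in sequentially. (LINT x|lebesgue_on \<Omega>. norm ((norm (u x - \<phi> n x))\<^sup>2)) \<le> (inverse (real (Suc n)))\<^sup>2"
      by (intro always_eventually allI) (simp only:, intro power_mono less_imp_le[OF a] L2_norm_nonneg)
  qed simp
  \<comment> \<open>L2 convergence, read as L1 convergence of the squares, gives pointwise
    convergence only along a subsequence.\<close>
  then obtain r :: "nat \<Rightarrow> nat" where r: "strict_mono r"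
    and conv: "AE x in lebesgue_on \<Omega>. (\<lambda>n. (norm (u x - \<phi> (r n) x))\<^sup>2) \<longlonglongrightarrow> 0"
    using tendsto_L1_AE_subseq[of "lebesgue_on \<Omega>" "\<lambda>n x. (norm (u x - \<phi> n x))\<^sup>2"]
      L2_integrable_sq[OF L2_diff[OF L(1,3)]] by blast
  have "AE x in lebesgue_on \<Omega>. ennreal ((u x)^6) = liminf (\<lambda>n. ennreal ((\<phi> (r n) x)^6))"
    using conv
  proof eventually_elim
    case (elim x)
    have "(\<lambda>n. sqrt ((norm (u x - \<phi> (r n) x))\<^sup>2)) \<longlonglongrightarrow> sqrt 0" by (intro tendsto_real_sqrt elim)
    then have "(\<lambda>n. u x - \<phi> (r n) x) \<longlonglongrightarrow> 0" by (simp add: tendsto_rabs_zero_iff)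
    then have "(\<lambda>n. u x - (u x - \<phi> (r n) x)) \<longlonglongrightarrow> u x - 0" by (intro tendsto_diff tendsto_const)
    then have "(\<lambda>n. \<phi> (r n) x) \<longlonglongrightarrow> u x" by simp
    then have "(\<lambda>n. ennreal ((\<phi> (r n) x)^6)) \<longlonglongrightarrow> ennreal ((u x)^6)"
      by (intro tendsto_ennrealI tendsto_power)
    from lim_imp_Liminf[OF trivial_limit_sequentially this] show ?case by (rule sym)
  qed
  then have "(\<integral>\<^sup>+x. ennreal ((u x)^6) \<partial>lebesgue_on \<Omega>) = (\<integral>\<^sup>+x. liminf (\<lambda>n. ennreal ((\<phi> (r n) x)^6)) \<partial>lebesgue_on \<Omega>)"
    by (rule nn_integral_cong_AE)
  also have "\<dots> \<le> liminf (\<lambda>n. \<integral>\<^sup>+x. ennreal ((\<phi> (r n) x)^6) \<partial>lebesgue_on \<Omega>)"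
    by (intro nn_integral_liminf) (use L2_borel[OF L(3)] in measurable)
  also have "\<dots> \<le> liminf (\<lambda>n. ennreal (4096 * (gnorm u + inverse (real (Suc (r n))))^6))"
  proof (intro Liminf_mono always_eventually allI)
    fix n
    have "L2_norm \<Omega> (grad (\<phi> (r n))) \<le> gnorm u + L2_norm \<Omega> (\<lambda>x. grad (\<phi> (r n)) x - weak_grad \<Omega> u x)"
      using L2_norm_triangle[OF L(2) L2_diff[OF L(4)[of "r n"] L(2)]] by simp
    also have "\<dots> \<le> gnorm u + inverse (real (Suc (r n)))"
      using b[of "r n"] by (simp add: L2_norm_minus_commute[of \<Omega> "grad (\<phi> (r n))"])
    finally have "ennreal (4096 * (L2_norm \<Omega> (grad (\<phi> (r n))))^6) \<le> ennreal (4096 * (gnorm u + inverse (real (Suc (r n))))^6)"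
      by (intro ennreal_leI mult_left_mono power_mono L2_norm_nonneg) auto
    with Sobolev_test_function_dom[OF t, of "r n"]
    show "(\<integral>\<^sup>+x. ennreal ((\<phi> (r n) x)^6) \<partial>lebesgue_on \<Omega>) \<le> ennreal (4096 * (gnorm u + inverse (real (Suc (r n))))^6)"
      by (rule order_trans)
  qed
  also have "\<dots> = ennreal (4096 * (gnorm u)^6)"
  proof (rule lim_imp_Liminf)
    have "(\<lambda>n. ennreal (4096 * (gnorm u + inverse (real (Suc (r n))))^6)) \<longlonglongrightarrow> ennreal (4096 * (gnorm u + 0)^6)"
      using LIMSEQ_subseq_LIMSEQ[OF i0 r] by (intro tendsto_ennrealI tendsto_intros) (simp add: o_def)
    then show "(\<lambda>n. ennreal (4096 * (gnorm u + inverse (real (Suc (r n))))^6)) \<longlonglongrightarrow> ennreal (4096 * (gnorm u)^6)" by simp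
  qed simp
  finally show ?thesis .
qed

lemma H10_Sobolev:
  assumes u: "u \<in> H10 \<Omega>"
  shows "integrable (lebesgue_on \<Omega>) (\<lambda>x. (u x)^6)"
    and "(LINT x|lebesgue_on \<Omega>. (u x)^6) \<le> 4096 * (gnorm u)^6"
proof -
  have m: "(\<lambda>x. (u x)^6) \<in> borel_measurable (lebesgue_on \<Omega>)"
    using L2_borel[OF H10_L2[OF u]] by measurable
  have fin: "(\<integral>\<^sup>+x. ennreal ((u x)^6) \<partial>lebesgue_on \<Omega>) < top"
    using H10_Sobolev_nn[OF u] by (rule order.strict_trans1) simp
  show i: "integrable (lebesgue_on \<Omega>) (\<lambda>x. (u x)^6)"
    by (rule integrableI_nonneg[OF m]) (use fin in \<open>simp_all add: infinity_ennreal_def\<close>)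
  have "ennreal (LINT x|lebesgue_on \<Omega>. (u x)^6) = (\<integral>\<^sup>+x. ennreal ((u x)^6) \<partial>lebesgue_on \<Omega>)"
    by (rule nn_integral_eq_integral[symmetric, OF i]) simp
  also have "\<dots> \<le> ennreal (4096 * (gnorm u)^6)" by (rule H10_Sobolev_nn[OF u])
  finally show "(LINT x|lebesgue_on \<Omega>. (u x)^6) \<le> 4096 * (gnorm u)^6"
    by (subst (asm) ennreal_le_iff) (simp_all add: gnorm_nonneg)
qed

end

section \<open>The nonlinearity\<close>

text \<open>The product has total degree 6, so it is at most the sixth power of the largest factor,
  which is one of the summands. After scaling this replaces Hoelder's inequality with exponents 3/2,
  6, 6.\<close>

lemma young6: "x^4 * \<bar>y\<bar> * \<bar>z\<bar> \<le> x^6 + y^6 + (z::real)^6"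
proof -
  define m where "m = max \<bar>x\<bar> (max \<bar>y\<bar> \<bar>z\<bar>)"
  have m: "\<bar>x\<bar> \<le> m" "\<bar>y\<bar> \<le> m" "\<bar>z\<bar> \<le> m" by (auto simp: m_def)
  have "x^4 * \<bar>y\<bar> * \<bar>z\<bar> = \<bar>x\<bar>^4 * \<bar>y\<bar> * \<bar>z\<bar>" by simp
  also have "\<dots> \<le> m^4 * m * m" using m by (intro mult_mono power_mono mult_nonneg_nonneg zero_le_power) linarith+
  also have "\<dots> = m^6" by (simp add: eval_nat_numeral mult.assoc)
  also have "\<dots> \<le> \<bar>x\<bar>^6 + \<bar>y\<bar>^6 + \<bar>z\<bar>^6"
  proof -
    have "m = \<bar>x\<bar> \<or> m = \<bar>y\<bar> \<or> m = \<bar>z\<bar>" by (auto simp: m_def max_def)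
    then show ?thesis by (elim disjE) simp_all
  qed
  finally show ?thesis by simp
qed

lemma four_power_between:
  fixes a b s :: real
  assumes "min a b \<le> s" "s \<le> max a b" shows "s^4 \<le> a^4 + b^4"
proof -
  have "\<bar>s\<bar> \<le> max \<bar>a\<bar> \<bar>b\<bar>" using assms by linarith
  then have "\<bar>s\<bar>^4 \<le> (max \<bar>a\<bar> \<bar>b\<bar>)^4" by (intro power_mono) auto
  also have "\<dots> \<le> \<bar>a\<bar>^4 + \<bar>b\<bar>^4" unfolding max_def by auto
  finally show ?thesis by simp
qed

lemma real_MVT:
  fixes g g' :: "real \<Rightarrow> real"
  assumes "\<And>x. (g has_real_derivative g' x) (at x)"
  obtains s where "min a b \<le> s" "s \<le> max a b" "g b - g a = g' s * (b - a)"
proof (cases a b rule: linorder_cases)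
  case less
  from MVT2[OF less, of g g'] assms obtain z where "a < z" "z < b" "g b - g a = (b - a) * g' z" by blast
  then show ?thesis using that[of z] less by (simp add: mult.commute)
next
  case equal then show ?thesis using that[of a] by simp
next
  case greater
  from MVT2[OF greater, of g g'] assms obtain z where "b < z" "z < a" "g a - g b = (a - b) * g' z" by blast
  then show ?thesis using that[of z] greater by (simp add: algebra_simps)
qed

lemma primitive_exists:
  fixes f :: "real \<Rightarrow> real"
  assumes "continuous_on UNIV f"
  obtains F where "\<And>x. (F has_real_derivative f x) (at x)" "F 0 = 0"
proof -
  define F where "F x = (LBINT y=0..x. f y)" for x :: real
  have "(F has_real_derivative f x) (at x)" for x
  proof -
    \<comment> \<open>The derivative of the integral is available on compact intervals; this one has
      both 0 and \<open>x\<close> in its interior.\<close>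
    define r where "r = \<bar>x\<bar> + 1"
    have "(F has_vector_derivative f x) (at x within {-r..r})"
      unfolding F_def zero_ereal_def
      by (rule interval_integral_FTC2) (use assms in \<open>auto simp: r_def intro: continuous_on_subset\<close>)
    then have "(F has_vector_derivative f x) (at x within {-r<..<r})"
      by (rule has_vector_derivative_within_subset) auto
    moreover have "at x within {-r<..<r} = at x"
      by (rule at_within_open) (auto simp: r_def)
    ultimately show ?thesis by (simp add: has_real_derivative_iff_has_vector_derivative)
  qed
  moreover have "F 0 = 0" by (simp add: F_def zero_ereal_def)
  ultimately show ?thesis using that by blast
qed

text \<open>Two applications of the mean value theorem: the cubic bound on f'' gives a quartic one
  on f', and the intermediate point is controlled by \<open>a\<close> and \<open>b\<close>.\<close>

lemma admissible_nonlinearity_Lipschitz: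
  assumes "admissible_nonlinearity \<Omega> f"
  obtains K where "K \<ge> 0" "\<And>a b. \<bar>f a - f b\<bar> \<le> K * (1 + a^4 + b^4) * \<bar>a - b\<bar>"
proof -
  from assms obtain L where L: "L > 0" "\<And>s. \<bar>deriv (deriv f) s\<bar> \<le> L * (1 + \<bar>s\<bar> ^ 3)" and C: "Ck_on 2 f UNIV"
    by (auto simp: admissible_nonlinearity_def)
  have d1: "(f has_real_derivative deriv f x) (at x)" for x
    using C by (auto simp: numeral_2_eq_2 DERIV_deriv_iff_real_differentiable)
  have "frechet_derivative f (at x) 1 = deriv f x" for x
    using frechet_derivative_at'[OF d1[THEN has_field_derivative_imp_has_derivative]] by simp
  then have "(deriv f) differentiable (at x)" for x
    using C by (simp add: numeral_2_eq_2)
  then have d2: "(deriv f has_real_derivative deriv (deriv f) x) (at x)" for x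
    by (simp add: DERIV_deriv_iff_real_differentiable)
  \<comment> \<open>The mean value theorem from 0 to s bounds f' by |f'(0)| + L (|s| + s^4), and |s|
    + s^4 \<le> 2 (1 + s^4).\<close>
  define K where "K = \<bar>deriv f 0\<bar> + 2 * L"
  have b: "\<bar>deriv f s\<bar> \<le> K * (1 + s^4)" for s
  proof -
    obtain z where z: "min 0 s \<le> z" "z \<le> max 0 s" "deriv f s - deriv f 0 = deriv (deriv f) z * (s - 0)"
      using real_MVT[OF d2] by metis
    have "\<bar>deriv f s\<bar> \<le> \<bar>deriv f 0\<bar> + \<bar>deriv (deriv f) z\<bar> * \<bar>s\<bar>"
      using z(3) abs_mult[of "deriv (deriv f) z" s] by simp
    also have "\<bar>deriv (deriv f) z\<bar> * \<bar>s\<bar> \<le> (L * (1 + \<bar>s\<bar>^3)) * \<bar>s\<bar>"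
    proof (rule mult_right_mono)
      have "\<bar>z\<bar>^3 \<le> \<bar>s\<bar>^3" using z by (intro power_mono) auto
      then have "L * (1 + \<bar>z\<bar>^3) \<le> L * (1 + \<bar>s\<bar>^3)" using L(1) by simp
      with L(2)[of z] show "\<bar>deriv (deriv f) z\<bar> \<le> L * (1 + \<bar>s\<bar>^3)" by linarith
    qed simp
    also have "\<dots> = L * (\<bar>s\<bar> + s^4)"
    proof -
      have "\<bar>s\<bar>^3 * \<bar>s\<bar> = \<bar>s\<bar>^4" by (simp add: eval_nat_numeral mult.assoc)
      then show ?thesis by (simp add: distrib_right mult.assoc)
    qed
    also have "\<dots> \<le> L * (2 * (1 + s^4))"
    proof (intro mult_left_mono)
      have "\<bar>s\<bar> \<le> 1 + s^4"
      proof (cases "\<bar>s\<bar> \<le> 1")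
        case False
        then have "\<bar>s\<bar>^1 \<le> \<bar>s\<bar>^4" by (intro power_increasing) auto
        then show ?thesis by simp
      qed (simp add: add_increasing2)
      then show "\<bar>s\<bar> + s^4 \<le> 2 * (1 + s^4)" by simp
    qed (use L in simp)
    also have "\<bar>deriv f 0\<bar> + L * (2 * (1 + s^4)) \<le> K * (1 + s^4)"
      using mult_left_mono[of 1 "1 + s^4" "\<bar>deriv f 0\<bar>"] by (simp add: K_def algebra_simps)
    finally show ?thesis by simp
  qed
  have K: "K \<ge> 0" using L by (simp add: K_def)
  have "\<bar>f a - f b\<bar> \<le> K * (1 + a^4 + b^4) * \<bar>a - b\<bar>" for a b
  proof -
    obtain z where z: "min b a \<le> z" "z \<le> max b a" "f a - f b = deriv f z * (a - b)"
      using real_MVT[OF d1] by metis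
    have "K * (1 + z^4) \<le> K * (1 + a^4 + b^4)"
      using four_power_between[OF z(1,2)] K by (intro mult_left_mono) auto
    with b[of z] have "\<bar>deriv f z\<bar> \<le> K * (1 + a^4 + b^4)" by linarith
    then show ?thesis unfolding z(3) abs_mult by (rule mult_right_mono) simp
  qed
  then show ?thesis using that K by blast
qed

section \<open>Integral estimates for nonlinear terms by gradient norms\<close>

context bounded_open_set
begin

text \<open>A consequence of the Sobolev inequality on a set of finite measure: integrate y^2 \<le>
  1 + y^6 for y = |u| / \<open>gnorm u\<close>. If the gradient norm is zero, the sixth moment is
  zero and \<open>u\<close> vanishes almost everywhere.\<close>

lemma Poincare:
  obtains C where "C \<ge> 0" "\<And>u. u \<in> H10 \<Omega> \<Longrightarrow> L2_norm \<Omega> u \<le> C * gnorm u"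
proof -
  define C where "C = sqrt (measure lebesgue \<Omega> + 4096)"
  have "L2_norm \<Omega> u \<le> C * gnorm u" if u: "u \<in> H10 \<Omega>" for u
  proof (cases "gnorm u = 0")
    case True
    have "0 \<le> (LINT x|lebesgue_on \<Omega>. (u x)^6)" by simp
    then have "(LINT x|lebesgue_on \<Omega>. (u x)^6) = 0"
      using H10_Sobolev(2)[OF u] True by (intro antisym) simp_all
    then have "AE x in lebesgue_on \<Omega>. (u x)^6 = 0"
      by (subst (asm) integral_nonneg_eq_0_iff_AE[OF H10_Sobolev(1)[OF u]]) auto
    then have "L2_norm \<Omega> u = 0" by (simp add: L2_norm_zero_iff[OF H10_L2[OF u]])
    then show ?thesis using True by simp
  next
    case False
    define t where "t = gnorm u"
    have t: "t > 0" using False gnorm_nonneg[of u] by (simp add: t_def)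
    have "L2_inner \<Omega> u u = t\<^sup>2 * (LINT x|lebesgue_on \<Omega>. (u x / t)\<^sup>2)"
      using t by (simp add: L2_inner_self power_divide)
    also have "\<dots> \<le> t\<^sup>2 * (LINT x|lebesgue_on \<Omega>. 1 + (u x)^6 / t^6)"
    proof (intro mult_left_mono integral_mono)
      show "integrable (lebesgue_on \<Omega>) (\<lambda>x. (u x / t)\<^sup>2)"
        using L2_integrable_sq[OF H10_L2[OF u]] by (simp add: power_divide)
      show "integrable (lebesgue_on \<Omega>) (\<lambda>x. 1 + (u x)^6 / t^6)"
        using H10_Sobolev(1)[OF u] by (intro Bochner_Integration.integrable_add integrable_const_dom) simp
      fix x
      define y where "y = \<bar>u x / t\<bar>"
      have "y\<^sup>2 \<le> 1 + y^6"
      proof (cases "y \<le> 1")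
        case True
        then have "y\<^sup>2 \<le> 1" by (intro power_le_one) (auto simp: y_def)
        then show ?thesis by (simp add: add_increasing2)
      next
        case False
        then have "y\<^sup>2 \<le> y^6" by (intro power_increasing) auto
        then show ?thesis by simp
      qed
      then show "(u x / t)\<^sup>2 \<le> 1 + (u x)^6 / t^6" by (simp add: y_def power_divide)
    qed simp
    also have "(LINT x|lebesgue_on \<Omega>. 1 + (u x)^6 / t^6) = measure lebesgue \<Omega> + (LINT x|lebesgue_on \<Omega>. (u x)^6) / t^6"
      using H10_Sobolev(1)[OF u] integrable_const_dom[of 1]
      by (simp add: measure_restrict_space)
    also have "\<dots> \<le> measure lebesgue \<Omega> + 4096"
      using H10_Sobolev(2)[OF u] t by (simp add: t_def[symmetric] divide_le_eq)
    also have "t\<^sup>2 * (measure lebesgue \<Omega> + 4096) = (C * t)\<^sup>2"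
      by (simp add: C_def power_mult_distrib)
    finally have "(L2_norm \<Omega> u)\<^sup>2 \<le> (C * t)\<^sup>2" by (simp add: L2_norm_sq mult_left_mono)
    then have "L2_norm \<Omega> u \<le> C * t"
      by (rule power2_le_imp_le) (use t in \<open>simp add: C_def\<close>)
    then show ?thesis by (simp add: t_def)
  qed
  moreover have "C \<ge> 0" by (simp add: C_def)
  ultimately show ?thesis using that by blast
qed

text \<open>\<open>young6\<close> is applied after each function has been scaled to have sixth
  moment at most 1. The Sobolev constant is 4096 = 4^6, and the three summands give 3 * 4096 =
  12288.\<close>

lemma trilinear_bound:
  assumes a: "a \<in> H10 \<Omega>" and p: "p \<in> H10 \<Omega>" and q: "q \<in> H10 \<Omega>"
  shows "integrable (lebesgue_on \<Omega>) (\<lambda>x. (a x)^4 * \<bar>p x\<bar> * \<bar>q x\<bar>)"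
    and "(LINT x|lebesgue_on \<Omega>. (a x)^4 * \<bar>p x\<bar> * \<bar>q x\<bar>) \<le> 12288 * (gnorm a)^4 * gnorm p * gnorm q"
proof -
  note S = H10_Sobolev(1)[OF a] H10_Sobolev(1)[OF p] H10_Sobolev(1)[OF q]
  note M = L2_borel[OF H10_L2[OF a]] L2_borel[OF H10_L2[OF p]] L2_borel[OF H10_L2[OF q]]
  show i: "integrable (lebesgue_on \<Omega>) (\<lambda>x. (a x)^4 * \<bar>p x\<bar> * \<bar>q x\<bar>)"
  proof (rule Bochner_Integration.integrable_bound)
    show "integrable (lebesgue_on \<Omega>) (\<lambda>x. (a x)^6 + (p x)^6 + (q x)^6)"
      using S by simp
    show "(\<lambda>x. (a x)^4 * \<bar>p x\<bar> * \<bar>q x\<bar>) \<in> borel_measurable (lebesgue_on \<Omega>)"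
      using M by measurable
    show "AE x in lebesgue_on \<Omega>. norm ((a x)^4 * \<bar>p x\<bar> * \<bar>q x\<bar>) \<le> norm ((a x)^6 + (p x)^6 + (q x)^6)"
      using young6 by (intro AE_I2) (simp add: abs_mult)
  qed
  \<comment> \<open>The extra \<open>e\<close> keeps the scaling factors positive when a gradient
    norm is zero; it is removed by a limit at the end.\<close>
  have e: "(LINT x|lebesgue_on \<Omega>. (a x)^4 * \<bar>p x\<bar> * \<bar>q x\<bar>) \<le> 12288 * (gnorm a + e)^4 * (gnorm p + e) * (gnorm q + e)"
    if e: "e > 0" for e
  proof -
    define A P Q where "A = 4 * (gnorm a + e)" and "P = 4 * (gnorm p + e)" and "Q = 4 * (gnorm q + e)"
    have pos: "A > 0" "P > 0" "Q > 0"
      using e gnorm_nonneg by (auto simp: A_def P_def Q_def add_nonneg_pos)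
    have six: "(LINT x|lebesgue_on \<Omega>. (w x)^6) \<le> (4 * (gnorm w + e))^6" if "w \<in> H10 \<Omega>" for w
    proof -
      have "(LINT x|lebesgue_on \<Omega>. (w x)^6) \<le> (4 * gnorm w)^6"
        using H10_Sobolev(2)[OF that] by (simp add: power_mult_distrib)
      also have "\<dots> \<le> (4 * (gnorm w + e))^6" using e gnorm_nonneg[of w] by (intro power_mono) auto
      finally show ?thesis .
    qed
    have "(LINT x|lebesgue_on \<Omega>. (a x)^4 * \<bar>p x\<bar> * \<bar>q x\<bar>)
        \<le> (LINT x|lebesgue_on \<Omega>. (A^4 * P * Q) * ((a x)^6 / A^6 + (p x)^6 / P^6 + (q x)^6 / Q^6))"
    proof (rule integral_mono[OF i])
      fix x
      have "(a x)^4 * \<bar>p x\<bar> * \<bar>q x\<bar> = (A^4 * P * Q) * ((a x / A)^4 * \<bar>p x / P\<bar> * \<bar>q x / Q\<bar>)"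
        using pos by (simp add: power_divide)
      also have "\<dots> \<le> (A^4 * P * Q) * ((a x / A)^6 + (p x / P)^6 + (q x / Q)^6)"
        using pos by (intro mult_left_mono young6) auto
      finally show "(a x)^4 * \<bar>p x\<bar> * \<bar>q x\<bar> \<le> (A^4 * P * Q) * ((a x)^6 / A^6 + (p x)^6 / P^6 + (q x)^6 / Q^6)"
        by (simp add: power_divide)
    qed (use S in simp)
    also have "\<dots> = (A^4 * P * Q) * ((LINT x|lebesgue_on \<Omega>. (a x)^6) / A^6 + (LINT x|lebesgue_on \<Omega>. (p x)^6) / P^6
        + (LINT x|lebesgue_on \<Omega>. (q x)^6) / Q^6)"
      using S by simp
    also have "\<dots> \<le> (A^4 * P * Q) * (1 + 1 + 1)"
      using pos six[OF a] six[OF p] six[OF q]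
      by (intro mult_left_mono add_mono) (auto simp: A_def P_def Q_def divide_le_eq_1)
    also have "\<dots> = 12288 * (gnorm a + e)^4 * (gnorm p + e) * (gnorm q + e)"
      unfolding A_def P_def Q_def power_mult_distrib by (simp only: mult_ac) simp
    finally show ?thesis .
  qed
  have "((\<lambda>e. 12288 * (gnorm a + e)^4 * (gnorm p + e) * (gnorm q + e)) \<longlongrightarrow>
      12288 * (gnorm a + 0)^4 * (gnorm p + 0) * (gnorm q + 0)) (at_right 0)"
    by (intro tendsto_intros)
  then have "((\<lambda>e. 12288 * (gnorm a + e)^4 * (gnorm p + e) * (gnorm q + e)) \<longlongrightarrow>
      12288 * (gnorm a)^4 * gnorm p * gnorm q) (at_right 0)" by simp
  then show "(LINT x|lebesgue_on \<Omega>. (a x)^4 * \<bar>p x\<bar> * \<bar>q x\<bar>) \<le> 12288 * (gnorm a)^4 * gnorm p * gnorm q"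
    by (rule tendsto_lowerbound) (auto simp: eventually_at_filter e)
qed

text \<open>What becomes of the pointwise Lipschitz weight \<open>1 + a^4 + b^4\<close> after
  integration over the domain.\<close>

definition wgt :: "(real^3 \<Rightarrow> real) \<Rightarrow> (real^3 \<Rightarrow> real) \<Rightarrow> real" where
  "wgt a b = 1 + (gnorm a)^4 + (gnorm b)^4"

lemma wgt_ge_1: "1 \<le> wgt a b"
  by (simp add: wgt_def gnorm_nonneg)

text \<open>The constant part of the weight is treated by Cauchy-Schwarz and the Poincare
  inequality, the quartic parts by the trilinear bound.\<close>

lemma weighted_bound:
  obtains C where "C \<ge> 0"
    "\<And>a b p q. a \<in> H10 \<Omega> \<Longrightarrow> b \<in> H10 \<Omega> \<Longrightarrow> p \<in> H10 \<Omega> \<Longrightarrow> q \<in> H10 \<Omega> \<Longrightarrow>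
      integrable (lebesgue_on \<Omega>) (\<lambda>x. (1 + (a x)^4 + (b x)^4) * \<bar>p x\<bar> * \<bar>q x\<bar>)"
    "\<And>a b p q. a \<in> H10 \<Omega> \<Longrightarrow> b \<in> H10 \<Omega> \<Longrightarrow> p \<in> H10 \<Omega> \<Longrightarrow> q \<in> H10 \<Omega> \<Longrightarrow>
      (LINT x|lebesgue_on \<Omega>. (1 + (a x)^4 + (b x)^4) * \<bar>p x\<bar> * \<bar>q x\<bar>) \<le> C * wgt a b * gnorm p * gnorm q"
proof -
  obtain P where P: "P \<ge> 0" "\<And>u. u \<in> H10 \<Omega> \<Longrightarrow> L2_norm \<Omega> u \<le> P * gnorm u"
    using Poincare by blast
  define C where "C = P\<^sup>2 + 12288"
  have eq: "(\<lambda>x. (1 + (a x)^4 + (b x)^4) * \<bar>p x\<bar> * \<bar>q x\<bar>)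
     = (\<lambda>x. \<bar>p x\<bar> \<bullet> \<bar>q x\<bar> + (a x)^4 * \<bar>p x\<bar> * \<bar>q x\<bar> + (b x)^4 * \<bar>p x\<bar> * \<bar>q x\<bar>)" for a b p q :: "real^3 \<Rightarrow> real"
    by (simp add: algebra_simps)
  have absL2: "(\<lambda>x. \<bar>p x\<bar>) \<in> L2 \<Omega>" "L2_norm \<Omega> (\<lambda>x. \<bar>p x\<bar>) = L2_norm \<Omega> p" if "p \<in> L2 \<Omega>" for p :: "real^3 \<Rightarrow> real"
    using that by (auto simp: L2_def L2_norm_def L2_inner_self)
  have bd: "(LINT x|lebesgue_on \<Omega>. \<bar>p x\<bar> \<bullet> \<bar>q x\<bar>) \<le> P\<^sup>2 * (gnorm p * gnorm q)"
    if h: "p \<in> H10 \<Omega>" "q \<in> H10 \<Omega>" for p q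
  proof -
    have "(LINT x|lebesgue_on \<Omega>. \<bar>p x\<bar> \<bullet> \<bar>q x\<bar>) \<le> L2_norm \<Omega> p * L2_norm \<Omega> q"
      using L2_Cauchy_Schwarz[OF absL2(1)[OF H10_L2[OF h(1)]] absL2(1)[OF H10_L2[OF h(2)]]] absL2(2) h H10_L2
      by (simp add: L2_inner_def)
    also have "\<dots> \<le> (P * gnorm p) * (P * gnorm q)"
      using P h by (intro mult_mono) (auto simp: L2_norm_nonneg gnorm_nonneg)
    finally show ?thesis by (simp add: power2_eq_square mult_ac)
  qed
  show ?thesis
  proof (rule that[of C])
    show "C \<ge> 0" by (simp add: C_def)
    fix a b p q assume h: "a \<in> H10 \<Omega>" "b \<in> H10 \<Omega>" "p \<in> H10 \<Omega>" "q \<in> H10 \<Omega>"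
    note i = L2_integrable_inner[OF absL2(1)[OF H10_L2[OF h(3)]] absL2(1)[OF H10_L2[OF h(4)]]]
      trilinear_bound(1)[OF h(1,3,4)] trilinear_bound(1)[OF h(2,3,4)]
    show "integrable (lebesgue_on \<Omega>) (\<lambda>x. (1 + (a x)^4 + (b x)^4) * \<bar>p x\<bar> * \<bar>q x\<bar>)"
      unfolding eq by (intro Bochner_Integration.integrable_add i)
    have "(LINT x|lebesgue_on \<Omega>. (1 + (a x)^4 + (b x)^4) * \<bar>p x\<bar> * \<bar>q x\<bar>)
        = (LINT x|lebesgue_on \<Omega>. \<bar>p x\<bar> \<bullet> \<bar>q x\<bar>) + (LINT x|lebesgue_on \<Omega>. (a x)^4 * \<bar>p x\<bar> * \<bar>q x\<bar>)
        + (LINT x|lebesgue_on \<Omega>. (b x)^4 * \<bar>p x\<bar> * \<bar>q x\<bar>)"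
      unfolding eq Bochner_Integration.integral_add[OF Bochner_Integration.integrable_add[OF i(1,2)] i(3)]
        Bochner_Integration.integral_add[OF i(1,2)] ..
    also have "\<dots> \<le> P\<^sup>2 * (gnorm p * gnorm q) + 12288 * (gnorm a)^4 * gnorm p * gnorm q + 12288 * (gnorm b)^4 * gnorm p * gnorm q"
      by (intro add_mono bd trilinear_bound(2) h)
    also have "\<dots> = (P\<^sup>2 + 12288 * (gnorm a)^4 + 12288 * (gnorm b)^4) * (gnorm p * gnorm q)"
      by (simp add: algebra_simps)
    also have "\<dots> \<le> (C * wgt a b) * (gnorm p * gnorm q)"
      by (intro mult_right_mono) (auto simp: C_def wgt_def algebra_simps gnorm_nonneg)
    finally show "(LINT x|lebesgue_on \<Omega>. (1 + (a x)^4 + (b x)^4) * \<bar>p x\<bar> * \<bar>q x\<bar>) \<le> C * wgt a b * gnorm p * gnorm q"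
      by (simp add: mult.assoc)
  qed
qed

end

section \<open>Functionals on \<open>H10\<close> that are accessible from L2\<close>

context bounded_open_set
begin

text \<open>Functionals on \<open>H10\<close> that are pointwise limits of uniformly bounded \<open>L2\<close> functionals;
  identities between time integrals pass from \<open>L2\<close> functionals to these by dominated convergence.\<close>

definition L2_approximable :: "((real^3 \<Rightarrow> real) \<Rightarrow> real) \<Rightarrow> bool" where
  "L2_approximable A \<longleftrightarrow> (\<exists>g B. (\<forall>n::nat. g n \<in> L2 \<Omega>) \<and> (\<forall>w\<in>H10 \<Omega>.
     (\<lambda>n. L2_inner \<Omega> (g n) w) \<longlonglongrightarrow> A w \<and> (\<forall>n. \<bar>L2_inner \<Omega> (g n) w\<bar> \<le> B * gnorm w)))"

text \<open>The weak gradient is tested with each partial derivative of \<open>\<phi>\<close>. The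
  representing \<open>g\<close> is minus the Laplacian of \<open>\<phi>\<close>, since
  \<open>?dd i\<close> is the second derivative in direction \<open>i\<close>.\<close>

lemma L2_inner_weak_grad_test:
  assumes t: "test_function \<Omega> \<phi>"
  obtains g where "g \<in> L2 \<Omega>" "\<And>w. w \<in> H10 \<Omega> \<Longrightarrow> L2_inner \<Omega> (weak_grad \<Omega> w) (grad \<phi>) = L2_inner \<Omega> g w"
proof -
  let ?d = "\<lambda>i x. frechet_derivative \<phi> (at x) (axis i 1)"
  let ?dd = "\<lambda>i x. grad (?d i) x $ i"
  define g where "g x = (\<Sum>i\<in>UNIV. - ?dd i x)" for x
  have dd: "?dd i \<in> L2 \<Omega>" for i
    unfolding grad_nth by (intro L2_test_function test_function_partial t)
  have L2_sum: "(\<lambda>x. \<Sum>i\<in>I. k i x) \<in> L2 \<Omega>" if "\<And>i. k i \<in> L2 \<Omega>" "finite I"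
    for k :: "3 \<Rightarrow> real^3 \<Rightarrow> real" and I
    using that(2) by (induction I rule: finite_induct) (auto intro: L2_zero L2_add that(1))
  have neg: "(\<lambda>x. - ?dd i x) \<in> L2 \<Omega>" for i
    using L2_mult[OF dd[of i], of "-1"] by simp
  have g: "g \<in> L2 \<Omega>" unfolding g_def by (intro L2_sum neg finite)
  have "L2_inner \<Omega> (weak_grad \<Omega> w) (grad \<phi>) = L2_inner \<Omega> g w" if w: "w \<in> H10 \<Omega>" for w
  proof -
    have comp: "(LINT x|lebesgue_on \<Omega>. ?d i x * weak_grad \<Omega> w x $ i) = (LINT x|lebesgue_on \<Omega>. (- ?dd i x) * w x)"
      (is "?l = ?r") and int: "integrable (lebesgue_on \<Omega>) (\<lambda>x. ?d i x * weak_grad \<Omega> w x $ i)" for i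
    proof -
      have ti: "test_function \<Omega> (?d i)" by (rule test_function_partial[OF t])
      have eq: "(LINT x|lebesgue_on \<Omega>. w x *\<^sub>R grad (?d i) x) = - (LINT x|lebesgue_on \<Omega>. ?d i x *\<^sub>R weak_grad \<Omega> w x)"
        using H1_weak_grad[OF H10_H1[OF w]] ti by (simp add: is_weak_gradient_def)
      have i1: "integrable (lebesgue_on \<Omega>) (\<lambda>x. w x *\<^sub>R grad (?d i) x)"
        by (intro L2_integrable_scaleR H10_L2 w L2_grad ti)
      have i2: "integrable (lebesgue_on \<Omega>) (\<lambda>x. ?d i x *\<^sub>R weak_grad \<Omega> w x)"
        by (intro L2_integrable_scaleR H10_weak_grad_L2 w L2_test_function ti)
      show "integrable (lebesgue_on \<Omega>) (\<lambda>x. ?d i x * weak_grad \<Omega> w x $ i)"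
        using integrable_bounded_linear[OF bounded_linear_vec_nth i2, of i] by simp
      have "?l = (LINT x|lebesgue_on \<Omega>. ?d i x *\<^sub>R weak_grad \<Omega> w x) $ i"
        using integral_bounded_linear[OF bounded_linear_vec_nth i2, of i] by simp
      also have "\<dots> = - ((LINT x|lebesgue_on \<Omega>. w x *\<^sub>R grad (?d i) x) $ i)" using eq by simp
      also have "\<dots> = - (LINT x|lebesgue_on \<Omega>. w x * ?dd i x)"
        using integral_bounded_linear[OF bounded_linear_vec_nth i1, of i] by simp
      also have "\<dots> = ?r" by (simp add: mult.commute)
      finally show "?l = ?r" .
    qed
    have "L2_inner \<Omega> (weak_grad \<Omega> w) (grad \<phi>) = (LINT x|lebesgue_on \<Omega>. (\<Sum>i\<in>UNIV. ?d i x * weak_grad \<Omega> w x $ i))"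
      by (simp add: L2_inner_def inner_vec_def grad_nth mult.commute)
    also have "\<dots> = (\<Sum>i\<in>UNIV. (LINT x|lebesgue_on \<Omega>. ?d i x * weak_grad \<Omega> w x $ i))"
      by (intro Bochner_Integration.integral_sum int)
    also have "\<dots> = (\<Sum>i\<in>UNIV. (LINT x|lebesgue_on \<Omega>. (- ?dd i x) * w x))" by (simp only: comp)
    also have "\<dots> = (LINT x|lebesgue_on \<Omega>. (\<Sum>i\<in>UNIV. (- ?dd i x) * w x))"
      using L2_integrable_inner[OF neg H10_L2[OF w]]
      by (intro Bochner_Integration.integral_sum[symmetric]) simp
    also have "\<dots> = L2_inner \<Omega> g w" by (simp add: L2_inner_def g_def sum_distrib_right)
    finally show ?thesis .
  qed
  then show ?thesis using that g by blast
qed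

text \<open>The gradient of \<open>\<psi>\<close> is approximated by gradients of test functions,
  each of which acts as an L2 function. The errors are at most \<open>gnorm w\<close>, whence the
  uniform bound \<open>gnorm \<psi> + 1\<close>.\<close>

lemma L2_approximable_gip:
  assumes psi: "\<psi> \<in> H10 \<Omega>"
  shows "L2_approximable (\<lambda>w. gip w \<psi>)"
proof -
  have "\<exists>\<phi>. test_function \<Omega> \<phi> \<and> L2_norm \<Omega> (\<lambda>x. weak_grad \<Omega> \<psi> x - grad \<phi> x) < inverse (real (Suc n))" for n
  proof -
    have "0 < inverse (real (Suc n))" by simp
    with psi show ?thesis unfolding H10_def by blast
  qed
  then obtain \<phi> where t: "\<And>n. test_function \<Omega> (\<phi> n)"
    and b: "\<And>n. L2_norm \<Omega> (\<lambda>x. weak_grad \<Omega> \<psi> x - grad (\<phi> n) x) < inverse (real (Suc n))"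
    by metis
  have "\<exists>g. g \<in> L2 \<Omega> \<and> (\<forall>w\<in>H10 \<Omega>. L2_inner \<Omega> (weak_grad \<Omega> w) (grad (\<phi> n)) = L2_inner \<Omega> g w)" for n
    by (rule L2_inner_weak_grad_test[OF t[of n]]) blast
  then obtain g where g: "\<And>n. g n \<in> L2 \<Omega>"
    and eq: "\<And>n w. w \<in> H10 \<Omega> \<Longrightarrow> L2_inner \<Omega> (weak_grad \<Omega> w) (grad (\<phi> n)) = L2_inner \<Omega> (g n) w"
    by metis
  note G = H10_weak_grad_L2
  have close: "\<bar>L2_inner \<Omega> (g n) w - gip w \<psi>\<bar> \<le> gnorm w * inverse (real (Suc n))" if w: "w \<in> H10 \<Omega>" for n w
  proof -
    have "\<bar>L2_inner \<Omega> (g n) w - gip w \<psi>\<bar> = \<bar>L2_inner \<Omega> (weak_grad \<Omega> w) (\<lambda>x. weak_grad \<Omega> \<psi> x - grad (\<phi> n) x)\<bar>"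
      by (simp add: L2_inner_diff_right[OF G[OF psi] L2_grad[OF t] G[OF w]] eq[OF w] abs_minus_commute)
    also have "\<dots> \<le> gnorm w * L2_norm \<Omega> (\<lambda>x. weak_grad \<Omega> \<psi> x - grad (\<phi> n) x)"
      by (intro L2_Cauchy_Schwarz L2_diff G w psi L2_grad t)
    also have "\<dots> \<le> gnorm w * inverse (real (Suc n))"
      by (intro mult_left_mono less_imp_le[OF b] gnorm_nonneg)
    finally show ?thesis .
  qed
  have "(\<lambda>n. L2_inner \<Omega> (g n) w) \<longlonglongrightarrow> gip w \<psi>" if w: "w \<in> H10 \<Omega>" for w
  proof (rule LIM_zero_cancel, rule Lim_null_comparison)
    show "\<forall>\<^sub>F n in sequentially. norm (L2_inner \<Omega> (g n) w - gip w \<psi>) \<le> gnorm w * inverse (real (Suc n))"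
      using close[OF w] by simp
    show "(\<lambda>n. gnorm w * inverse (real (Suc n))) \<longlonglongrightarrow> 0"
      using tendsto_mult[OF tendsto_const LIMSEQ_inverse_real_of_nat, of "gnorm w"] by simp
  qed
  moreover have "\<bar>L2_inner \<Omega> (g n) w\<bar> \<le> (gnorm \<psi> + 1) * gnorm w" if w: "w \<in> H10 \<Omega>" for n w
  proof -
    have "gnorm w * inverse (real (Suc n)) \<le> gnorm w * 1"
      by (intro mult_left_mono gnorm_nonneg) (simp add: field_simps)
    then show ?thesis using close[OF w, of n] gip_bound[OF w psi] by (simp add: algebra_simps)
  qed
  ultimately show ?thesis unfolding L2_approximable_def using g by blast
qed

end

text \<open>From here on the growth of the nonlinearity enters only through
  \<open>f_Lipschitz\<close>.\<close>

locale quintic_nonlinearity = bounded_open_set \<Omega> for \<Omega> +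
  fixes f F :: "real \<Rightarrow> real" and K :: real
  assumes K_nonneg: "0 \<le> K"
    and f_Lipschitz: "\<bar>f a - f b\<bar> \<le> K * (1 + a^4 + b^4) * \<bar>a - b\<bar>"
    and f_cont: "continuous_on UNIV f"
    and f_zero: "f 0 = 0"
    and F_deriv: "(F has_real_derivative f x) (at x)"
    and F_zero: "F 0 = 0"
begin

abbreviation fip :: "(real^3 \<Rightarrow> real) \<Rightarrow> (real^3 \<Rightarrow> real) \<Rightarrow> real" where
  "fip u q \<equiv> L2_inner \<Omega> (\<lambda>x. f (u x)) q"

definition potential :: "(real^3 \<Rightarrow> real) \<Rightarrow> real" where
  "potential u = (LINT x|lebesgue_on \<Omega>. F (u x))"

lemma f_comp_borel:
  assumes u: "u \<in> H10 \<Omega>" shows "(\<lambda>x. f (u x)) \<in> borel_measurable (lebesgue_on \<Omega>)"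
  by (rule measurable_compose[OF L2_borel[OF H10_L2[OF u]] borel_measurable_continuous_onI[OF f_cont]])

lemma F_comp_borel:
  assumes u: "u \<in> H10 \<Omega>" shows "(\<lambda>x. F (u x)) \<in> borel_measurable (lebesgue_on \<Omega>)"
proof -
  have "continuous_on UNIV F"
    by (rule DERIV_continuous_on) (rule has_field_derivative_at_within[OF F_deriv])
  then show ?thesis
    by (intro measurable_compose[OF L2_borel[OF H10_L2[OF u]]] borel_measurable_continuous_onI)
qed

text \<open>\<open>F b - F a\<close> is \<open>f s * (b - a)\<close> for some \<open>s\<close> in
  between, and \<open>f s\<close> is compared with \<open>f a\<close>. The factor 2 absorbs the
  second \<open>a^4\<close> that arises from \<open>s^4 \<le> a^4 + b^4\<close>.\<close>

lemma F_Taylor: "\<bar>F b - F a - f a * (b - a)\<bar> \<le> 2 * K * (1 + a^4 + b^4) * \<bar>b - a\<bar> * \<bar>b - a\<bar>"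
proof -
  obtain s where s: "min a b \<le> s" "s \<le> max a b" "F b - F a = f s * (b - a)"
    using real_MVT[OF F_deriv] by metis
  have "\<bar>f s - f a\<bar> \<le> K * (1 + s^4 + a^4) * \<bar>s - a\<bar>" by (rule f_Lipschitz)
  also have "\<dots> \<le> (K * (2 * (1 + a^4 + b^4))) * \<bar>b - a\<bar>"
  proof (intro mult_mono mult_left_mono)
    have "1 + s^4 + a^4 \<le> 1 + (a^4 + b^4) + a^4" using four_power_between[OF s(1,2)] by simp
    also have "\<dots> \<le> 2 * (1 + a^4 + b^4)" by simp
    finally show "1 + s^4 + a^4 \<le> 2 * (1 + a^4 + b^4)" .
    show "\<bar>s - a\<bar> \<le> \<bar>b - a\<bar>" using s(1,2) by linarith
  qed (use K_nonneg in auto)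
  finally have le: "\<bar>f s - f a\<bar> \<le> 2 * K * (1 + a^4 + b^4) * \<bar>b - a\<bar>" by (simp add: mult_ac)
  have "F b - F a - f a * (b - a) = (f s - f a) * (b - a)" using s(3) by (simp add: algebra_simps)
  then show ?thesis using mult_right_mono[OF le, of "\<bar>b - a\<bar>"] by (simp add: abs_mult)
qed

lemma fip_diff_integrable:
  assumes "a \<in> H10 \<Omega>" "b \<in> H10 \<Omega>" "q \<in> H10 \<Omega>"
  shows "integrable (lebesgue_on \<Omega>) (\<lambda>x. (f (a x) - f (b x)) * q x)"
    and "\<bar>(LINT x|lebesgue_on \<Omega>. (f (a x) - f (b x)) * q x)\<bar>
      \<le> K * (LINT x|lebesgue_on \<Omega>. (1 + (a x)^4 + (b x)^4) * \<bar>a x - b x\<bar> * \<bar>q x\<bar>)"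
proof -
  obtain C where W: "integrable (lebesgue_on \<Omega>) (\<lambda>x. (1 + (a x)^4 + (b x)^4) * \<bar>a x - b x\<bar> * \<bar>q x\<bar>)"
    using weighted_bound[of thesis] assms H10_diff[OF assms(1,2)] by blast
  have le: "\<bar>(f (a x) - f (b x)) * q x\<bar> \<le> K * ((1 + (a x)^4 + (b x)^4) * \<bar>a x - b x\<bar> * \<bar>q x\<bar>)" for x
    using mult_right_mono[OF f_Lipschitz[of "a x" "b x"], of "\<bar>q x\<bar>"] by (simp add: abs_mult mult.assoc)
  show i: "integrable (lebesgue_on \<Omega>) (\<lambda>x. (f (a x) - f (b x)) * q x)"
  proof (rule Bochner_Integration.integrable_bound)
    show "integrable (lebesgue_on \<Omega>) (\<lambda>x. K * ((1 + (a x)^4 + (b x)^4) * \<bar>a x - b x\<bar> * \<bar>q x\<bar>))"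
      by (intro integrable_mult_right W)
    show "(\<lambda>x. (f (a x) - f (b x)) * q x) \<in> borel_measurable (lebesgue_on \<Omega>)"
      using f_comp_borel[OF assms(1)] f_comp_borel[OF assms(2)] L2_borel[OF H10_L2[OF assms(3)]] by measurable
    show "AE x in lebesgue_on \<Omega>. norm ((f (a x) - f (b x)) * q x)
       \<le> norm (K * ((1 + (a x)^4 + (b x)^4) * \<bar>a x - b x\<bar> * \<bar>q x\<bar>))"
      using le by (intro AE_I2) (metis abs_ge_self order_trans real_norm_def)
  qed
  have "\<bar>(LINT x|lebesgue_on \<Omega>. (f (a x) - f (b x)) * q x)\<bar> \<le> (LINT x|lebesgue_on \<Omega>. \<bar>(f (a x) - f (b x)) * q x\<bar>)"
    using integral_abs_bound by blast
  also have "\<dots> \<le> (LINT x|lebesgue_on \<Omega>. K * ((1 + (a x)^4 + (b x)^4) * \<bar>a x - b x\<bar> * \<bar>q x\<bar>))"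
    by (intro integral_mono integrable_abs i integrable_mult_right W le)
  finally show "\<bar>(LINT x|lebesgue_on \<Omega>. (f (a x) - f (b x)) * q x)\<bar>
      \<le> K * (LINT x|lebesgue_on \<Omega>. (1 + (a x)^4 + (b x)^4) * \<bar>a x - b x\<bar> * \<bar>q x\<bar>)"
    by simp
qed

text \<open>\<open>f (a x)\<close> need not be square integrable; the product is integrable by
  comparison with the zero function, where \<open>f\<close> vanishes.\<close>

lemma fip_integrable:
  assumes "a \<in> H10 \<Omega>" "q \<in> H10 \<Omega>"
  shows "integrable (lebesgue_on \<Omega>) (\<lambda>x. f (a x) * q x)"
  using fip_diff_integrable(1)[OF assms(1) H10_zero assms(2)] by (simp add: f_zero)

lemma fip_diff_right:
  "a \<in> H10 \<Omega> \<Longrightarrow> p \<in> H10 \<Omega> \<Longrightarrow> q \<in> H10 \<Omega> \<Longrightarrow> fip a (\<lambda>x. p x - q x) = fip a p - fip a q"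
  using fip_integrable by (simp add: L2_inner_def right_diff_distrib)

text \<open>The first bound is local Lipschitz continuity of the nonlinearity into the dual of
  \<open>H10\<close>; the second says that \<open>fip a\<close> is the derivative of the potential
  at \<open>a\<close>, with quadratic remainder. The constant has the factor 2 of
  \<open>F_Taylor\<close>.\<close>

lemma nonlinear_bounds:
  obtains C where "C \<ge> 0"
    "\<And>a b q. a \<in> H10 \<Omega> \<Longrightarrow> b \<in> H10 \<Omega> \<Longrightarrow> q \<in> H10 \<Omega> \<Longrightarrow>
      \<bar>fip a q - fip b q\<bar> \<le> C * wgt a b * gnorm (\<lambda>x. a x - b x) * gnorm q"
    "\<And>a b. a \<in> H10 \<Omega> \<Longrightarrow> b \<in> H10 \<Omega> \<Longrightarrow>
      \<bar>potential b - potential a - fip a (\<lambda>x. b x - a x)\<bar> \<le> C * wgt a b * (gnorm (\<lambda>x. b x - a x))\<^sup>2"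
proof -
  obtain W where W: "W \<ge> 0"
    "\<And>a b p q. a \<in> H10 \<Omega> \<Longrightarrow> b \<in> H10 \<Omega> \<Longrightarrow> p \<in> H10 \<Omega> \<Longrightarrow> q \<in> H10 \<Omega> \<Longrightarrow>
      integrable (lebesgue_on \<Omega>) (\<lambda>x. (1 + (a x)^4 + (b x)^4) * \<bar>p x\<bar> * \<bar>q x\<bar>)"
    "\<And>a b p q. a \<in> H10 \<Omega> \<Longrightarrow> b \<in> H10 \<Omega> \<Longrightarrow> p \<in> H10 \<Omega> \<Longrightarrow> q \<in> H10 \<Omega> \<Longrightarrow>
      (LINT x|lebesgue_on \<Omega>. (1 + (a x)^4 + (b x)^4) * \<bar>p x\<bar> * \<bar>q x\<bar>) \<le> W * wgt a b * gnorm p * gnorm q"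
    using weighted_bound by blast
  have F_int: "integrable (lebesgue_on \<Omega>) (\<lambda>x. F (a x))" if a: "a \<in> H10 \<Omega>" for a
  proof (rule Bochner_Integration.integrable_bound)
    show "integrable (lebesgue_on \<Omega>) (\<lambda>x. 2 * K * ((1 + 0^4 + (a x)^4) * \<bar>a x\<bar> * \<bar>a x\<bar>))"
      by (intro integrable_mult_right W(2) H10_zero a)
    show "AE x in lebesgue_on \<Omega>. norm (F (a x)) \<le> norm (2 * K * ((1 + 0^4 + (a x)^4) * \<bar>a x\<bar> * \<bar>a x\<bar>))"
    proof (rule AE_I2)
      fix x
      have "\<bar>F (a x)\<bar> \<le> 2 * K * ((1 + 0^4 + (a x)^4) * \<bar>a x\<bar> * \<bar>a x\<bar>)"
        using F_Taylor[of "a x" 0] by (simp add: F_zero f_zero mult.assoc)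
      then show "norm (F (a x)) \<le> norm (2 * K * ((1 + 0^4 + (a x)^4) * \<bar>a x\<bar> * \<bar>a x\<bar>))"
        by (metis abs_ge_self order_trans real_norm_def)
    qed
  qed (rule F_comp_borel[OF a])
  show ?thesis
  proof (rule that[of "2 * K * W"])
    show "2 * K * W \<ge> 0" using K_nonneg W(1) by simp
    fix a b assume a: "a \<in> H10 \<Omega>" and b: "b \<in> H10 \<Omega>"
    note d = H10_diff[OF b a]
    {
      fix q assume q: "q \<in> H10 \<Omega>"
      have "fip a q - fip b q = (LINT x|lebesgue_on \<Omega>. (f (a x) - f (b x)) * q x)"
        using fip_integrable[OF a q] fip_integrable[OF b q] by (simp add: L2_inner_def left_diff_distrib)
      then have "\<bar>fip a q - fip b q\<bar> \<le> K * (LINT x|lebesgue_on \<Omega>. (1 + (a x)^4 + (b x)^4) * \<bar>a x - b x\<bar> * \<bar>q x\<bar>)"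
        using fip_diff_integrable(2)[OF a b q] by simp
      also have "\<dots> \<le> (2 * K) * (W * wgt a b * gnorm (\<lambda>x. a x - b x) * gnorm q)"
        using K_nonneg W(1) wgt_ge_1[of a b]
        by (intro mult_mono W(3) a b q H10_diff integral_nonneg_AE AE_I2) auto
      finally show "\<bar>fip a q - fip b q\<bar> \<le> 2 * K * W * wgt a b * gnorm (\<lambda>x. a x - b x) * gnorm q"
        by (simp add: mult.assoc)
    }
    have i: "integrable (lebesgue_on \<Omega>) (\<lambda>x. F (b x) - F (a x) - f (a x) * (b x - a x))"
      by (intro Bochner_Integration.integrable_diff F_int a b fip_integrable d)
    have "potential b - potential a - fip a (\<lambda>x. b x - a x)
        = (LINT x|lebesgue_on \<Omega>. F (b x) - F (a x) - f (a x) * (b x - a x))"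
      using F_int[OF a] F_int[OF b] fip_integrable[OF a d] by (simp add: potential_def L2_inner_def)
    then have "\<bar>potential b - potential a - fip a (\<lambda>x. b x - a x)\<bar>
        \<le> (LINT x|lebesgue_on \<Omega>. \<bar>F (b x) - F (a x) - f (a x) * (b x - a x)\<bar>)"
      using integral_abs_bound by simp
    also have "\<dots> \<le> (LINT x|lebesgue_on \<Omega>. 2 * K * ((1 + (a x)^4 + (b x)^4) * \<bar>b x - a x\<bar> * \<bar>b x - a x\<bar>))"
    proof (intro integral_mono integrable_abs i integrable_mult_right W(2) a b d)
      fix x show "\<bar>F (b x) - F (a x) - f (a x) * (b x - a x)\<bar>
          \<le> 2 * K * ((1 + (a x)^4 + (b x)^4) * \<bar>b x - a x\<bar> * \<bar>b x - a x\<bar>)"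
        using F_Taylor[where a = "a x" and b = "b x"] by (simp add: mult.assoc)
    qed
    also have "\<dots> = 2 * K * (LINT x|lebesgue_on \<Omega>. (1 + (a x)^4 + (b x)^4) * \<bar>b x - a x\<bar> * \<bar>b x - a x\<bar>)"
      by simp
    also have "\<dots> \<le> 2 * K * (W * wgt a b * gnorm (\<lambda>x. b x - a x) * gnorm (\<lambda>x. b x - a x))"
      using K_nonneg by (intro mult_left_mono W(3) a b d) auto
    finally show "\<bar>potential b - potential a - fip a (\<lambda>x. b x - a x)\<bar> \<le> 2 * K * W * wgt a b * (gnorm (\<lambda>x. b x - a x))\<^sup>2"
      by (simp add: mult.assoc power2_eq_square)
  qed
qed

text \<open>Truncating the nonlinear term at height \<open>n\<close> makes it bounded, hence square
  integrable, and keeps it below the original in absolute value.\<close>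

lemma L2_approximable_fip:
  assumes a: "a \<in> H10 \<Omega>"
  shows "L2_approximable (fip a)"
proof -
  obtain W where W: "W \<ge> 0"
    "\<And>a b p q. a \<in> H10 \<Omega> \<Longrightarrow> b \<in> H10 \<Omega> \<Longrightarrow> p \<in> H10 \<Omega> \<Longrightarrow> q \<in> H10 \<Omega> \<Longrightarrow>
      integrable (lebesgue_on \<Omega>) (\<lambda>x. (1 + (a x)^4 + (b x)^4) * \<bar>p x\<bar> * \<bar>q x\<bar>)"
    "\<And>a b p q. a \<in> H10 \<Omega> \<Longrightarrow> b \<in> H10 \<Omega> \<Longrightarrow> p \<in> H10 \<Omega> \<Longrightarrow> q \<in> H10 \<Omega> \<Longrightarrow>
      (LINT x|lebesgue_on \<Omega>. (1 + (a x)^4 + (b x)^4) * \<bar>p x\<bar> * \<bar>q x\<bar>) \<le> W * wgt a b * gnorm p * gnorm q"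
    using weighted_bound by blast
  define g where "g n x = max (- real n) (min (real n) (f (a x)))" for n :: nat and x
  have gm: "g n \<in> borel_measurable (lebesgue_on \<Omega>)" for n
    unfolding g_def using f_comp_borel[OF a] by measurable
  have gL: "g n \<in> L2 \<Omega>" for n
    by (rule L2_bounded[OF gm, of n "real n"]) (auto simp: g_def)
  have gle: "\<bar>g n x\<bar> \<le> \<bar>f (a x)\<bar>" for n x by (auto simp: g_def)
  have glim: "(\<lambda>n. g n x) \<longlonglongrightarrow> f (a x)" for x
  proof (rule tendsto_eventually)
    obtain N :: nat where N: "\<bar>f (a x)\<bar> \<le> real N" using real_arch_simple by blast
    show "\<forall>\<^sub>F n in sequentially. g n x = f (a x)"
      unfolding eventually_sequentially using N by (intro exI[of _ N]) (auto simp: g_def)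
  qed
  have "(\<lambda>n. L2_inner \<Omega> (g n) q) \<longlonglongrightarrow> fip a q" if q: "q \<in> H10 \<Omega>" for q
    unfolding L2_inner_def
  proof (rule integral_dominated_convergence[where w = "\<lambda>x. \<bar>f (a x) * q x\<bar>"])
    show "AE x in lebesgue_on \<Omega>. norm (g n x \<bullet> q x) \<le> \<bar>f (a x) * q x\<bar>" for n
      using gle by (intro AE_I2) (simp add: abs_mult mult_right_mono)
    show "AE x in lebesgue_on \<Omega>. (\<lambda>n. g n x \<bullet> q x) \<longlonglongrightarrow> f (a x) \<bullet> q x"
      by (intro AE_I2 tendsto_inner glim tendsto_const)
  qed (use gm f_comp_borel[OF a] L2_borel[OF H10_L2[OF q]] fip_integrable[OF a q] in \<open>auto\<close>)
  moreover have "\<bar>L2_inner \<Omega> (g n) q\<bar> \<le> (K * W * wgt a (\<lambda>x. 0) * gnorm a) * gnorm q" if q: "q \<in> H10 \<Omega>" for n q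
  proof -
    have "\<bar>L2_inner \<Omega> (g n) q\<bar> \<le> (LINT x|lebesgue_on \<Omega>. \<bar>g n x * q x\<bar>)"
      by (simp add: L2_inner_def)
    also have "\<dots> \<le> (LINT x|lebesgue_on \<Omega>. K * ((1 + (a x)^4 + 0^4) * \<bar>a x\<bar> * \<bar>q x\<bar>))"
    proof (intro integral_mono integrable_mult_right W(2)[OF a H10_zero a q])
      show "integrable (lebesgue_on \<Omega>) (\<lambda>x. \<bar>g n x * q x\<bar>)"
        using L2_integrable_inner[OF gL H10_L2[OF q], of n] by simp
      fix x
      have "\<bar>g n x\<bar> \<le> K * (1 + (a x)^4 + 0^4) * \<bar>a x\<bar>"
        using gle[of n x] f_Lipschitz[of "a x" 0] by (simp add: f_zero)
      then show "\<bar>g n x * q x\<bar> \<le> K * ((1 + (a x)^4 + 0^4) * \<bar>a x\<bar> * \<bar>q x\<bar>)"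
        using mult_right_mono[of "\<bar>g n x\<bar>" "K * (1 + (a x)^4 + 0^4) * \<bar>a x\<bar>" "\<bar>q x\<bar>"]
        by (simp add: abs_mult mult.assoc)
    qed
    also have "\<dots> = K * (LINT x|lebesgue_on \<Omega>. (1 + (a x)^4 + 0^4) * \<bar>a x\<bar> * \<bar>q x\<bar>)" by simp
    also have "\<dots> \<le> K * (W * wgt a (\<lambda>x. 0) * gnorm a * gnorm q)"
      by (intro mult_left_mono W(3)[OF a H10_zero a q] K_nonneg)
    finally show ?thesis by (simp add: mult.assoc)
  qed
  ultimately show ?thesis unfolding L2_approximable_def using gL by blast
qed

end

section \<open>Weak solutions\<close>

lemma integrable_lebesgue_on_continuous:
  fixes g :: "real \<Rightarrow> real"
  assumes "continuous_on {a..b} g"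
  shows "integrable (lebesgue_on {a..b}) g"
  by (intro absolutely_integrable_imp_integrable absolutely_integrable_continuous_real assms) simp

text \<open>The exceptional null set is cut out of all functions; completeness of Lebesgue measure
  then makes the value of the limit on it irrelevant.\<close>

lemma borel_measurable_AE_limit:
  fixes g :: "'a::euclidean_space \<Rightarrow> real"
  assumes S: "S \<in> sets lebesgue" and m: "\<And>n. f n \<in> borel_measurable (lebesgue_on S)"
    and lim: "AE x in lebesgue_on S. (\<lambda>n::nat. f n x) \<longlonglongrightarrow> g x"
  shows "g \<in> borel_measurable (lebesgue_on S)"
proof -
  from lim S have "AE x in lebesgue. x \<in> S \<longrightarrow> (\<lambda>n. f n x) \<longlonglongrightarrow> g x"
    by (simp add: AE_restrict_space_iff)
  then obtain N where N: "N \<in> null_sets lebesgue" "\<And>x. x \<notin> N \<Longrightarrow> x \<in> S \<Longrightarrow> (\<lambda>n. f n x) \<longlonglongrightarrow> g x"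
    by (auto simp: completion.AE_iff_null_sets)
  have mN: "(\<lambda>x. if x \<in> S then f n x else 0) \<in> borel_measurable lebesgue" for n
    by (rule borel_measurable_if_I[OF m S])
  have "(\<lambda>x. indicator (- N) x * (if x \<in> S then f n x else 0)) \<in> borel_measurable lebesgue" for n
    by (intro borel_measurable_times mN borel_measurable_indicator)
      (simp add: Compl_in_sets_lebesgue null_setsD2[OF N(1)])
  then have "(\<lambda>x. indicator (- N) x * (if x \<in> S then g x else 0)) \<in> borel_measurable lebesgue"
    by (rule borel_measurable_LIMSEQ_real[rotated]) (use N(2) in \<open>auto split: split_indicator intro!: tendsto_intros\<close>)
  moreover have "AE x in lebesgue. indicator (- N) x * (if x \<in> S then g x else 0) = (if x \<in> S then g x else 0)"
    using AE_not_in[OF N(1)] by eventually_elim simp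
  ultimately have "(\<lambda>x. if x \<in> S then g x else 0) \<in> borel_measurable lebesgue"
    by (rule borel_measurable_AE)
  then show ?thesis by (rule borel_measurable_if_D)
qed

text \<open>Heine-Cantor by sequential compactness, for a pseudometric on times: a curve of function
  representatives is measured by a seminorm. It is used for \<open>u\<close> in the gradient norm
  and for the coefficients of continuous approximations of \<open>v\<close>.\<close>

lemma pseudometric_uniformly_continuous:
  fixes d :: "real \<Rightarrow> real \<Rightarrow> real"
  assumes sym: "\<And>s t. s \<in> {a..b} \<Longrightarrow> t \<in> {a..b} \<Longrightarrow> d s t = d t s"
    and tri: "\<And>r s t. r \<in> {a..b} \<Longrightarrow> s \<in> {a..b} \<Longrightarrow> t \<in> {a..b} \<Longrightarrow> d r t \<le> d r s + d s t"
    and cont: "\<And>t. t \<in> {a..b} \<Longrightarrow> ((\<lambda>s. d s t) \<longlongrightarrow> 0) (at t within {a..b})"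
    and refl: "\<And>t. t \<in> {a..b} \<Longrightarrow> d t t = 0" and e: "e > 0"
  obtains \<delta> where "\<delta> > 0" "\<And>s t. s \<in> {a..b} \<Longrightarrow> t \<in> {a..b} \<Longrightarrow> \<bar>s - t\<bar> < \<delta> \<Longrightarrow> d s t < e"
proof (rule ccontr)
  assume "\<not> thesis"
  with that have "\<exists>s t. s \<in> {a..b} \<and> t \<in> {a..b} \<and> \<bar>s - t\<bar> < inverse (real (Suc n)) \<and> \<not> d s t < e" for n
    by (metis inverse_positive_iff_positive of_nat_0_less_iff zero_less_Suc)
  then obtain s t where st: "\<And>n. s n \<in> {a..b}" "\<And>n. t n \<in> {a..b}"
    "\<And>n. \<bar>s n - t n\<bar> < inverse (real (Suc n))" "\<And>n. \<not> d (s n) (t n) < e" by metis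
  obtain l r where l: "l \<in> {a..b}" "strict_mono (r :: nat \<Rightarrow> nat)" "(s \<circ> r) \<longlonglongrightarrow> l"
    using compact_imp_seq_compact[OF compact_Icc, of a b] st(1) unfolding seq_compact_def by metis
  have diff: "(\<lambda>n. s n - t n) \<longlonglongrightarrow> 0"
  proof (rule Lim_null_comparison[OF _ LIMSEQ_inverse_real_of_nat])
    show "\<forall>\<^sub>F n in sequentially. norm (s n - t n) \<le> inverse (real (Suc n))"
      by (intro always_eventually allI) (use st(3) in \<open>simp only: real_norm_def less_imp_le\<close>)
  qed
  have "(\<lambda>n. (s \<circ> r) n - (s (r n) - t (r n))) \<longlonglongrightarrow> l - 0"
    using LIMSEQ_subseq_LIMSEQ[OF diff l(2)] by (intro tendsto_diff l(3)) (simp add: o_def)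
  then have tr: "(\<lambda>n. t (r n)) \<longlonglongrightarrow> l" by simp
  have dl: "(\<lambda>n. d (x n) l) \<longlonglongrightarrow> 0" if x: "x \<longlonglongrightarrow> l" "\<And>n. x n \<in> {a..b}" for x
  proof -
    have "((\<lambda>s. d s l) \<longlongrightarrow> d l l) (at l within {a..b})" using cont[OF l(1)] refl[OF l(1)] by simp
    then have "continuous (at l within {a..b}) (\<lambda>s. d s l)" by (simp add: continuous_within)
    then have "((\<lambda>s. d s l) \<circ> x) \<longlonglongrightarrow> d l l"
      using x unfolding continuous_within_sequentially by blast
    then show ?thesis by (simp add: o_def refl[OF l(1)])
  qed
  have "(\<lambda>n. d (s (r n)) l + d (t (r n)) l) \<longlonglongrightarrow> 0 + 0"
    using l(3) tr st by (intro tendsto_add dl) (auto simp: o_def)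
  then have "\<forall>\<^sub>F n in sequentially. d (s (r n)) l + d (t (r n)) l < e"
    using e by (intro order_tendstoD(2)) auto
  then obtain n where "d (s (r n)) l + d (t (r n)) l < e" by (auto simp: eventually_sequentially)
  with tri[OF st(1) l(1) st(2), of "r n" "r n"] sym[OF l(1) st(2)[of "r n"]] st(4)[of "r n"] show False by simp
qed

lemma powr_le_one_plus:
  fixes y :: real
  assumes "0 \<le> y" "0 \<le> q" "q \<le> r" shows "y powr q \<le> 1 + y powr r"
proof (cases "y \<le> 1")
  case True
  then have "y powr q \<le> 1" using assms by (intro powr_le1) auto
  then show ?thesis by (simp add: add_increasing2)
next
  case False
  then have "y powr q \<le> y powr r" using assms by (intro powr_mono) auto
  then show ?thesis by simp
qed

locale weak_solution_setting = quintic_nonlinearity \<Omega> f F K for \<Omega> f F K +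
  fixes \<alpha> :: real and h :: "real^3 \<Rightarrow> real" and U\<^sub>0 :: state and U :: "real \<Rightarrow> state"
  assumes alpha: "0 \<le> \<alpha>" and h_L2: "h \<in> L2 \<Omega>"
    and sol: "weak_solution \<Omega> \<alpha> f h U\<^sub>0 U"
begin

abbreviation u :: "real \<Rightarrow> real^3 \<Rightarrow> real" where "u t \<equiv> fst (U t)"
abbreviation v :: "real \<Rightarrow> real^3 \<Rightarrow> real" where "v t \<equiv> snd (U t)"
abbreviation k :: "real \<Rightarrow> real" where "k t \<equiv> gnorm (v t)"

lemma u_H10: "0 \<le> t \<Longrightarrow> u t \<in> H10 \<Omega>" and v_L2: "0 \<le> t \<Longrightarrow> v t \<in> L2 \<Omega>"
  using sol by (auto simp: weak_solution_def Let_def phase_space_def mem_Times_iff)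

lemma phase_dist_components:
  "gnorm (\<lambda>x. fst V x - fst W x) \<le> phase_dist \<Omega> V W"
  "L2_norm \<Omega> (\<lambda>x. snd V x - snd W x) \<le> phase_dist \<Omega> V W"
  by (simp_all add: phase_dist_def phase_norm_def real_le_rsqrt)

lemma phase_dist_tendsto: "0 \<le> t \<Longrightarrow> ((\<lambda>s. phase_dist \<Omega> (U s) (U t)) \<longlongrightarrow> 0) (at t within {0..})"
  using sol by (simp add: weak_solution_def Let_def)

lemma u_tendsto: "0 \<le> t \<Longrightarrow> ((\<lambda>s. gnorm (\<lambda>x. u s x - u t x)) \<longlongrightarrow> 0) (at t within {0..})"
  by (rule tendsto_sandwich[OF _ _ tendsto_const phase_dist_tendsto])
    (simp_all add: phase_dist_components gnorm_nonneg)

lemma v_tendsto: "0 \<le> t \<Longrightarrow> ((\<lambda>s. L2_norm \<Omega> (\<lambda>x. v s x - v t x)) \<longlongrightarrow> 0) (at t within {0..})"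
  by (rule tendsto_sandwich[OF _ _ tendsto_const phase_dist_tendsto])
    (simp_all add: phase_dist_components L2_norm_nonneg)

text \<open>The factor \<open>B\<close> may depend on the limit point \<open>t\<close> but not on
  the moving time \<open>s\<close>; what depends on both goes into \<open>d\<close>.\<close>

lemma continuous_on_comparison:
  fixes A :: "real \<Rightarrow> real"
  assumes d: "\<And>t. 0 \<le> t \<Longrightarrow> (d t \<longlongrightarrow> 0) (at t within {0..})"
    and le: "\<And>s t. 0 \<le> s \<Longrightarrow> 0 \<le> t \<Longrightarrow> \<bar>A s - A t\<bar> \<le> B t * d t s"
  shows "continuous_on {0..} A"
  unfolding continuous_on
proof
  fix t :: real assume t: "t \<in> {0..}"
  show "(A \<longlongrightarrow> A t) (at t within {0..})"
  proof (rule LIM_zero_cancel, rule Lim_null_comparison)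
    show "\<forall>\<^sub>F s in at t within {0..}. norm (A s - A t) \<le> B t * d t s"
      using le t by (auto simp: eventually_at_filter)
    show "((\<lambda>s. B t * d t s) \<longlongrightarrow> 0) (at t within {0..})"
      using tendsto_mult[OF tendsto_const d, of t "B t"] t by simp
  qed
qed

lemma continuous_L2_inner_v:
  assumes g: "g \<in> L2 \<Omega>" shows "continuous_on {0..} (\<lambda>t. L2_inner \<Omega> g (v t))"
proof (rule continuous_on_comparison[OF v_tendsto, where B = "\<lambda>_. L2_norm \<Omega> g"])
  fix s t :: real assume "0 \<le> s" "0 \<le> t"
  then show "\<bar>L2_inner \<Omega> g (v s) - L2_inner \<Omega> g (v t)\<bar> \<le> L2_norm \<Omega> g * L2_norm \<Omega> (\<lambda>x. v s x - v t x)"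
    using L2_Cauchy_Schwarz[OF g L2_diff[OF v_L2 v_L2]] L2_inner_diff_right[OF v_L2 v_L2 g] by simp
qed

lemma continuous_gip_u:
  assumes g: "\<psi> \<in> H10 \<Omega>" shows "continuous_on {0..} (\<lambda>t. gip (u t) \<psi>)"
proof (rule continuous_on_comparison[OF u_tendsto, where B = "\<lambda>_. gnorm \<psi>"])
  fix s t :: real assume "0 \<le> s" "0 \<le> t"
  then show "\<bar>gip (u s) \<psi> - gip (u t) \<psi>\<bar> \<le> gnorm \<psi> * gnorm (\<lambda>x. u s x - u t x)"
    using gip_bound[OF H10_diff[OF u_H10 u_H10] g] gip_diff_left[OF u_H10 u_H10 g] by (simp add: mult.commute)
qed

lemma continuous_gnorm_u: "continuous_on {0..} (\<lambda>t. gnorm (u t))"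
proof (rule continuous_on_comparison[OF u_tendsto, where B = "\<lambda>_. 1"])
  fix s t :: real assume "0 \<le> s" "0 \<le> t"
  then show "\<bar>gnorm (u s) - gnorm (u t)\<bar> \<le> 1 * gnorm (\<lambda>x. u s x - u t x)"
    using gnorm_abs_diff[OF u_H10 u_H10] by simp
qed

lemma continuous_L2_norm_v: "continuous_on {0..} (\<lambda>t. L2_norm \<Omega> (v t))"
proof (rule continuous_on_comparison[OF v_tendsto, where B = "\<lambda>_. 1"])
  fix s t :: real assume st: "0 \<le> s" "0 \<le> t"
  have "L2_norm \<Omega> (v s) \<le> L2_norm \<Omega> (v t) + L2_norm \<Omega> (\<lambda>x. v s x - v t x)"
    using L2_norm_triangle[OF v_L2[OF st(2)] L2_diff[OF v_L2[OF st(1)] v_L2[OF st(2)]]] by simp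
  moreover have "L2_norm \<Omega> (v t) \<le> L2_norm \<Omega> (v s) + L2_norm \<Omega> (\<lambda>x. v t x - v s x)"
    using L2_norm_triangle[OF v_L2[OF st(1)] L2_diff[OF v_L2[OF st(2)] v_L2[OF st(1)]]] by simp
  ultimately show "\<bar>L2_norm \<Omega> (v s) - L2_norm \<Omega> (v t)\<bar> \<le> 1 * L2_norm \<Omega> (\<lambda>x. v s x - v t x)"
    using L2_norm_minus_commute[of \<Omega> "v s" "v t"] by simp
qed

lemma u_bounded:
  obtains M where "M \<ge> 0" "\<And>t. 0 \<le> t \<Longrightarrow> t \<le> T \<Longrightarrow> gnorm (u t) \<le> M"
proof -
  have "compact ((\<lambda>t. gnorm (u t)) ` {0..T})"
    by (intro compact_continuous_image continuous_on_subset[OF continuous_gnorm_u]) auto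
  then obtain M where "\<And>y. y \<in> (\<lambda>t. gnorm (u t)) ` {0..T} \<Longrightarrow> norm y \<le> M"
    using compact_imp_bounded bounded_iff by metis
  then have "gnorm (u t) \<le> max M 0" if "0 \<le> t" "t \<le> T" for t
    using that by (force intro: max.coboundedI1)
  then show ?thesis using that[of "max M 0"] by simp
qed

lemma u_uniform:
  assumes "e > 0"
  obtains \<delta> where "\<delta> > 0" "\<And>s t. s \<in> {0..T} \<Longrightarrow> t \<in> {0..T} \<Longrightarrow> \<bar>s - t\<bar> < \<delta> \<Longrightarrow> gnorm (\<lambda>x. u s x - u t x) < e"
proof (rule pseudometric_uniformly_continuous[of 0 T "\<lambda>s t. gnorm (\<lambda>x. u s x - u t x)" e])
  show "((\<lambda>s. gnorm (\<lambda>x. u s x - u t x)) \<longlongrightarrow> 0) (at t within {0..T})" if "t \<in> {0..T}" for t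
    using that by (intro tendsto_within_subset[OF u_tendsto]) auto
qed (use assms that in \<open>auto simp: gnorm_zero intro: gnorm_minus_commute gnorm_triangle_diff u_H10\<close>)

lemma continuous_fip_u:
  assumes g: "\<psi> \<in> H10 \<Omega>" shows "continuous_on {0..} (\<lambda>t. fip (u t) \<psi>)"
proof -
  obtain C where C: "C \<ge> 0" "\<And>a b q. a \<in> H10 \<Omega> \<Longrightarrow> b \<in> H10 \<Omega> \<Longrightarrow> q \<in> H10 \<Omega> \<Longrightarrow>
      \<bar>fip a q - fip b q\<bar> \<le> C * wgt a b * gnorm (\<lambda>x. a x - b x) * gnorm q"
    by (rule nonlinear_bounds) blast
  show ?thesis
  \<comment> \<open>The weight involves \<open>u s\<close>, so it becomes part of \<open>d\<close>;
    it stays bounded as \<open>s\<close> tends to \<open>t\<close> because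
    \<open>gnorm (u s)\<close> converges.\<close>
  proof (rule continuous_on_comparison[where B = "\<lambda>_. C * gnorm \<psi>"
      and d = "\<lambda>t s. wgt (u s) (u t) * gnorm (\<lambda>x. u s x - u t x)"])
    fix t :: real assume t: "0 \<le> t"
    have "((\<lambda>s. gnorm (u s)) \<longlongrightarrow> gnorm (u t)) (at t within {0..})"
      using continuous_gnorm_u t by (auto simp: continuous_on)
    then have "((\<lambda>s. wgt (u s) (u t) * gnorm (\<lambda>x. u s x - u t x)) \<longlongrightarrow> wgt (u t) (u t) * 0) (at t within {0..})"
      unfolding wgt_def by (intro tendsto_intros u_tendsto t)
    then show "((\<lambda>s. wgt (u s) (u t) * gnorm (\<lambda>x. u s x - u t x)) \<longlongrightarrow> 0) (at t within {0..})" by simp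
  next
    fix s t :: real assume "0 \<le> s" "0 \<le> t"
    then show "\<bar>fip (u s) \<psi> - fip (u t) \<psi>\<bar> \<le> C * gnorm \<psi> * (wgt (u s) (u t) * gnorm (\<lambda>x. u s x - u t x))"
      using C(2)[OF u_H10 u_H10 g] by (simp add: mult_ac)
  qed
qed

text \<open>Strong differentiability of \<open>u\<close> into L2 makes each scalar function
  \<open>L2_inner \<Omega> g (u t)\<close> continuously differentiable. The derivative is one-sided
  at 0, which is enough on subintervals of the half line.\<close>

lemma L2_inner_u_increment:
  assumes g: "g \<in> L2 \<Omega>" and ab: "0 \<le> a" "a \<le> b"
  shows "L2_inner \<Omega> g (\<lambda>x. u b x - u a x) = (LINT \<tau>|lebesgue_on {a..b}. L2_inner \<Omega> g (v \<tau>))"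
proof -
  have "((\<lambda>t. L2_inner \<Omega> g (u t)) has_real_derivative L2_inner \<Omega> g (v t)) (at t within {0..})" if t: "0 \<le> t" for t
    unfolding has_field_derivative_iff
  proof (rule LIM_zero_cancel, rule Lim_null_comparison)
    have lim: "((\<lambda>s. L2_norm \<Omega> (\<lambda>x. (u s x - u t x) / (s - t) - v t x)) \<longlongrightarrow> 0) (at t within {0..})"
      using sol t by (simp add: weak_solution_def Let_def)
    then show "((\<lambda>s. L2_norm \<Omega> g * L2_norm \<Omega> (\<lambda>x. (u s x - u t x) / (s - t) - v t x)) \<longlongrightarrow> 0) (at t within {0..})"
      using tendsto_mult[OF tendsto_const lim, of "L2_norm \<Omega> g"] by simp
    have "norm ((L2_inner \<Omega> g (u s) - L2_inner \<Omega> g (u t)) / (s - t) - L2_inner \<Omega> g (v t))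
        \<le> L2_norm \<Omega> g * L2_norm \<Omega> (\<lambda>x. (u s x - u t x) / (s - t) - v t x)" if s: "0 \<le> s" for s
    proof -
      note L = H10_L2[OF u_H10[OF s]] H10_L2[OF u_H10[OF t]]
      have q: "(\<lambda>x. (u s x - u t x) / (s - t)) \<in> L2 \<Omega>"
        using L2_mult[OF L2_diff[OF L], of "1 / (s - t)"] by simp
      have "L2_inner \<Omega> g (\<lambda>x. (u s x - u t x) / (s - t)) = (L2_inner \<Omega> g (u s) - L2_inner \<Omega> g (u t)) / (s - t)"
        using L2_inner_mult_right[of \<Omega> g "1 / (s - t)" "\<lambda>x. u s x - u t x"] L2_inner_diff_right[OF L g] by simp
      then have "(L2_inner \<Omega> g (u s) - L2_inner \<Omega> g (u t)) / (s - t) - L2_inner \<Omega> g (v t)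
          = L2_inner \<Omega> g (\<lambda>x. (u s x - u t x) / (s - t) - v t x)"
        by (simp add: L2_inner_diff_right[OF q v_L2[OF t] g])
      then show ?thesis using L2_Cauchy_Schwarz[OF g L2_diff[OF q v_L2[OF t]]] by simp
    qed
    then show "\<forall>\<^sub>F s in at t within {0..}. norm ((L2_inner \<Omega> g (u s) - L2_inner \<Omega> g (u t)) / (s - t) - L2_inner \<Omega> g (v t))
        \<le> L2_norm \<Omega> g * L2_norm \<Omega> (\<lambda>x. (u s x - u t x) / (s - t) - v t x)"
      by (auto simp: eventually_at_filter)
  qed
  then have d: "((\<lambda>t. L2_inner \<Omega> g (u t)) has_vector_derivative L2_inner \<Omega> g (v t)) (at t within {0..})"
    if "0 \<le> t" for t
    using that by (simp add: has_real_derivative_iff_has_vector_derivative)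
  have "((\<lambda>t. L2_inner \<Omega> g (u t)) has_vector_derivative L2_inner \<Omega> g (v t)) (at t within {a..b})"
    if "t \<in> {a..b}" for t
    by (rule has_vector_derivative_within_subset[OF d]) (use that ab in auto)
  from fundamental_theorem_of_calculus[OF ab(2) this]
  have "((\<lambda>t. L2_inner \<Omega> g (v t)) has_integral L2_inner \<Omega> g (u b) - L2_inner \<Omega> g (u a)) {a..b}" .
  moreover have "integrable (lebesgue_on {a..b}) (\<lambda>t. L2_inner \<Omega> g (v t))"
    using ab by (intro integrable_lebesgue_on_continuous continuous_on_subset[OF continuous_L2_inner_v[OF g]]) auto
  ultimately have "(LINT \<tau>|lebesgue_on {a..b}. L2_inner \<Omega> g (v \<tau>)) = L2_inner \<Omega> g (u b) - L2_inner \<Omega> g (u a)"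
    by (simp add: lebesgue_integral_eq_integral integral_unique)
  then show ?thesis
    using L2_inner_diff_right[OF H10_L2[OF u_H10] H10_L2[OF u_H10] g, of b a] ab by simp
qed

lemma Bochner: "T > 0 \<Longrightarrow> Bochner_Lp_H10 \<Omega> (\<alpha> + 2) T v"
  using sol by (simp add: weak_solution_def Let_def)

lemma interval_integrable_subset:
  fixes g :: "real \<Rightarrow> real"
  assumes "integrable (lebesgue_on {a..b}) g" "a \<le> c" "d \<le> b"
  shows "integrable (lebesgue_on {c..d}) g"
  using integrable_subinterval[OF assms(1)] assms(2,3) by auto

lemma v_H10_AE:
  assumes "0 \<le> a" shows "AE t in lebesgue_on {a..b}. v t \<in> H10 \<Omega>"
proof -
  \<comment> \<open>The Bochner property is given for positive horizons, hence
    \<open>max b 1\<close>.\<close>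
  have "AE t in lebesgue_on {0..max b 1}. v t \<in> H10 \<Omega>"
    using Bochner[of "max b 1"] by (simp add: Bochner_Lp_H10_def)
  then show ?thesis
    using assms by (auto simp: AE_restrict_space_iff elim!: eventually_mono)
qed

lemma k_powr_integrable:
  assumes "0 \<le> a" shows "integrable (lebesgue_on {a..b}) (\<lambda>t. k t powr (\<alpha> + 2))"
proof -
  have "integrable (lebesgue_on {0..max b 1}) (\<lambda>t. k t powr (\<alpha> + 2))"
    using Bochner[of "max b 1"] by (simp add: Bochner_Lp_H10_def)
  then show ?thesis by (rule interval_integrable_subset) (use assms in auto)
qed

text \<open>The definition provides measurability only of the power of \<open>k\<close>; the root of
  order \<open>\<alpha> + 2\<close> recovers \<open>k\<close>.\<close>

lemma k_borel:
  assumes "0 \<le> a" shows "k \<in> borel_measurable (lebesgue_on {a..b})"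
proof -
  have "(\<lambda>t. (k t powr (\<alpha> + 2)) powr (1 / (\<alpha> + 2))) \<in> borel_measurable (lebesgue_on {a..b})"
    using borel_measurable_integrable[OF k_powr_integrable[OF assms]] by measurable
  moreover have "(k t powr (\<alpha> + 2)) powr (1 / (\<alpha> + 2)) = k t" for t
    using alpha gnorm_nonneg[of "v t"] by (simp add: powr_powr)
  ultimately show ?thesis by simp
qed

lemma k_powr_integrable_le:
  assumes "0 \<le> a" "0 \<le> q" "q \<le> \<alpha> + 2" shows "integrable (lebesgue_on {a..b}) (\<lambda>t. k t powr q)"
proof (rule Bochner_Integration.integrable_bound)
  show "integrable (lebesgue_on {a..b}) (\<lambda>t. 1 + k t powr (\<alpha> + 2))"
    by (intro Bochner_Integration.integrable_add k_powr_integrable assms integrable_lebesgue_on_continuous) auto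
  show "(\<lambda>t. k t powr q) \<in> borel_measurable (lebesgue_on {a..b})"
    using k_borel[OF assms(1)] by measurable
  show "AE t in lebesgue_on {a..b}. norm (k t powr q) \<le> norm (1 + k t powr (\<alpha> + 2))"
    using powr_le_one_plus[OF gnorm_nonneg assms(2,3)] by (intro AE_I2) (simp add: abs_of_nonneg)
qed

lemma k_integrable:
  assumes "0 \<le> a" shows "integrable (lebesgue_on {a..b}) k"
  using k_powr_integrable_le[OF assms, of 1 b] alpha by (simp add: gnorm_nonneg)

text \<open>Dominated convergence in time: the majorant \<open>B * k \<tau>\<close> is integrable.
  In this way increments of \<open>u\<close> can be tested with gradients, although the time
  derivative of \<open>u\<close> exists only in L2.\<close>

lemma L2_approximable_increment:
  assumes A: "L2_approximable A" and ab: "0 \<le> a" "a \<le> b"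
  shows "integrable (lebesgue_on {a..b}) (\<lambda>\<tau>. A (v \<tau>))"
    and "A (\<lambda>x. u b x - u a x) = (LINT \<tau>|lebesgue_on {a..b}. A (v \<tau>))"
proof -
  from A obtain g B where g: "\<And>n::nat. g n \<in> L2 \<Omega>"
    and lim: "\<And>w. w \<in> H10 \<Omega> \<Longrightarrow> (\<lambda>n. L2_inner \<Omega> (g n) w) \<longlonglongrightarrow> A w"
    and bound: "\<And>w n. w \<in> H10 \<Omega> \<Longrightarrow> \<bar>L2_inner \<Omega> (g n) w\<bar> \<le> B * gnorm w"
    unfolding L2_approximable_def by blast
  have m: "(\<lambda>\<tau>. L2_inner \<Omega> (g n) (v \<tau>)) \<in> borel_measurable (lebesgue_on {a..b})" for n
    using ab by (intro borel_measurable_integrable integrable_lebesgue_on_continuous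
        continuous_on_subset[OF continuous_L2_inner_v[OF g]]) auto
  have ae: "AE \<tau> in lebesgue_on {a..b}. (\<lambda>n. L2_inner \<Omega> (g n) (v \<tau>)) \<longlonglongrightarrow> A (v \<tau>)"
    using v_H10_AE[OF ab(1)] by eventually_elim (rule lim)
  have mA: "(\<lambda>\<tau>. A (v \<tau>)) \<in> borel_measurable (lebesgue_on {a..b})"
    by (rule borel_measurable_AE_limit[OF _ m ae]) simp
  have dom: "integrable (lebesgue_on {a..b}) (\<lambda>\<tau>. B * k \<tau>)"
    by (intro integrable_mult_right k_integrable ab)
  have le: "AE \<tau> in lebesgue_on {a..b}. norm (L2_inner \<Omega> (g n) (v \<tau>)) \<le> B * k \<tau>" for n
    using v_H10_AE[OF ab(1)] by eventually_elim (simp add: bound)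
  show "integrable (lebesgue_on {a..b}) (\<lambda>\<tau>. A (v \<tau>))"
    by (rule integrable_dominated_convergence[OF mA m dom ae le])
  have "(\<lambda>n. LINT \<tau>|lebesgue_on {a..b}. L2_inner \<Omega> (g n) (v \<tau>)) \<longlonglongrightarrow> (LINT \<tau>|lebesgue_on {a..b}. A (v \<tau>))"
    by (rule integral_dominated_convergence[OF mA m dom ae le])
  moreover have "(\<lambda>n. L2_inner \<Omega> (g n) (\<lambda>x. u b x - u a x)) \<longlonglongrightarrow> A (\<lambda>x. u b x - u a x)"
    using ab by (intro lim H10_diff u_H10) auto
  ultimately show "A (\<lambda>x. u b x - u a x) = (LINT \<tau>|lebesgue_on {a..b}. A (v \<tau>))"
    using LIMSEQ_unique by (simp add: L2_inner_u_increment[OF g ab])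
qed

text \<open>Multiplication by \<open>k t\<close> removes the conflict between the convention that
  r^0 is 1 and \<open>0 powr 0 = 0\<close>: both sides vanish where \<open>k t\<close> does.\<close>

lemma damping_mult: "damping_power (k t) \<alpha> * k t = k t powr (\<alpha> + 1)"
  and damping_mult_sq: "damping_power (k t) \<alpha> * (k t)\<^sup>2 = k t powr (\<alpha> + 2)"
proof -
  have "k t powr 1 = k t" "k t powr 2 = (k t)\<^sup>2" by (simp_all add: gnorm_nonneg)
  then show "damping_power (k t) \<alpha> * k t = k t powr (\<alpha> + 1)" "damping_power (k t) \<alpha> * (k t)\<^sup>2 = k t powr (\<alpha> + 2)"
    by (auto simp: damping_power_def powr_add)
qed

lemma damping_nonneg: "0 \<le> damping_power (k t) \<alpha>"
  by (simp add: damping_power_def)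

text \<open>The majorant has exponent \<open>\<alpha> + 1\<close>, one less than is available.
  Measurability of \<open>gip (v \<tau>) \<psi>\<close> in time comes from L2
  approximability.\<close>

lemma damping_gip_integrable:
  assumes psi: "\<psi> \<in> H10 \<Omega>" and ab: "0 \<le> a" "a \<le> b"
  shows "integrable (lebesgue_on {a..b}) (\<lambda>\<tau>. damping_power (k \<tau>) \<alpha> * gip (v \<tau>) \<psi>)"
proof (rule Bochner_Integration.integrable_bound)
  show "integrable (lebesgue_on {a..b}) (\<lambda>\<tau>. gnorm \<psi> * k \<tau> powr (\<alpha> + 1))"
    by (intro integrable_mult_right k_powr_integrable_le ab) (use alpha in auto)
  show "(\<lambda>\<tau>. damping_power (k \<tau>) \<alpha> * gip (v \<tau>) \<psi>) \<in> borel_measurable (lebesgue_on {a..b})"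
    using k_borel[OF ab(1), of b] borel_measurable_integrable[OF L2_approximable_increment(1)[OF L2_approximable_gip[OF psi] ab]]
    unfolding damping_power_def by measurable
  show "AE \<tau> in lebesgue_on {a..b}. norm (damping_power (k \<tau>) \<alpha> * gip (v \<tau>) \<psi>) \<le> norm (gnorm \<psi> * k \<tau> powr (\<alpha> + 1))"
    using v_H10_AE[OF ab(1)]
  proof eventually_elim
    case (elim \<tau>)
    have "norm (damping_power (k \<tau>) \<alpha> * gip (v \<tau>) \<psi>) \<le> damping_power (k \<tau>) \<alpha> * (k \<tau> * gnorm \<psi>)"
      using gip_bound[OF elim psi] by (simp add: abs_mult damping_nonneg mult_left_mono)
    also have "\<dots> = gnorm \<psi> * k \<tau> powr (\<alpha> + 1)" by (simp add: damping_mult[symmetric])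
    finally show ?case by (simp add: gnorm_nonneg)
  qed
qed

lemma weak_form_integrable:
  assumes psi: "\<psi> \<in> H10 \<Omega>" and ab: "0 \<le> a" "a \<le> b"
  shows "integrable (lebesgue_on {a..b}) (\<lambda>\<tau>. gip (u \<tau>) \<psi> + damping_power (k \<tau>) \<alpha> * gip (v \<tau>) \<psi> + fip (u \<tau>) \<psi>)"
  using ab by (intro Bochner_Integration.integrable_add damping_gip_integrable psi integrable_lebesgue_on_continuous
      continuous_on_subset[OF continuous_gip_u[OF psi]] continuous_on_subset[OF continuous_fip_u[OF psi]]) auto

lemma LINT_const_interval: "a \<le> b \<Longrightarrow> (LINT \<tau>|lebesgue_on {a..b}. (c::real)) = (b - a) * c"
  by (simp add: measure_restrict_space)

lemma weak_form_increment:
  assumes psi: "\<psi> \<in> H10 \<Omega>" and ab: "0 \<le> a" "a \<le> b"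
  shows "L2_inner \<Omega> (v b) \<psi> - L2_inner \<Omega> (v a) \<psi>
    = (b - a) * L2_inner \<Omega> h \<psi>
      - (LINT \<tau>|lebesgue_on {a..b}. gip (u \<tau>) \<psi> + damping_power (k \<tau>) \<alpha> * gip (v \<tau>) \<psi> + fip (u \<tau>) \<psi>)"
proof -
  let ?G = "\<lambda>\<tau>. gip (u \<tau>) \<psi> + damping_power (k \<tau>) \<alpha> * gip (v \<tau>) \<psi> + fip (u \<tau>) \<psi>"
  have eq: "L2_inner \<Omega> (v t) \<psi> + (LINT \<tau>|lebesgue_on {0..t}. ?G \<tau>) = L2_inner \<Omega> (snd U\<^sub>0) \<psi> + t * L2_inner \<Omega> h \<psi>" if "0 \<le> t" for t
    using sol psi that by (simp add: weak_solution_def Let_def measure_restrict_space)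
  have "(LINT \<tau>|lebesgue_on {0..b}. ?G \<tau>) = (LINT \<tau>|lebesgue_on {0..a}. ?G \<tau>) + (LINT \<tau>|lebesgue_on {a..b}. ?G \<tau>)"
    using ab by (intro integral_combine weak_form_integrable psi) auto
  then show ?thesis using eq[of a] eq[of b] ab by (simp add: algebra_simps)
qed

end

section \<open>Approximation of Bochner integrable curves by continuous ones\<close>

text \<open>A measurable function is an almost everywhere limit of continuous ones. Clipping these
  to the unit interval keeps the limit, an indicator, and supplies the majorant 1.\<close>

lemma indicator_continuous_approx:
  fixes A :: "real set"
  assumes A: "A \<in> sets lebesgue" and e: "e > 0"
  obtains \<phi> where "continuous_on UNIV \<phi>" "\<And>t. 0 \<le> \<phi> t \<and> \<phi> t \<le> (1::real)"
    "(LINT t|lebesgue_on {a..b}. \<bar>indicator A t - \<phi> t\<bar>) \<le> e"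
proof -
  have "indicat_real A measurable_on UNIV"
    by (intro lebesgue_measurable_imp_measurable_on borel_measurable_indicator A) (simp_all add: lebesgue_on_UNIV_eq A)
  then obtain N g where N: "negligible N" and g: "\<And>n. continuous_on UNIV (g n)"
    and lim: "\<And>x. x \<notin> N \<Longrightarrow> (\<lambda>n. g n x) \<longlonglongrightarrow> indicat_real A x"
    unfolding measurable_on_def by auto
  define \<phi> where "\<phi> n t = max 0 (min 1 (g n t))" for n and t
  have cont: "continuous_on UNIV (\<phi> n)" for n
    unfolding \<phi>_def by (intro continuous_intros g)
  have bd: "0 \<le> \<phi> n t \<and> \<phi> n t \<le> 1" for n t by (auto simp: \<phi>_def)
  have m: "indicat_real A \<in> borel_measurable (lebesgue_on {a..b})"
    by (intro measurable_restrict_space1 borel_measurable_indicator A)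
  have "(\<lambda>n. LINT t|lebesgue_on {a..b}. \<bar>indicator A t - \<phi> n t\<bar>) \<longlonglongrightarrow> (LINT t|lebesgue_on {a..b}. 0)"
  proof (rule integral_dominated_convergence[where w = "\<lambda>_. 1"])
    show "(\<lambda>t. \<bar>indicat_real A t - \<phi> n t\<bar>) \<in> borel_measurable (lebesgue_on {a..b})" for n
      using m continuous_borel_lebesgue_on[OF cont[of n], of "{a..b}"] by measurable
    show "integrable (lebesgue_on {a..b}) (\<lambda>_. 1::real)"
      by (intro integrable_lebesgue_on_continuous) auto
    have "AE t in lebesgue. t \<notin> N"
      using N by (intro AE_not_in) (simp add: negligible_iff_null_sets)
    then have "AE t in lebesgue_on {a..b}. t \<notin> N"
      by (auto simp: AE_restrict_space_iff elim: eventually_mono)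
    then show "AE t in lebesgue_on {a..b}. (\<lambda>n. \<bar>indicat_real A t - \<phi> n t\<bar>) \<longlonglongrightarrow> 0"
    proof eventually_elim
      case (elim t)
      have "(\<lambda>n. \<bar>indicat_real A t - \<phi> n t\<bar>) \<longlonglongrightarrow> \<bar>indicat_real A t - max 0 (min 1 (indicat_real A t))\<bar>"
        unfolding \<phi>_def by (intro tendsto_intros lim elim)
      then show ?case by (simp split: split_indicator_asm)
    qed
    show "AE t in lebesgue_on {a..b}. norm \<bar>indicat_real A t - \<phi> n t\<bar> \<le> 1" for n
      using bd by (intro AE_I2) (auto split: split_indicator)
  qed simp
  then have "\<forall>\<^sub>F n in sequentially. (LINT t|lebesgue_on {a..b}. \<bar>indicator A t - \<phi> n t\<bar>) < e"
    using e by (intro order_tendstoD(2)) auto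
  then obtain n where "(LINT t|lebesgue_on {a..b}. \<bar>indicator A t - \<phi> n t\<bar>) < e"
    by (auto simp: eventually_sequentially)
  then show ?thesis using that[OF cont bd] less_imp_le by blast
qed

text \<open>The sum is at most twice the maximum; this crude constant serves all exponents
  \<open>q\<close> without convexity.\<close>

lemma powr_sum_le:
  fixes a b q :: real
  assumes "0 \<le> a" "0 \<le> b" "0 \<le> q"
  shows "(a + b) powr q \<le> 2 powr q * (a powr q + b powr q)"
proof -
  have "(a + b) powr q \<le> (2 * max a b) powr q" using assms by (intro powr_mono2) auto
  also have "\<dots> = 2 powr q * max a b powr q" using assms by (simp add: powr_mult)
  also have "\<dots> \<le> 2 powr q * (a powr q + b powr q)"
    by (intro mult_left_mono) (auto simp: max_def)
  finally show ?thesis .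
qed

context bounded_open_set
begin

lemma H10_sum:
  assumes "finite R" "R \<subseteq> H10 \<Omega>"
  shows "(\<lambda>x. \<Sum>w\<in>R. a w * w x) \<in> H10 \<Omega>"
    and "gnorm (\<lambda>x. \<Sum>w\<in>R. a w * w x) \<le> (\<Sum>w\<in>R. \<bar>a w\<bar> * gnorm w)"
proof -
  have "(\<lambda>x. \<Sum>w\<in>R. a w * w x) \<in> H10 \<Omega> \<and> gnorm (\<lambda>x. \<Sum>w\<in>R. a w * w x) \<le> (\<Sum>w\<in>R. \<bar>a w\<bar> * gnorm w)"
    using assms
  proof (induction R rule: finite_induct)
    case (insert w R)
    then have w: "w \<in> H10 \<Omega>" "(\<lambda>x. \<Sum>w\<in>R. a w * w x) \<in> H10 \<Omega>"
      and le: "gnorm (\<lambda>x. \<Sum>w\<in>R. a w * w x) \<le> (\<Sum>w\<in>R. \<bar>a w\<bar> * gnorm w)" by auto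
    have eq: "(\<lambda>x. \<Sum>w\<in>insert w R. a w * w x) = (\<lambda>x. (\<Sum>w\<in>R. a w * w x) + a w * w x)"
      using insert(1,2) by (simp add: add.commute)
    have "gnorm (\<lambda>x. (\<Sum>w\<in>R. a w * w x) + a w * w x) \<le> (\<Sum>w\<in>R. \<bar>a w\<bar> * gnorm w) + \<bar>a w\<bar> * gnorm w"
      using gnorm_add_mult[OF w(2,1), of "a w"] le by linarith
    then show ?case
      unfolding eq using weak_grad_add_mult(1)[OF w(2,1), of "a w"] insert(1,2) by (simp add: add.commute)
  qed (simp add: H10_zero gnorm_zero)
  then show "(\<lambda>x. \<Sum>w\<in>R. a w * w x) \<in> H10 \<Omega>"
    and "gnorm (\<lambda>x. \<Sum>w\<in>R. a w * w x) \<le> (\<Sum>w\<in>R. \<bar>a w\<bar> * gnorm w)" by auto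
qed

end

context weak_solution_setting
begin

text \<open>Simple functions are first cut off where they are far from \<open>v\<close>, and then the indicators of
  their level sets are made continuous.\<close>

lemma Bochner_continuous_approx:
  assumes T: "T > 0" and e: "e > 0"
  obtains c \<rho> where "\<And>t. c t \<in> H10 \<Omega>"
    "\<And>\<eta>. \<eta> > 0 \<Longrightarrow> \<exists>\<delta>>0. \<forall>s\<in>{0..T}. \<forall>t\<in>{0..T}. \<bar>s - t\<bar> < \<delta> \<longrightarrow> gnorm (\<lambda>x. c s x - c t x) < \<eta>"
    "integrable (lebesgue_on {0..T}) \<rho>" "\<And>t. 0 \<le> \<rho> t" "(LINT t|lebesgue_on {0..T}. \<rho> t) \<le> e"
    "AE t in lebesgue_on {0..T}. gnorm (\<lambda>x. v t x - c t x) powr (\<alpha> + 2) \<le> \<rho> t"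
proof -
  define p where "p = \<alpha> + 2"
  have p: "p \<ge> 2" using alpha by (simp add: p_def)
  let ?\<mu> = "lebesgue_on {0..T}"
  obtain s where s_fin: "\<And>n::nat. finite (range (s n))" and s_H10: "\<And>n. range (s n) \<subseteq> H10 \<Omega>"
    and s_meas: "\<And>n w. {t\<in>{0..T}. s n t = w} \<in> sets lebesgue"
    and s_lim: "AE t in ?\<mu>. (\<lambda>n. gnorm (\<lambda>x. s n t x - v t x)) \<longlonglongrightarrow> 0"
    using Bochner[OF T] unfolding Bochner_Lp_H10_def by blast
  have s_mem: "s n t \<in> H10 \<Omega>" for n t using s_H10[of n] by auto
  have vH: "AE t in ?\<mu>. v t \<in> H10 \<Omega>" by (rule v_H10_AE) simp
  have km: "k \<in> borel_measurable ?\<mu>" by (rule k_borel) simp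
  \<comment> \<open>The distance of \<open>w\<close> from \<open>v t\<close>, expanded into inner
    products so that measurability in \<open>t\<close> is visible. The absolute value guards the
    exceptional times at which \<open>v t\<close> is not in \<open>H10\<close>.\<close>
  define q where "q w t = sqrt \<bar>(gnorm w)\<^sup>2 - 2 * gip (v t) w + (k t)\<^sup>2\<bar>" for w t
  define E where "E n t = (\<Sum>w\<in>range (s n). indicat_real {t\<in>{0..T}. s n t = w} t * q w t)" for n t
  have qm: "q w \<in> borel_measurable ?\<mu>" if w: "w \<in> H10 \<Omega>" for w
  proof -
    have "integrable ?\<mu> (\<lambda>t. gip (v t) w)"
      by (rule L2_approximable_increment(1)[OF L2_approximable_gip[OF w]]) (use T in auto)
    then show ?thesis
      unfolding q_def
      by (intro measurable_compose[OF _ borel_measurable_sqrt] borel_measurable_abs borel_measurable_add borel_measurable_diff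
          borel_measurable_times borel_measurable_const borel_measurable_power km)
        (rule borel_measurable_integrable)
  qed
  have Am: "{t\<in>{0..T}. s n t = w} \<in> sets ?\<mu>" for n w
    by (subst sets_restrict_space_iff) (use s_meas in auto)
  have Em: "E n \<in> borel_measurable ?\<mu>" for n
    unfolding E_def by (intro borel_measurable_sum borel_measurable_times borel_measurable_indicator Am qm) (use s_H10 in auto)
  have E_eq: "E n t = gnorm (\<lambda>x. s n t x - v t x)" if t: "t \<in> {0..T}" and v: "v t \<in> H10 \<Omega>" for n t
  proof -
    have "E n t = (\<Sum>w\<in>range (s n). if w = s n t then q w t else 0)"
      unfolding E_def using t by (intro sum.cong refl) (auto split: split_indicator)
    also have "\<dots> = q (s n t) t" using s_fin by simp
    also have "(gnorm (s n t))\<^sup>2 - 2 * gip (v t) (s n t) + (k t)\<^sup>2 = (gnorm (\<lambda>x. s n t x - v t x))\<^sup>2"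
      unfolding gnorm_sq gip_diff_left[OF s_mem v H10_diff[OF s_mem v]]
        gip_diff_right[OF s_mem v s_mem] gip_diff_right[OF s_mem v v] gip_commute[of "s n t" "v t"] by simp
    then have "q (s n t) t = gnorm (\<lambda>x. s n t x - v t x)"
      by (simp add: q_def gnorm_nonneg)
    finally show ?thesis .
  qed
  have E_nonneg: "0 \<le> E n t" for n t
    unfolding E_def by (intro sum_nonneg) (auto simp: q_def)
  \<comment> \<open>The simple functions come with no common majorant. Off \<open>Bs n\<close> they
    are replaced by 0, at the price of the error \<open>k t\<close>; this gives the bound
    \<open>1 + k t\<close>, whose power is integrable.\<close>
  define Bs where "Bs n = {t\<in>{0..T}. E n t \<le> 1}" for n
  define err where "err n t = (if t \<in> Bs n then E n t else k t)" for n t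
  have Bm: "Bs n \<in> sets ?\<mu>" for n
    unfolding Bs_def using Em[of n] borel_measurable_le[OF Em[of n] borel_measurable_const[of 1 ?\<mu>]] by simp
  have errm: "err n \<in> borel_measurable ?\<mu>" for n
    unfolding err_def using Em km Bm by (intro measurable_If_set) auto
  have err_le: "0 \<le> err n t \<and> err n t \<le> 1 + k t" for n t
    using E_nonneg[of n t] gnorm_nonneg[of "v t"] by (auto simp: err_def Bs_def)
  have err_lim: "AE t in ?\<mu>. (\<lambda>n. err n t powr p) \<longlonglongrightarrow> 0"
    using s_lim vH AE_space
  proof eventually_elim
    case (elim t)
    then have lim: "(\<lambda>n. E n t) \<longlonglongrightarrow> 0" using E_eq by simp
    then have "\<forall>\<^sub>F n in sequentially. E n t < 1" by (intro order_tendstoD(2)) auto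
    then have "\<forall>\<^sub>F n in sequentially. E n t = err n t"
      by eventually_elim (use elim(3) in \<open>auto simp: err_def Bs_def\<close>)
    with lim have "(\<lambda>n. err n t) \<longlonglongrightarrow> 0" by (rule Lim_transform_eventually)
    then have "(\<lambda>n. err n t powr p) \<longlonglongrightarrow> 0 powr p"
      by (rule tendsto_powr2[OF _ tendsto_const]) (use err_le p in auto)
    then show ?case using p by simp
  qed
  have dom_int: "integrable ?\<mu> (\<lambda>t. 2 powr p * (1 + k t powr p))"
    unfolding p_def by (intro integrable_mult_right Bochner_Integration.integrable_add k_powr_integrable
      integrable_lebesgue_on_continuous) auto
  have dom_le: "norm (err n t powr p) \<le> 2 powr p * (1 + k t powr p)" for n t
  proof -
    have "err n t powr p \<le> (1 + k t) powr p" using err_le p by (intro powr_mono2) auto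
    also have "\<dots> \<le> 2 powr p * (1 powr p + k t powr p)" using p by (intro powr_sum_le gnorm_nonneg) auto
    finally show ?thesis by simp
  qed
  have errpm: "(\<lambda>t. err n t powr p) \<in> borel_measurable ?\<mu>" for n using errm by measurable
  have err_int: "integrable ?\<mu> (\<lambda>t. err n t powr p)" for n
  proof (rule Bochner_Integration.integrable_bound[OF dom_int errpm])
    show "AE t in ?\<mu>. norm (err n t powr p) \<le> norm (2 powr p * (1 + k t powr p))"
      using dom_le by (intro AE_I2) (metis abs_ge_self order_trans real_norm_def)
  qed
  have "(\<lambda>n. LINT t|?\<mu>. err n t powr p) \<longlonglongrightarrow> (LINT t|?\<mu>. 0)"
    by (rule integral_dominated_convergence[OF _ errpm dom_int err_lim]) (use dom_le in auto)
  \<comment> \<open>Half of the budget \<open>e\<close>, divided by the factor with which this error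
    enters \<open>\<rho>\<close>.\<close>
  moreover have "0 < e / (2 * 2 powr p)" using e by simp
  ultimately have "\<forall>\<^sub>F n in sequentially. (LINT t|?\<mu>. err n t powr p) < e / (2 * 2 powr p)"
    by (intro order_tendstoD(2)) auto
  then obtain n where n: "(LINT t|?\<mu>. err n t powr p) < e / (2 * 2 powr p)"
    by (auto simp: eventually_sequentially)
  define R where "R = range (s n)"
  have R: "finite R" "R \<subseteq> H10 \<Omega>" using s_fin s_H10 by (auto simp: R_def)
  define A where "A w = {t\<in>{0..T}. s n t = w} \<inter> Bs n" for w
  have A: "A w \<in> sets lebesgue" for w
    using sets.Int[OF Am[of n w] Bm[of n]] by (subst (asm) sets_restrict_space_iff) (auto simp: A_def)
  define G where "G = 1 + (\<Sum>w\<in>R. gnorm w)"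
  have Gsum: "0 \<le> (\<Sum>w\<in>R. gnorm w)" by (intro sum_nonneg gnorm_nonneg)
  have G: "G \<ge> 1" using Gsum by (simp add: G_def)
  \<comment> \<open>The other half of the budget: \<open>Q\<close> enters \<open>\<rho>\<close> with
    the factor \<open>2 powr p * G powr (p - 1)\<close>, and its integral will be at most
    \<open>e2 * G\<close>.\<close>
  define e2 where "e2 = e / (2 * 2 powr p * G powr (p - 1) * G)"
  have e2: "e2 > 0" using e G by (simp add: e2_def)
  have "\<exists>\<phi>. continuous_on UNIV \<phi> \<and> (\<forall>t. 0 \<le> \<phi> t \<and> \<phi> t \<le> (1::real)) \<and>
    (LINT t|?\<mu>. \<bar>indicator (A w) t - \<phi> t\<bar>) \<le> e2" for w
    by (rule indicator_continuous_approx[OF A[of w] e2, of 0 T]) blast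
  then obtain \<phi> where \<phi>c: "\<And>w. continuous_on UNIV (\<phi> w)" and \<phi>b: "\<And>w t. 0 \<le> \<phi> w t \<and> \<phi> w t \<le> (1::real)"
    and \<phi>i: "\<And>w. (LINT t|?\<mu>. \<bar>indicator (A w) t - \<phi> w t\<bar>) \<le> e2" by metis
  define c where "c t x = (\<Sum>w\<in>R. \<phi> w t * w x)" for t x
  have cH: "c t \<in> H10 \<Omega>" for t
    using H10_sum(1)[OF R, of "\<lambda>w. \<phi> w t"] by (simp add: c_def[abs_def])
  \<comment> \<open>An upper bound for the gradient norm of the change that results from replacing
    indicators by continuous functions.\<close>
  define Q where "Q t = (\<Sum>w\<in>R. \<bar>indicator (A w) t - \<phi> w t\<bar> * gnorm w)" for t
  have diff_le: "\<bar>indicator (A w) t - \<phi> w t\<bar> \<le> 1" for w t using \<phi>b[of w t] by (auto split: split_indicator)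
  have Q: "0 \<le> Q t" "Q t \<le> G" for t
  proof -
    show "0 \<le> Q t" unfolding Q_def by (intro sum_nonneg mult_nonneg_nonneg gnorm_nonneg) auto
    have "Q t \<le> (\<Sum>w\<in>R. 1 * gnorm w)" unfolding Q_def
      by (intro sum_mono mult_right_mono diff_le gnorm_nonneg)
    then show "Q t \<le> G" by (simp add: G_def)
  qed
  \<comment> \<open>The p-th power of \<open>err n t + Q t\<close> is split by
    \<open>powr_sum_le\<close>. Only the first power of \<open>Q\<close> is small in the mean, so
    \<open>Q t \<le> G\<close> is used to reduce its p-th power to
    \<open>G powr (p - 1) * Q t\<close>.\<close>
  define \<rho> where "\<rho> t = 2 powr p * (err n t powr p + G powr (p - 1) * Q t)" for t
  have ind_int: "integrable ?\<mu> (\<lambda>t. \<bar>indicat_real (A w) t - \<phi> w t\<bar>)" for w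
  proof (rule Bochner_Integration.integrable_bound)
    show "integrable ?\<mu> (\<lambda>_. 1::real)" by (intro integrable_lebesgue_on_continuous) auto
    have "indicat_real (A w) \<in> borel_measurable ?\<mu>"
      by (intro measurable_restrict_space1 borel_measurable_indicator A)
    then show "(\<lambda>t. \<bar>indicat_real (A w) t - \<phi> w t\<bar>) \<in> borel_measurable ?\<mu>"
      using continuous_borel_lebesgue_on[OF \<phi>c[of w], of "{0..T}"] by measurable
    show "AE t in ?\<mu>. norm \<bar>indicat_real (A w) t - \<phi> w t\<bar> \<le> norm (1::real)"
      using diff_le by (intro AE_I2) simp
  qed
  have Q_int: "integrable ?\<mu> Q"
    unfolding Q_def by (intro Bochner_Integration.integrable_sum integrable_mult_left ind_int)
  have \<rho>_int: "integrable ?\<mu> \<rho>"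
    unfolding \<rho>_def by (intro integrable_mult_right Bochner_Integration.integrable_add err_int Q_int)
  have \<rho>_le: "(LINT t|?\<mu>. \<rho> t) \<le> e"
  proof -
    have "(LINT t|?\<mu>. Q t) = (\<Sum>w\<in>R. (LINT t|?\<mu>. \<bar>indicat_real (A w) t - \<phi> w t\<bar>) * gnorm w)"
      unfolding Q_def using ind_int by (subst Bochner_Integration.integral_sum) auto
    also have "\<dots> \<le> (\<Sum>w\<in>R. e2 * gnorm w)"
      by (intro sum_mono mult_right_mono \<phi>i gnorm_nonneg)
    also have "\<dots> = e2 * (\<Sum>w\<in>R. gnorm w)" by (simp add: sum_distrib_left)
    also have "\<dots> \<le> e2 * G" using e2 by (intro mult_left_mono) (auto simp: G_def)
    finally have Q1: "(LINT t|?\<mu>. Q t) \<le> e2 * G" .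
    have "(LINT t|?\<mu>. \<rho> t) = 2 powr p * ((LINT t|?\<mu>. err n t powr p) + G powr (p - 1) * (LINT t|?\<mu>. Q t))"
      unfolding \<rho>_def using err_int Q_int by simp
    also have "\<dots> \<le> 2 powr p * (e / (2 * 2 powr p) + G powr (p - 1) * (e2 * G))"
      using n Q1 by (intro mult_left_mono add_mono) auto
    also have "\<dots> = e" using G by (simp add: e2_def field_simps)
    finally show ?thesis .
  qed
  have \<rho>_bound: "AE t in ?\<mu>. gnorm (\<lambda>x. v t x - c t x) powr p \<le> \<rho> t"
    using vH AE_space
  proof eventually_elim
    case (elim t)
    then have v: "v t \<in> H10 \<Omega>" and t: "t \<in> {0..T}" by auto
    \<comment> \<open>The cut-off simple function at time \<open>t\<close>: it is
      \<open>s n t\<close> on \<open>Bs n\<close> and 0 elsewhere, with distance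
      \<open>err n t\<close> from \<open>v t\<close>.\<close>
    define s' where "s' x = (\<Sum>w\<in>R. indicator (A w) t * w x)" for x
    have s'H: "s' \<in> H10 \<Omega>"
      using H10_sum(1)[OF R, of "\<lambda>w. indicator (A w) t"] by (simp add: s'_def[abs_def])
    have "gnorm (\<lambda>x. v t x - s' x) = err n t"
    proof (cases "t \<in> Bs n")
      case True
      have "s' x = (\<Sum>w\<in>R. if w = s n t then w x else 0)" for x
        unfolding s'_def using True t by (intro sum.cong refl) (auto simp: A_def split: split_indicator)
      then have "s' = s n t" using R(1) by (auto simp: R_def)
      then show ?thesis using True E_eq[OF t v] gnorm_minus_commute[OF v s_mem] by (simp add: err_def)
    next
      case False
      then have "s' = (\<lambda>x. 0)" by (auto simp: s'_def A_def)
      then show ?thesis using False by (simp add: err_def)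
    qed
    moreover have "gnorm (\<lambda>x. s' x - c t x) \<le> Q t"
    proof -
      have "(\<lambda>x. s' x - c t x) = (\<lambda>x. \<Sum>w\<in>R. (indicator (A w) t - \<phi> w t) * w x)"
        by (simp add: s'_def c_def sum_subtractf left_diff_distrib)
      then show ?thesis using H10_sum(2)[OF R, of "\<lambda>w. indicator (A w) t - \<phi> w t"] by (simp add: Q_def)
    qed
    ultimately have "gnorm (\<lambda>x. v t x - c t x) \<le> err n t + Q t"
      using gnorm_triangle_diff[OF v cH s'H, of t] by simp
    then have "gnorm (\<lambda>x. v t x - c t x) powr p \<le> (err n t + Q t) powr p"
      using p by (intro powr_mono2 gnorm_nonneg) auto
    also have "\<dots> \<le> 2 powr p * (err n t powr p + Q t powr p)"
      using err_le[of n t] Q(1)[of t] p by (intro powr_sum_le) auto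
    also have "\<dots> \<le> \<rho> t"
    proof -
      have "Q t powr p = Q t powr (p - 1 + 1)" by simp
      also have "\<dots> = Q t powr (p - 1) * Q t powr 1" by (rule powr_add)
      also have "\<dots> = Q t powr (p - 1) * Q t" using Q(1)[of t] by simp
      also have "\<dots> \<le> G powr (p - 1) * Q t"
        using Q[of t] p by (intro mult_right_mono powr_mono2) auto
      finally show ?thesis unfolding \<rho>_def by simp
    qed
    finally show ?case .
  qed
  have unif: "\<exists>\<delta>>0. \<forall>s\<in>{0..T}. \<forall>t\<in>{0..T}. \<bar>s - t\<bar> < \<delta> \<longrightarrow> gnorm (\<lambda>x. c s x - c t x) < \<eta>" if eta: "\<eta> > 0" for \<eta>
  proof -
    define d where "d s t = (\<Sum>w\<in>R. \<bar>\<phi> w s - \<phi> w t\<bar> * gnorm w)" for s t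
    obtain \<delta> where \<delta>: "\<delta> > 0" "\<And>s t. s \<in> {0..T} \<Longrightarrow> t \<in> {0..T} \<Longrightarrow> \<bar>s - t\<bar> < \<delta> \<Longrightarrow> d s t < \<eta>"
    proof (rule pseudometric_uniformly_continuous[of 0 T d \<eta>])
      show "d s t = d t s" for s t by (simp add: d_def abs_minus_commute)
      show "d r t \<le> d r s + d s t" for r s t
        unfolding d_def sum.distrib[symmetric] distrib_right[symmetric]
        by (intro sum_mono mult_right_mono gnorm_nonneg) auto
      show "d t t = 0" for t by (simp add: d_def)
      show "((\<lambda>s. d s t) \<longlongrightarrow> 0) (at t within {0..T})" for t
      proof -
        have "((\<lambda>s. d s t) \<longlongrightarrow> (\<Sum>w\<in>R. \<bar>\<phi> w t - \<phi> w t\<bar> * gnorm w)) (at t within {0..T})"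
          unfolding d_def
        proof (intro tendsto_intros)
          fix w show "(\<phi> w \<longlongrightarrow> \<phi> w t) (at t within {0..T})"
            using \<phi>c[of w] unfolding continuous_on by (metis UNIV_I tendsto_within_subset subset_UNIV)
        qed
        then show ?thesis by simp
      qed
    qed (use eta in auto)
    moreover have "gnorm (\<lambda>x. c s x - c t x) \<le> d s t" for s t
    proof -
      have "(\<lambda>x. c s x - c t x) = (\<lambda>x. \<Sum>w\<in>R. (\<phi> w s - \<phi> w t) * w x)"
        by (simp add: c_def sum_subtractf left_diff_distrib)
      then show ?thesis using H10_sum(2)[OF R, of "\<lambda>w. \<phi> w s - \<phi> w t"] by (simp add: d_def)
    qed
    ultimately show ?thesis by (meson le_less_trans)
  qed
  have "0 \<le> \<rho> t" for t unfolding \<rho>_def using Q(1)[of t] by simp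
  then show ?thesis
    using that[of c \<rho>] cH unif \<rho>_int \<rho>_le \<rho>_bound by (simp add: p_def)
qed

end

section \<open>Averaging over time shifts\<close>

lemma
  fixes g :: "real \<Rightarrow> real"
  shows integrable_shift: "integrable (lebesgue_on {a..b}) (\<lambda>t. g (t + c)) \<longleftrightarrow> integrable (lebesgue_on {a + c..b + c}) g"
    and integral_shift: "(LINT t|lebesgue_on {a..b}. g (t + c)) = (LINT t|lebesgue_on {a + c..b + c}. g t)"
proof -
  have eq: "(\<lambda>x. if c + 1 * x \<in> {a + c..b + c} then g (c + 1 * x) else 0) = (\<lambda>x. if x \<in> {a..b} then g (x + c) else 0)"
    by (auto simp: add.commute)
  have S: "{l..r} \<in> sets lebesgue" for l r :: real by simp
  show "integrable (lebesgue_on {a..b}) (\<lambda>t. g (t + c)) \<longleftrightarrow> integrable (lebesgue_on {a + c..b + c}) g"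
    using lebesgue_integrable_real_affine_iff[of 1 "\<lambda>x. if x \<in> {a + c..b + c} then g x else 0" c, OF one_neq_zero]
    unfolding eq by (simp only: Lebesgue_Measure.integrable_restrict_UNIV[OF S])
  show "(LINT t|lebesgue_on {a..b}. g (t + c)) = (LINT t|lebesgue_on {a + c..b + c}. g t)"
    using lebesgue_integral_real_affine[of 1 "\<lambda>x. if x \<in> {a + c..b + c} then g x else 0" c, OF one_neq_zero]
    unfolding eq by (simp only: Lebesgue_Measure.integral_restrict_UNIV[OF S]) simp
qed

lemma AE_shift:
  fixes c :: real
  assumes "AE t in lebesgue_on {a + c..b + c}. P t"
  shows "AE t in lebesgue_on {a..b}. P (t + c)"
proof -
  from assms have "AE t in lebesgue. t \<in> {a + c..b + c} \<longrightarrow> P t"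
    by (subst (asm) AE_restrict_space_iff) auto
  then obtain N where N: "N \<in> null_sets lebesgue" "\<And>t. t \<notin> N \<Longrightarrow> t \<in> {a + c..b + c} \<Longrightarrow> P t"
    by (auto simp: completion.AE_iff_null_sets)
  have "negligible ((+) (- c) ` N)"
    using N(1) by (intro negligible_translation) (simp add: negligible_iff_null_sets)
  then have "AE t in lebesgue. t \<notin> (+) (- c) ` N"
    by (intro AE_not_in) (simp add: negligible_iff_null_sets)
  then have "AE t in lebesgue. t \<in> {a..b} \<longrightarrow> P (t + c)"
  proof eventually_elim
    case (elim t)
    then have "t + c \<notin> N" by (force simp: image_iff)
    then show ?case using N(2) by auto
  qed
  then show ?thesis by (subst AE_restrict_space_iff) auto
qed

lemma AE_subinterval:
  fixes a b c d :: real
  assumes "AE t in lebesgue_on {a..b}. P t" "a \<le> c" "d \<le> b"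
  shows "AE t in lebesgue_on {c..d}. P t"
  using assms by (auto simp: AE_restrict_space_iff elim!: eventually_mono)

text \<open>Integrating the step inequality over starting times telescopes the left side into
  averages of \<open>Z\<close> just after \<open>b\<close> and just after \<open>a\<close>, times
  \<open>\<delta>\<close>; continuity turns these into \<open>Z b\<close> and \<open>Z a\<close>. On
  the right, \<open>\<rho>\<close> and its shift each contribute at most the full integral, hence
  the factor 2.\<close>

lemma averaging_bound:
  fixes Z \<rho> :: "real \<Rightarrow> real"
  assumes ab: "a \<le> b" and d0: "d0 > 0" and Z: "continuous_on {a..b + d0} Z"
    and \<rho>: "integrable (lebesgue_on {a..b + d0}) \<rho>" "\<And>t. 0 \<le> \<rho> t"
    and step: "\<And>\<delta>. 0 < \<delta> \<Longrightarrow> \<delta> < d0 \<Longrightarrow> AE t in lebesgue_on {a..b}. Z (t + \<delta>) - Z t \<le> \<delta> * (\<rho> t + \<rho> (t + \<delta>))"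
  shows "Z b - Z a \<le> 2 * (LINT t|lebesgue_on {a..b + d0}. \<rho> t)"
proof (rule field_le_epsilon)
  fix e :: real assume e: "e > 0"
  let ?I = "LINT t|lebesgue_on {a..b + d0}. \<rho> t"
  have Zc: "\<exists>d>0. \<forall>s\<in>{a..b + d0}. \<bar>s - l\<bar> < d \<longrightarrow> \<bar>Z s - Z l\<bar> < e / 2" if "l \<in> {a..b + d0}" for l
    using Z that e unfolding continuous_on_iff dist_real_def by (metis half_gt_zero)
  obtain d1 where d1: "d1 > 0" "\<And>s. s \<in> {a..b + d0} \<Longrightarrow> \<bar>s - a\<bar> < d1 \<Longrightarrow> \<bar>Z s - Z a\<bar> < e / 2"
    using Zc[of a] ab d0 by auto
  obtain d2 where d2: "d2 > 0" "\<And>s. s \<in> {a..b + d0} \<Longrightarrow> \<bar>s - b\<bar> < d2 \<Longrightarrow> \<bar>Z s - Z b\<bar> < e / 2"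
    using Zc[of b] ab d0 by auto
  \<comment> \<open>Short enough that \<open>Z\<close> varies by less than \<open>e / 2\<close> over
    a step at either end, and that shifts stay below \<open>b + d0\<close>.\<close>
  define \<delta> where "\<delta> = min (min d1 d2) d0 / 2"
  have \<delta>: "0 < \<delta>" "\<delta> < d0" "\<delta> < d1" "\<delta> < d2" using d0 d1(1) d2(1) by (auto simp: \<delta>_def)
  have Zi: "integrable (lebesgue_on {c..d}) Z" if "a \<le> c" "d \<le> b + d0" for c d
    by (intro integrable_lebesgue_on_continuous continuous_on_subset[OF Z]) (use that in auto)
  have \<rho>i: "integrable (lebesgue_on {c..d}) \<rho>" if "a \<le> c" "d \<le> b + d0" for c d
    using integrable_subinterval[OF \<rho>(1)] that by auto
  have \<rho>le: "(LINT t|lebesgue_on {c..d}. \<rho> t) \<le> ?I" if "a \<le> c" "d \<le> b + d0" for c d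
    using that by (intro integral_mono_lebesgue_on_AE \<rho>(1)) (auto simp: \<rho>(2))
  have Zs: "integrable (lebesgue_on {a..b}) (\<lambda>t. Z (t + \<delta>))"
    using Zi[of "a + \<delta>" "b + \<delta>"] \<delta> by (simp add: integrable_shift)
  have \<rho>s: "integrable (lebesgue_on {a..b}) (\<lambda>t. \<rho> (t + \<delta>))"
    using \<rho>i[of "a + \<delta>" "b + \<delta>"] \<delta> by (simp add: integrable_shift)
  have "(LINT t|lebesgue_on {a..b}. Z (t + \<delta>) - Z t) \<le> (LINT t|lebesgue_on {a..b}. \<delta> * (\<rho> t + \<rho> (t + \<delta>)))"
    using Zs \<rho>s Zi[of a b] \<rho>i[of a b] \<delta> d0 by (intro integral_mono_AE step) auto
  also have "\<dots> = \<delta> * ((LINT t|lebesgue_on {a..b}. \<rho> t) + (LINT t|lebesgue_on {a + \<delta>..b + \<delta>}. \<rho> t))"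
    using \<rho>s \<rho>i[of a b] d0 by (simp add: integral_shift)
  also have "\<dots> \<le> \<delta> * (?I + ?I)"
    using \<delta> d0 by (intro mult_left_mono add_mono \<rho>le) auto
  finally have up: "(LINT t|lebesgue_on {a..b}. Z (t + \<delta>) - Z t) \<le> \<delta> * (?I + ?I)" .
  have "(LINT t|lebesgue_on {a..b}. Z (t + \<delta>) - Z t) = (LINT t|lebesgue_on {a + \<delta>..b + \<delta>}. Z t) - (LINT t|lebesgue_on {a..b}. Z t)"
    using Zs Zi[of a b] d0 by (simp add: integral_shift)
  \<comment> \<open>The interval from \<open>a\<close> to \<open>b + \<delta>\<close> is split at
    \<open>b\<close> and at \<open>a + \<delta>\<close>; this also covers the case that
    \<open>\<delta>\<close> exceeds \<open>b - a\<close>.\<close>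
  also have "\<dots> = (LINT t|lebesgue_on {b..b + \<delta>}. Z t) - (LINT t|lebesgue_on {a..a + \<delta>}. Z t)"
    using integral_combine[OF Zi[of a "b + \<delta>"], of b] integral_combine[OF Zi[of a "b + \<delta>"], of "a + \<delta>"] \<delta> ab d0 by simp
  finally have eq: "(LINT t|lebesgue_on {a..b}. Z (t + \<delta>) - Z t)
      = (LINT t|lebesgue_on {b..b + \<delta>}. Z t) - (LINT t|lebesgue_on {a..a + \<delta>}. Z t)" .
  have c: "(LINT t|lebesgue_on {l..l + \<delta>}. (r::real)) = \<delta> * r" for l r
    using \<delta> by (simp add: measure_restrict_space)
  have ci: "integrable (lebesgue_on {l..l + \<delta>}) (\<lambda>t. r::real)" for l r
    by (intro integrable_lebesgue_on_continuous) auto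
  have "(LINT t|lebesgue_on {b..b + \<delta>}. Z b - e / 2) \<le> (LINT t|lebesgue_on {b..b + \<delta>}. Z t)"
  proof (rule integral_mono[OF ci Zi])
    fix t assume "t \<in> space (lebesgue_on {b..b + \<delta>})"
    then have "\<bar>Z t - Z b\<bar> < e / 2" using \<delta> ab by (intro d2(2)) auto
    then show "Z b - e / 2 \<le> Z t" by linarith
  qed (use \<delta> ab in auto)
  moreover have "(LINT t|lebesgue_on {a..a + \<delta>}. Z t) \<le> (LINT t|lebesgue_on {a..a + \<delta>}. Z a + e / 2)"
  proof (rule integral_mono[OF Zi ci])
    fix t assume "t \<in> space (lebesgue_on {a..a + \<delta>})"
    then have "\<bar>Z t - Z a\<bar> < e / 2" using \<delta> ab by (intro d1(2)) auto
    then show "Z t \<le> Z a + e / 2" by linarith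
  qed (use \<delta> ab in auto)
  ultimately have "\<delta> * (Z b - e / 2) - \<delta> * (Z a + e / 2) \<le> \<delta> * (?I + ?I)"
    using up unfolding eq c by linarith
  then have "\<delta> * (Z b - Z a - e) \<le> \<delta> * (2 * ?I)" by (simp add: algebra_simps)
  then have "Z b - Z a - e \<le> 2 * ?I" using \<delta>(1) by (rule mult_left_le_imp_le)
  then show "Z b - Z a \<le> 2 * ?I + e" by simp
qed

text \<open>If \<open>x\<close> is small against \<open>1 + y\<close>, the left side is absorbed by
  the \<open>\<eta>\<close> term; otherwise \<open>y\<close> is at most a multiple of
  \<open>x\<close> and everything is a power of \<open>x\<close>. It splits the testing error into a
  small multiple of the dissipation and a power that the approximation of \<open>v\<close> makes
  small in the mean.\<close>

lemma damped_Young: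
  fixes B \<eta> \<alpha> :: real
  assumes B: "B \<ge> 0" and eta: "\<eta> > 0" and al: "\<alpha> \<ge> 0"
  obtains C where "C \<ge> 0"
    "\<And>y x. 0 \<le> y \<Longrightarrow> 0 \<le> x \<Longrightarrow> (B + y powr (\<alpha> + 1)) * x \<le> \<eta> * (1 + y powr (\<alpha> + 2)) + C * x powr (\<alpha> + 2)"
proof -
  \<comment> \<open>Expanding the product with \<open>1 + y\<close> gives four terms, together at
    most \<open>(2 * B + 2) * (1 + y powr (\<alpha> + 2))\<close>. The bound by 1 ensures
    \<open>x \<le> x / \<theta>\<close> in the other case.\<close>
  define \<theta> where "\<theta> = min (\<eta> / (2 * B + 2)) 1"
  have th: "0 < \<theta>" "\<theta> \<le> 1"
    using B eta by (simp_all add: \<theta>_def)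
  have "\<theta> \<le> \<eta> / (2 * B + 2)" by (simp add: \<theta>_def)
  then have th': "\<theta> * (2 * B + 2) \<le> \<eta>" using B pos_le_divide_eq[of "2 * B + 2" \<theta> \<eta>] by simp

  have "(B + y powr (\<alpha> + 1)) * x \<le> \<eta> * (1 + y powr (\<alpha> + 2)) + ((B + 1) * (1 / \<theta>) powr (\<alpha> + 2)) * x powr (\<alpha> + 2)"
    if yx: "0 \<le> y" "0 \<le> x" for y x
  proof (cases "x \<le> \<theta> * (1 + y)")
    case True
    have y1: "y \<le> 1 + y powr (\<alpha> + 2)" "y powr (\<alpha> + 1) \<le> 1 + y powr (\<alpha> + 2)"
      using powr_le_one_plus[of y 1 "\<alpha> + 2"] powr_le_one_plus[of y "\<alpha> + 1" "\<alpha> + 2"] yx al by simp_all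
    have y2: "y powr (\<alpha> + 1) * y = y powr (\<alpha> + 2)"
      using powr_add[of y "\<alpha> + 1" 1] yx by (simp add: add.assoc)
    have "(B + y powr (\<alpha> + 1)) * x \<le> (B + y powr (\<alpha> + 1)) * (\<theta> * (1 + y))"
      using True B by (intro mult_left_mono) auto
    also have "\<dots> = \<theta> * (B + B * y + y powr (\<alpha> + 1) + y powr (\<alpha> + 1) * y)" by (simp add: algebra_simps)
    also have "\<dots> \<le> \<theta> * ((2 * B + 2) * (1 + y powr (\<alpha> + 2)))"
    proof (rule mult_left_mono)
      have "B * y \<le> B * (1 + y powr (\<alpha> + 2))" by (rule mult_left_mono[OF y1(1) B])
      moreover have "0 \<le> B * y powr (\<alpha> + 2)" using B by simp
      moreover have "(2 * B + 2) * (1 + y powr (\<alpha> + 2)) = 2 * B + 2 * (B * y powr (\<alpha> + 2)) + 2 + 2 * y powr (\<alpha> + 2)"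
        by (simp add: algebra_simps)
      ultimately show "B + B * y + y powr (\<alpha> + 1) + y powr (\<alpha> + 1) * y \<le> (2 * B + 2) * (1 + y powr (\<alpha> + 2))"
        using y1(2) y2 by (simp add: distrib_left)
    qed (use th in simp)
    also have "\<dots> = (\<theta> * (2 * B + 2)) * (1 + y powr (\<alpha> + 2))" by (simp add: mult.assoc)
    also have "\<dots> \<le> \<eta> * (1 + y powr (\<alpha> + 2))" by (intro mult_right_mono th') (simp add: add_nonneg_nonneg)
    finally show ?thesis using B by (simp add: add_increasing2)
  next
    case False
    define z where "z = x / \<theta>"
    have z: "1 + y \<le> z" using False th by (simp add: z_def field_simps)
    have xz: "x \<le> z" using th yx by (simp add: z_def le_divide_eq mult_left_le)
    have "y powr (\<alpha> + 1) \<le> z powr (\<alpha> + 1)" using z yx al by (intro powr_mono2) auto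
    moreover have "1 \<le> z powr (\<alpha> + 1)" using z yx al by (intro ge_one_powr_ge_zero) auto
    then have "B \<le> B * z powr (\<alpha> + 1)" using B mult_left_mono[of 1 "z powr (\<alpha> + 1)" B] by simp
    ultimately have "(B + y powr (\<alpha> + 1)) * x \<le> ((B + 1) * z powr (\<alpha> + 1)) * z"
      using B yx xz by (intro mult_mono) (auto simp: distrib_right)
    also have "\<dots> = (B + 1) * z powr (\<alpha> + 2)"
      using powr_add[of z "\<alpha> + 1" 1] z yx by (simp add: add.assoc)
    also have "z powr (\<alpha> + 2) = (1 / \<theta>) powr (\<alpha> + 2) * x powr (\<alpha> + 2)"
      unfolding z_def using th yx powr_mult[of "1 / \<theta>" x] by simp
    finally have "(B + y powr (\<alpha> + 1)) * x \<le> ((B + 1) * (1 / \<theta>) powr (\<alpha> + 2)) * x powr (\<alpha> + 2)"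
      by (simp add: mult.assoc)
    moreover have "0 \<le> \<eta> * (1 + y powr (\<alpha> + 2))" using eta by (simp add: add_nonneg_nonneg)
    ultimately show ?thesis by linarith
  qed
  then show ?thesis using that[of "(B + 1) * (1 / \<theta>) powr (\<alpha> + 2)"] B by simp
qed

section \<open>The energy\<close>

context quintic_nonlinearity
begin

definition energy :: "(real^3 \<Rightarrow> real) \<Rightarrow> state \<Rightarrow> real" where
  "energy h V = (gnorm (fst V))\<^sup>2 / 2 + (L2_norm \<Omega> (snd V))\<^sup>2 / 2 + potential (fst V) - L2_inner \<Omega> h (fst V)"

lemma square_diff_bound:
  fixes x y d :: real
  assumes "\<bar>y - x\<bar> \<le> d" "0 \<le> x"
  shows "\<bar>y\<^sup>2 / 2 - x\<^sup>2 / 2\<bar> \<le> d * (2 * x + d) / 2"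
proof -
  have "\<bar>y\<^sup>2 - x\<^sup>2\<bar> = \<bar>y - x\<bar> * \<bar>y + x\<bar>" by (simp add: power2_eq_square algebra_simps flip: abs_mult)
  also have "\<dots> \<le> d * (2 * x + d)" using assms by (intro mult_mono) auto
  finally show ?thesis by (simp add: diff_divide_distrib[symmetric])
qed

text \<open>The increment of each part of the energy is bounded by a polynomial in the distance that
  vanishes at 0; its coefficients depend on the fixed point \<open>V\<close> only.\<close>

lemma energy_continuous:
  assumes h: "h \<in> L2 \<Omega>" and V: "V \<in> phase_space \<Omega>" and e: "e > 0"
  obtains \<delta> where "\<delta> > 0"
    "\<And>W. W \<in> phase_space \<Omega> \<Longrightarrow> phase_dist \<Omega> W V < \<delta> \<Longrightarrow> \<bar>energy h W - energy h V\<bar> < e"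
proof -
  obtain C where C: "C \<ge> 0"
    "\<And>a b q. a \<in> H10 \<Omega> \<Longrightarrow> b \<in> H10 \<Omega> \<Longrightarrow> q \<in> H10 \<Omega> \<Longrightarrow>
      \<bar>fip a q - fip b q\<bar> \<le> C * wgt a b * gnorm (\<lambda>x. a x - b x) * gnorm q"
    "\<And>a b. a \<in> H10 \<Omega> \<Longrightarrow> b \<in> H10 \<Omega> \<Longrightarrow>
      \<bar>potential b - potential a - fip a (\<lambda>x. b x - a x)\<bar> \<le> C * wgt a b * (gnorm (\<lambda>x. b x - a x))\<^sup>2"
    by (rule nonlinear_bounds) blast
  obtain P where P: "P \<ge> 0" "\<And>u. u \<in> H10 \<Omega> \<Longrightarrow> L2_norm \<Omega> u \<le> P * gnorm u"
    using Poincare by blast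
  obtain a v where Vav: "V = (a, v)" by (cases V)
  have a: "a \<in> H10 \<Omega>" and v: "v \<in> L2 \<Omega>" using V by (auto simp: Vav phase_space_def)
  define g where "g = gnorm a"
  define l where "l = L2_norm \<Omega> v"
  have gl: "0 \<le> g" "0 \<le> l" by (auto simp: g_def l_def gnorm_nonneg L2_norm_nonneg)
  \<comment> \<open>In this order: gradient part, kinetic part, linear part of the potential, its
    quadratic remainder, and the force \<open>h\<close>.\<close>
  define R where "R d = d * (2 * g + d) / 2 + d * (2 * l + d) / 2 + C * (1 + g^4) * g * d
    + C * (1 + g^4 + (g + d)^4) * d\<^sup>2 + L2_norm \<Omega> h * (P * d)" for d
  have bound: "\<bar>energy h W - energy h V\<bar> \<le> R (phase_dist \<Omega> W V)" if W: "W \<in> phase_space \<Omega>" for W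
  proof -
    obtain b w where Wbw: "W = (b, w)" by (cases W)
    have b: "b \<in> H10 \<Omega>" and w: "w \<in> L2 \<Omega>" using W by (auto simp: Wbw phase_space_def)
    define d where "d = phase_dist \<Omega> W V"
    have d1: "gnorm (\<lambda>x. b x - a x) \<le> d" and d2: "L2_norm \<Omega> (\<lambda>x. w x - v x) \<le> d"
      by (simp_all add: d_def Wbw Vav phase_dist_def phase_norm_def real_le_rsqrt)
    have d: "0 \<le> d" using d1 gnorm_nonneg[of "\<lambda>x. b x - a x"] by linarith
    have "\<bar>gnorm b - g\<bar> \<le> d" using gnorm_abs_diff[OF b a] d1 by (simp add: g_def)
    note t1 = square_diff_bound[OF this gl(1)]
    have gb: "gnorm b \<le> g + d" using gnorm_add[OF a H10_diff[OF b a]] d1 by (simp add: g_def)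
    have "\<bar>L2_norm \<Omega> w - l\<bar> \<le> d"
    proof -
      have "L2_norm \<Omega> w \<le> l + L2_norm \<Omega> (\<lambda>x. w x - v x)"
        using L2_norm_triangle[OF v L2_diff[OF w v]] by (simp add: l_def)
      moreover have "l \<le> L2_norm \<Omega> w + L2_norm \<Omega> (\<lambda>x. w x - v x)"
        using L2_norm_triangle[OF w L2_diff[OF v w]] L2_norm_minus_commute[of \<Omega> w v] by (simp add: l_def)
      ultimately show ?thesis using d2 by linarith
    qed
    note t2 = square_diff_bound[OF this gl(2)]
    \<comment> \<open>Comparison with the zero function turns the Lipschitz bound into a bound for
      \<open>fip a\<close> itself.\<close>
    have "fip (\<lambda>x. 0) q = 0" for q by (simp add: L2_inner_def f_zero)
    then have "\<bar>fip a (\<lambda>x. b x - a x)\<bar> \<le> C * wgt a (\<lambda>x. 0) * g * gnorm (\<lambda>x. b x - a x)"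
      using C(2)[OF a H10_zero H10_diff[OF b a]] by (simp add: g_def)
    also have "\<dots> \<le> C * wgt a (\<lambda>x. 0) * g * d"
      using C(1) wgt_ge_1[of a "\<lambda>x. 0"] gl by (intro mult_left_mono d1 mult_nonneg_nonneg) auto
    also have "\<dots> = C * (1 + g^4) * g * d" by (simp add: wgt_def g_def gnorm_zero)
    finally have t3: "\<bar>fip a (\<lambda>x. b x - a x)\<bar> \<le> C * (1 + g^4) * g * d" .
    have "C * wgt a b * (gnorm (\<lambda>x. b x - a x))\<^sup>2 \<le> C * (1 + g^4 + (g + d)^4) * d\<^sup>2"
      unfolding wgt_def g_def[symmetric] using C(1) d gb gl
      by (intro mult_mono mult_left_mono power_mono add_mono d1 gnorm_nonneg) (auto simp: gnorm_nonneg)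
    then have t4: "\<bar>potential b - potential a - fip a (\<lambda>x. b x - a x)\<bar> \<le> C * (1 + g^4 + (g + d)^4) * d\<^sup>2"
      using C(3)[OF a b] by linarith
    have "\<bar>L2_inner \<Omega> h b - L2_inner \<Omega> h a\<bar> \<le> L2_norm \<Omega> h * L2_norm \<Omega> (\<lambda>x. b x - a x)"
      using L2_Cauchy_Schwarz[OF h L2_diff[OF H10_L2[OF b] H10_L2[OF a]]]
      by (simp add: L2_inner_diff_right[OF H10_L2[OF b] H10_L2[OF a] h])
    also have "\<dots> \<le> L2_norm \<Omega> h * (P * d)"
      using P(2)[OF H10_diff[OF b a]] mult_left_mono[OF d1 P(1)]
      by (intro mult_left_mono L2_norm_nonneg) linarith
    finally have t5: "\<bar>L2_inner \<Omega> h b - L2_inner \<Omega> h a\<bar> \<le> L2_norm \<Omega> h * (P * d)" .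
    have "energy h W - energy h V = ((gnorm b)\<^sup>2 / 2 - g\<^sup>2 / 2) + ((L2_norm \<Omega> w)\<^sup>2 / 2 - l\<^sup>2 / 2)
      + fip a (\<lambda>x. b x - a x) + (potential b - potential a - fip a (\<lambda>x. b x - a x)) - (L2_inner \<Omega> h b - L2_inner \<Omega> h a)"
      by (simp add: energy_def Wbw Vav g_def l_def)
    then show ?thesis using t1 t2 t3 t4 t5 unfolding R_def d_def[symmetric] by linarith
  qed
  have "(R \<longlongrightarrow> R 0) (at 0)"
    unfolding R_def by (intro tendsto_intros) auto
  then have "(R \<longlongrightarrow> 0) (at 0)" by (simp add: R_def)
  then obtain \<delta> where \<delta>: "\<delta> > 0" "\<And>d. d \<noteq> 0 \<Longrightarrow> \<bar>d\<bar> < \<delta> \<Longrightarrow> \<bar>R d\<bar> < e"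
    using e unfolding LIM_eq by auto
  have "R 0 = 0" by (simp add: R_def)
  then have \<delta>': "\<bar>R d\<bar> < e" if "\<bar>d\<bar> < \<delta>" for d using \<delta>(2)[of d] that e by (cases "d = 0") auto
  show ?thesis
  proof (rule that[OF \<delta>(1)])
    fix W assume W: "W \<in> phase_space \<Omega>" "phase_dist \<Omega> W V < \<delta>"
    have "0 \<le> phase_dist \<Omega> W V" by (simp add: phase_dist_def phase_norm_def)
    then show "\<bar>energy h W - energy h V\<bar> < e"
      using \<delta>'[of "phase_dist \<Omega> W V"] bound[OF W(1)] W(2) by linarith
  qed
qed

end

section \<open>The energy inequality for weak solutions\<close>

context weak_solution_setting
begin

lemma phase_space_U: "0 \<le> t \<Longrightarrow> U t \<in> phase_space \<Omega>"
  using sol by (simp add: weak_solution_def Let_def)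

lemma energy_U_continuous: "continuous_on {0..} (\<lambda>t. energy h (U t))"
  unfolding continuous_on
proof
  fix t :: real assume t: "t \<in> {0..}"
  show "((\<lambda>s. energy h (U s)) \<longlongrightarrow> energy h (U t)) (at t within {0..})"
  proof (rule tendstoI)
    fix e :: real assume "e > 0"
    then obtain \<delta> where \<delta>: "\<delta> > 0"
      "\<And>W. W \<in> phase_space \<Omega> \<Longrightarrow> phase_dist \<Omega> W (U t) < \<delta> \<Longrightarrow> \<bar>energy h W - energy h (U t)\<bar> < e"
      using energy_continuous[OF h_L2 phase_space_U] t by (metis atLeast_iff)
    have "\<forall>\<^sub>F s in at t within {0..}. phase_dist \<Omega> (U s) (U t) < \<delta>"
      using phase_dist_tendsto t \<delta>(1) by (intro order_tendstoD(2)) auto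
    moreover have "\<forall>\<^sub>F s in at t within {0..}. s \<in> {0..}"
      by (auto simp: eventually_at_filter)
    ultimately show "\<forall>\<^sub>F s in at t within {0..}. dist (energy h (U s)) (energy h (U t)) < e"
      by eventually_elim (use \<delta>(2) phase_space_U in \<open>auto simp: dist_real_def\<close>)
  qed
qed

lemma gnorm_average:
  assumes "a \<in> H10 \<Omega>" "b \<in> H10 \<Omega>" "z \<in> H10 \<Omega>"
  shows "gnorm (\<lambda>x. z x - 1 / 2 * (a x + b x)) \<le> gnorm (\<lambda>x. z x - a x) / 2 + gnorm (\<lambda>x. z x - b x) / 2"
proof -
  have "(\<lambda>x. z x - 1 / 2 * (a x + b x)) = (\<lambda>x. 1 / 2 * ((z x - a x) + (z x - b x)))"
    by (auto simp: field_simps)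
  then have "gnorm (\<lambda>x. z x - 1 / 2 * (a x + b x)) = \<bar>1 / 2\<bar> * gnorm (\<lambda>x. (z x - a x) + (z x - b x))"
    by (simp only: gnorm_mult[OF H10_add[OF H10_diff[OF assms(3,1)] H10_diff[OF assms(3,2)]]])
  also have "\<dots> \<le> gnorm (\<lambda>x. z x - a x) / 2 + gnorm (\<lambda>x. z x - b x) / 2"
    using gnorm_add[OF H10_diff[OF assms(3,1)] H10_diff[OF assms(3,2)]] by simp
  finally show ?thesis .
qed

text \<open>One time step is tested with the average of \<open>v\<close> at its two end points; the error involves
  only the oscillation of \<open>u\<close> and of \<open>v\<close> over the step, in the energy norm.\<close>

lemma energy_step:
  assumes T: "0 \<le> T"
  obtains B where "B \<ge> 0"
    "\<And>t b \<omega> X. \<lbrakk>0 \<le> t; t \<le> b; b \<le> T; v t \<in> H10 \<Omega>; v b \<in> H10 \<Omega>; 0 \<le> \<omega>;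
      \<And>\<sigma> \<tau>. \<sigma> \<in> {t..b} \<Longrightarrow> \<tau> \<in> {t..b} \<Longrightarrow> gnorm (\<lambda>x. u \<sigma> x - u \<tau> x) \<le> \<omega>;
      integrable (lebesgue_on {t..b}) X;
      AE \<tau> in lebesgue_on {t..b}. (B + k \<tau> powr (\<alpha> + 1)) * gnorm (\<lambda>x. v \<tau> x - 1 / 2 * (v t x + v b x)) \<le> X \<tau>\<rbrakk>
      \<Longrightarrow> energy h (U b) - energy h (U t) + (LINT \<tau>|lebesgue_on {t..b}. k \<tau> powr (\<alpha> + 2))
        \<le> (LINT \<tau>|lebesgue_on {t..b}. B * \<omega> * k \<tau> + X \<tau>)"
proof -
  obtain C where C: "C \<ge> 0"
    "\<And>a b q. a \<in> H10 \<Omega> \<Longrightarrow> b \<in> H10 \<Omega> \<Longrightarrow> q \<in> H10 \<Omega> \<Longrightarrow>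
      \<bar>fip a q - fip b q\<bar> \<le> C * wgt a b * gnorm (\<lambda>x. a x - b x) * gnorm q"
    "\<And>a b. a \<in> H10 \<Omega> \<Longrightarrow> b \<in> H10 \<Omega> \<Longrightarrow>
      \<bar>potential b - potential a - fip a (\<lambda>x. b x - a x)\<bar> \<le> C * wgt a b * (gnorm (\<lambda>x. b x - a x))\<^sup>2"
    by (rule nonlinear_bounds) blast
  obtain P where P: "P \<ge> 0" "\<And>u. u \<in> H10 \<Omega> \<Longrightarrow> L2_norm \<Omega> u \<le> P * gnorm u"
    using Poincare by blast
  obtain M where M: "M \<ge> 0" "\<And>t. 0 \<le> t \<Longrightarrow> t \<le> T \<Longrightarrow> gnorm (u t) \<le> M"
    using u_bounded by blast
  define W where "W = 1 + M^4 + M^4"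
  have W0: "0 \<le> W" by (simp add: W_def)
  have W: "wgt a b \<le> W" if "gnorm a \<le> M" "gnorm b \<le> M" for a b
    unfolding wgt_def W_def using that by (intro add_mono power_mono gnorm_nonneg) auto
  define N where "N = L2_norm \<Omega> h * P"
  have N0: "0 \<le> N" by (simp add: N_def P(1) L2_norm_nonneg)
  \<comment> \<open>The sum of all factors below: \<open>N\<close>, \<open>M\<close> and
    \<open>C * W * M\<close> multiply the distance of \<open>v \<tau>\<close> from the test
    function, while 1 and twice \<open>C * W\<close> multiply \<open>\<omega> * k \<tau>\<close>.
    One constant then serves both kinds of error.\<close>
  define B where "B = N + M + C * W * M + 1 + 2 * (C * W)"
  have B0: "0 \<le> B" using N0 M(1) C(1) W0 by (simp add: B_def)
  show ?thesis
  proof (rule that[OF B0])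
    fix t b \<omega> :: real and X :: "real \<Rightarrow> real"
    assume tb: "0 \<le> t" "t \<le> b" "b \<le> T" and vt: "v t \<in> H10 \<Omega>" and vb: "v b \<in> H10 \<Omega>" and om: "0 \<le> \<omega>"
      and osc: "\<And>\<sigma> \<tau>. \<sigma> \<in> {t..b} \<Longrightarrow> \<tau> \<in> {t..b} \<Longrightarrow> gnorm (\<lambda>x. u \<sigma> x - u \<tau> x) \<le> \<omega>"
      and Xi: "integrable (lebesgue_on {t..b}) X"
      and X: "AE \<tau> in lebesgue_on {t..b}. (B + k \<tau> powr (\<alpha> + 1)) * gnorm (\<lambda>x. v \<tau> x - 1 / 2 * (v t x + v b x)) \<le> X \<tau>"
    let ?\<mu> = "lebesgue_on {t..b}"
    have b0: "0 \<le> b" using tb by simp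
    note ut = u_H10[OF tb(1)] and ub = u_H10[OF b0]
    define m where "m = (\<lambda>x. 1 / 2 * (v t x + v b x))"
    \<comment> \<open>The counterpart of \<open>m\<close> for \<open>u\<close>: the increment of
      \<open>u\<close> tested with this average is the exact increment of half the squared gradient
      norm.\<close>
    define z where "z = (\<lambda>x. 1 / 2 * (u t x + u b x))"
    define w where "w = (\<lambda>x. u b x - u t x)"
    have mH: "m \<in> H10 \<Omega>" and zH: "z \<in> H10 \<Omega>" and wH: "w \<in> H10 \<Omega>"
      unfolding m_def z_def w_def by (intro H10_mult H10_add H10_diff vt vb ut ub)+
    have h_bound: "\<bar>L2_inner \<Omega> h q\<bar> \<le> N * gnorm q" if q: "q \<in> H10 \<Omega>" for q
    proof -
      have "\<bar>L2_inner \<Omega> h q\<bar> \<le> L2_norm \<Omega> h * L2_norm \<Omega> q" by (rule L2_Cauchy_Schwarz[OF h_L2 H10_L2[OF q]])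
      also have "\<dots> \<le> L2_norm \<Omega> h * (P * gnorm q)" by (intro mult_left_mono P(2) q L2_norm_nonneg)
      finally show ?thesis by (simp add: N_def mult.assoc)
    qed
    have LI: "L2_approximable (L2_inner \<Omega> h)"
      unfolding L2_approximable_def
      by (intro exI[of _ "\<lambda>_. h"] exI[of _ N] conjI ballI allI h_L2 tendsto_const h_bound)
    note inc_h = L2_approximable_increment[OF LI tb(1,2)]
      and inc_z = L2_approximable_increment[OF L2_approximable_gip[OF zH] tb(1,2)]
      and inc_w = L2_approximable_increment[OF L2_approximable_gip[OF wH] tb(1,2)]
      and inc_f = L2_approximable_increment[OF L2_approximable_fip[OF ut] tb(1,2)]
    note inc_h(2)[folded w_def] and inc_z(2)[folded w_def] and inc_w(2)[folded w_def] and inc_f(2)[folded w_def]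
    note incs = this
    let ?G = "\<lambda>\<tau>. gip (u \<tau>) m + damping_power (k \<tau>) \<alpha> * gip (v \<tau>) m + fip (u \<tau>) m"
    have Gi: "integrable ?\<mu> ?G" by (rule weak_form_integrable[OF mH tb(1,2)])
    have ki: "integrable ?\<mu> k" by (rule k_integrable[OF tb(1)])
    have kpi: "integrable ?\<mu> (\<lambda>\<tau>. k \<tau> powr (\<alpha> + 2))" by (rule k_powr_integrable[OF tb(1)])
    have ci: "integrable ?\<mu> (\<lambda>\<tau>. c::real)" for c by (intro integrable_lebesgue_on_continuous) auto
    have kin: "(L2_norm \<Omega> (v b))\<^sup>2 / 2 - (L2_norm \<Omega> (v t))\<^sup>2 / 2
        = (LINT \<tau>|?\<mu>. L2_inner \<Omega> h m) - (LINT \<tau>|?\<mu>. ?G \<tau>)"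
    proof -
      note vL = v_L2[OF tb(1)] v_L2[OF b0]
      have "L2_inner \<Omega> (v b) m - L2_inner \<Omega> (v t) m = (L2_norm \<Omega> (v b))\<^sup>2 / 2 - (L2_norm \<Omega> (v t))\<^sup>2 / 2"
        unfolding m_def L2_inner_mult_right L2_inner_add_right[OF vL vL(1)] L2_inner_add_right[OF vL vL(2)] L2_norm_sq
        by (simp add: L2_inner_commute[of \<Omega> "v b" "v t"] field_simps)
      then show ?thesis
        using weak_form_increment[OF mH tb(1,2)] unfolding LINT_const_interval[OF tb(2)] by linarith
    qed
    have pot_grad: "(gnorm (u b))\<^sup>2 / 2 - (gnorm (u t))\<^sup>2 / 2 = (LINT \<tau>|?\<mu>. gip (v \<tau>) z)"
    proof -
      have "gip w z = (gnorm (u b))\<^sup>2 / 2 - (gnorm (u t))\<^sup>2 / 2"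
        unfolding z_def gip_mult_right[OF H10_add[OF ut ub] wH] gip_add_right[OF ut ub wH] gnorm_sq
        unfolding w_def gip_diff_left[OF ub ut ut] gip_diff_left[OF ub ut ub]
        by (simp add: gip_commute[of "u b" "u t"] field_simps)
      then show ?thesis using incs(2) by simp
    qed
    have wn: "gnorm w \<le> \<omega>" unfolding w_def using osc[of b t] tb by simp
    have gu: "gnorm (u \<tau>) \<le> M" if "\<tau> \<in> {t..b}" for \<tau> using M(2)[of \<tau>] that tb by auto
    \<comment> \<open>The square of \<open>\<omega>\<close> would not be proportional to the length
      of the step. So only one factor is bounded by \<open>\<omega>\<close>, and the other becomes a
      time integral of \<open>k\<close>.\<close>
    have w2: "(gnorm w)\<^sup>2 \<le> (LINT \<tau>|?\<mu>. \<omega> * k \<tau>)"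
    proof -
      have "(gnorm w)\<^sup>2 = (LINT \<tau>|?\<mu>. gip (v \<tau>) w)" using incs(3) by (simp add: gnorm_sq)
      also have "\<dots> \<le> (LINT \<tau>|?\<mu>. \<omega> * k \<tau>)"
      proof (rule integral_mono_AE[OF inc_w(1) integrable_mult_right[OF ki]])
        show "AE \<tau> in ?\<mu>. gip (v \<tau>) w \<le> \<omega> * k \<tau>"
          using v_H10_AE[OF tb(1)]
        proof eventually_elim
          case (elim \<tau>)
          have "gip (v \<tau>) w \<le> k \<tau> * gnorm w" using gip_bound[OF elim wH] by linarith
          also have "\<dots> \<le> k \<tau> * \<omega>" by (intro mult_left_mono wn gnorm_nonneg)
          finally show ?case by (simp add: mult.commute)
        qed
      qed
      finally show ?thesis .
    qed
    have pot: "potential (u b) - potential (u t) \<le> (LINT \<tau>|?\<mu>. fip (u t) (v \<tau>)) + (LINT \<tau>|?\<mu>. C * W * (\<omega> * k \<tau>))"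
    proof -
      have "potential (u b) - potential (u t) - fip (u t) w \<le> C * wgt (u t) (u b) * (gnorm w)\<^sup>2"
        using C(3)[OF ut ub] unfolding w_def by linarith
      also have "\<dots> \<le> C * W * (LINT \<tau>|?\<mu>. \<omega> * k \<tau>)"
        using C(1) W0 gu[of t] gu[of b] tb by (intro mult_mono mult_left_mono W w2 mult_nonneg_nonneg) auto
      also have "\<dots> = (LINT \<tau>|?\<mu>. C * W * (\<omega> * k \<tau>))" by simp
      finally show ?thesis using incs(4) by simp
    qed
    \<comment> \<open>All contributions are gathered under one time integral; what remains is a
      pointwise estimate for almost every \<open>\<tau>\<close>.\<close>
    let ?L = "\<lambda>\<tau>. L2_inner \<Omega> h m - ?G \<tau> + gip (v \<tau>) z + fip (u t) (v \<tau>) + C * W * (\<omega> * k \<tau>)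
        - L2_inner \<Omega> h (v \<tau>) + k \<tau> powr (\<alpha> + 2)"
    have Li: "integrable ?\<mu> ?L"
      by (intro Bochner_Integration.integrable_add Bochner_Integration.integrable_diff ci Gi inc_z(1) inc_f(1)
          integrable_mult_right ki inc_h(1) kpi)
    have "energy h (U b) - energy h (U t)
       = ((gnorm (u b))\<^sup>2 / 2 - (gnorm (u t))\<^sup>2 / 2) + ((L2_norm \<Omega> (v b))\<^sup>2 / 2 - (L2_norm \<Omega> (v t))\<^sup>2 / 2)
        + (potential (u b) - potential (u t)) - L2_inner \<Omega> h w"
      unfolding energy_def w_def L2_inner_diff_right[OF H10_L2[OF ub] H10_L2[OF ut] h_L2] by simp
    also have "\<dots> \<le> (LINT \<tau>|?\<mu>. gip (v \<tau>) z) + ((LINT \<tau>|?\<mu>. L2_inner \<Omega> h m) - (LINT \<tau>|?\<mu>. ?G \<tau>))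
        + ((LINT \<tau>|?\<mu>. fip (u t) (v \<tau>)) + (LINT \<tau>|?\<mu>. C * W * (\<omega> * k \<tau>))) - (LINT \<tau>|?\<mu>. L2_inner \<Omega> h (v \<tau>))"
      using kin pot_grad pot incs(1) by linarith
    finally have "energy h (U b) - energy h (U t) + (LINT \<tau>|?\<mu>. k \<tau> powr (\<alpha> + 2))
      \<le> (LINT \<tau>|?\<mu>. L2_inner \<Omega> h m) - (LINT \<tau>|?\<mu>. ?G \<tau>) + (LINT \<tau>|?\<mu>. gip (v \<tau>) z)
        + (LINT \<tau>|?\<mu>. fip (u t) (v \<tau>)) + (LINT \<tau>|?\<mu>. C * W * (\<omega> * k \<tau>))
        - (LINT \<tau>|?\<mu>. L2_inner \<Omega> h (v \<tau>)) + (LINT \<tau>|?\<mu>. k \<tau> powr (\<alpha> + 2))" by linarith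
    also have "\<dots> = (LINT \<tau>|?\<mu>. ?L \<tau>)"
    proof -
      note i = ci[of "L2_inner \<Omega> h m"] Gi inc_z(1) inc_f(1) integrable_mult_right[OF integrable_mult_right[OF ki]] inc_h(1) kpi
      note i1 = Bochner_Integration.integrable_diff[OF i(1,2)]
      note i2 = Bochner_Integration.integrable_add[OF i1 i(3)]
      note i3 = Bochner_Integration.integrable_add[OF i2 i(4)]
      note i4 = Bochner_Integration.integrable_add[OF i3 i(5)]
      note i5 = Bochner_Integration.integrable_diff[OF i4 i(6)]
      show ?thesis
        unfolding Bochner_Integration.integral_add[OF i5 i(7)] Bochner_Integration.integral_diff[OF i4 i(6)]
          Bochner_Integration.integral_add[OF i3 i(5)] Bochner_Integration.integral_add[OF i2 i(4)]
          Bochner_Integration.integral_add[OF i1 i(3)] Bochner_Integration.integral_diff[OF i(1,2)] ..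
    qed
    also have "\<dots> \<le> (LINT \<tau>|?\<mu>. B * \<omega> * k \<tau> + X \<tau>)"
    proof (rule integral_mono_AE[OF Li Bochner_Integration.integrable_add[OF integrable_mult_right[OF ki] Xi]])
      show "AE \<tau> in ?\<mu>. ?L \<tau> \<le> B * \<omega> * k \<tau> + X \<tau>"
        using v_H10_AE[OF tb(1)] X AE_space
      proof eventually_elim
        case (elim \<tau>)
        then have v\<tau>: "v \<tau> \<in> H10 \<Omega>" and \<tau>: "\<tau> \<in> {t..b}" by auto
        have u\<tau>: "u \<tau> \<in> H10 \<Omega>" using \<tau> tb by (intro u_H10) auto
        define \<xi> where "\<xi> = gnorm (\<lambda>x. v \<tau> x - m x)"
        note d = H10_diff[OF v\<tau> mH]
        have k0: "0 \<le> k \<tau>" and xi0: "0 \<le> \<xi>" by (auto simp: \<xi>_def gnorm_nonneg)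
        have e1: "L2_inner \<Omega> h m - L2_inner \<Omega> h (v \<tau>) \<le> N * \<xi>"
          using h_bound[OF d] by (simp add: \<xi>_def L2_inner_diff_right[OF H10_L2[OF v\<tau>] H10_L2[OF mH] h_L2])
        \<comment> \<open>The elastic terms \<open>gip (v \<tau>) z\<close> of the energy and
          \<open>gip (u \<tau>) m\<close> of the weak form cancel up to two errors:
          \<open>e2\<close> replaces \<open>z\<close> by \<open>u \<tau>\<close>, and
          \<open>e3\<close> replaces \<open>m\<close> by \<open>v \<tau>\<close>.\<close>
        have "gnorm (\<lambda>x. u \<tau> x - z x) \<le> \<omega>"
          using gnorm_average[OF ut ub u\<tau>] osc[of \<tau> t] osc[of \<tau> b] \<tau> tb by (simp add: z_def)
        then have "k \<tau> * gnorm (\<lambda>x. z x - u \<tau> x) \<le> k \<tau> * \<omega>"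
          unfolding gnorm_minus_commute[OF zH u\<tau>] by (intro mult_left_mono k0)
        then have e2: "gip (v \<tau>) z - gip (v \<tau>) (u \<tau>) \<le> k \<tau> * \<omega>"
          using gip_bound[OF v\<tau> H10_diff[OF zH u\<tau>]] by (simp add: gip_diff_right[OF zH u\<tau> v\<tau>])
        have "gnorm (u \<tau>) * \<xi> \<le> M * \<xi>" by (intro mult_right_mono gu \<tau> xi0)
        then have e3: "gip (v \<tau>) (u \<tau>) - gip (u \<tau>) m \<le> M * \<xi>"
          using gip_bound[OF u\<tau> d] by (simp add: gip_diff_right[OF v\<tau> mH u\<tau>] gip_commute[of "v \<tau>" "u \<tau>"] \<xi>_def)
        \<comment> \<open>The potential was expanded at the left end \<open>t\<close>, whereas the
          weak form contains \<open>u \<tau>\<close>; the difference is an oscillation of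
          \<open>u\<close>.\<close>
        have "C * wgt (u t) (u \<tau>) * gnorm (\<lambda>x. u t x - u \<tau> x) * k \<tau> \<le> C * W * \<omega> * k \<tau>"
          using C(1) W0 \<tau> tb om by (intro mult_mono mult_left_mono W gu osc mult_nonneg_nonneg gnorm_nonneg) auto
        then have e4: "fip (u t) (v \<tau>) - fip (u \<tau>) (v \<tau>) \<le> C * W * \<omega> * k \<tau>"
          using C(2)[OF ut u\<tau> v\<tau>] by linarith
        have f0: "fip (\<lambda>x. 0) q = 0" for q by (simp add: L2_inner_def f_zero)
        have "C * wgt (u \<tau>) (\<lambda>x. 0) * gnorm (u \<tau>) * \<xi> \<le> C * W * M * \<xi>"
          using C(1) W0 \<tau> M(1) xi0 by (intro mult_mono mult_left_mono W gu mult_nonneg_nonneg gnorm_nonneg) (auto simp: gnorm_zero)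
        then have e5: "fip (u \<tau>) (v \<tau>) - fip (u \<tau>) m \<le> C * W * M * \<xi>"
          using C(2)[OF u\<tau> H10_zero d] by (simp add: f0 fip_diff_right[OF u\<tau> v\<tau> mH] \<xi>_def)
        \<comment> \<open>The dissipation is the damping form tested with \<open>v \<tau>\<close>
          itself. Testing with \<open>m\<close> instead costs \<open>\<xi>\<close> with the
          unbounded weight \<open>k \<tau> powr (\<alpha> + 1)\<close>, which is why this weight
          appears in the condition on \<open>X\<close>.\<close>
        have "k \<tau> powr (\<alpha> + 2) - damping_power (k \<tau>) \<alpha> * gip (v \<tau>) m = damping_power (k \<tau>) \<alpha> * gip (v \<tau>) (\<lambda>x. v \<tau> x - m x)"
          unfolding gip_diff_right[OF v\<tau> mH v\<tau>] damping_mult_sq[symmetric] gnorm_sq by (simp add: right_diff_distrib)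
        also have "\<dots> \<le> damping_power (k \<tau>) \<alpha> * (k \<tau> * \<xi>)"
          using gip_bound[OF v\<tau> d] by (intro mult_left_mono damping_nonneg) (simp add: \<xi>_def)
        also have "\<dots> = k \<tau> powr (\<alpha> + 1) * \<xi>" by (simp add: damping_mult[symmetric])
        finally have e6: "k \<tau> powr (\<alpha> + 2) - damping_power (k \<tau>) \<alpha> * gip (v \<tau>) m \<le> k \<tau> powr (\<alpha> + 1) * \<xi>" .
        have x: "(B + k \<tau> powr (\<alpha> + 1)) * \<xi> \<le> X \<tau>" using elim(2) by (simp add: \<xi>_def m_def)
        have "0 \<le> (1 + 2 * (C * W)) * \<xi>" "0 \<le> (N + M + C * W * M) * (\<omega> * k \<tau>)"
          using C(1) W0 N0 M(1) om k0 xi0 by (intro mult_nonneg_nonneg add_nonneg_nonneg; simp)+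
        then have "N * \<xi> + k \<tau> * \<omega> + M * \<xi> + C * W * \<omega> * k \<tau> + C * W * M * \<xi> + C * W * (\<omega> * k \<tau>) \<le> B * \<omega> * k \<tau> + B * \<xi>"
          unfolding B_def by (simp add: algebra_simps)
        then show ?case using e1 e2 e3 e4 e5 e6 x by (simp add: distrib_right)
      qed
    qed
    finally show "energy h (U b) - energy h (U t) + (LINT \<tau>|?\<mu>. k \<tau> powr (\<alpha> + 2)) \<le> (LINT \<tau>|?\<mu>. B * \<omega> * k \<tau> + X \<tau>)" .
  qed
qed

text \<open>Errors at inner times of a step are collected in an integrand \<open>g\<close> and
  subtracted from the energy. Only the errors at the two ends remain, which is the situation of
  \<open>averaging_bound\<close>.\<close>

lemma energy_inequality:
  assumes ab: "0 \<le> a" "a \<le> b"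
  shows "energy h (U b) + (LINT \<tau>|lebesgue_on {a..b}. k \<tau> powr (\<alpha> + 2)) \<le> energy h (U a)"
proof -
  \<comment> \<open>Steps that start before \<open>b\<close> may end after it; their length stays
    below 1.\<close>
  define T where "T = b + 1"
  have T: "T > 0" using ab by (simp add: T_def)
  define p where "p = \<alpha> + 2"
  have p: "p \<ge> 2" using alpha by (simp add: p_def)
  obtain B where B: "B \<ge> 0" and step:
    "\<And>t b \<omega> X. \<lbrakk>0 \<le> t; t \<le> b; b \<le> T; v t \<in> H10 \<Omega>; v b \<in> H10 \<Omega>; 0 \<le> \<omega>;
      \<And>\<sigma> \<tau>. \<sigma> \<in> {t..b} \<Longrightarrow> \<tau> \<in> {t..b} \<Longrightarrow> gnorm (\<lambda>x. u \<sigma> x - u \<tau> x) \<le> \<omega>;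
      integrable (lebesgue_on {t..b}) X;
      AE \<tau> in lebesgue_on {t..b}. (B + k \<tau> powr (\<alpha> + 1)) * gnorm (\<lambda>x. v \<tau> x - 1 / 2 * (v t x + v b x)) \<le> X \<tau>\<rbrakk>
      \<Longrightarrow> energy h (U b) - energy h (U t) + (LINT \<tau>|lebesgue_on {t..b}. k \<tau> powr (\<alpha> + 2))
        \<le> (LINT \<tau>|lebesgue_on {t..b}. B * \<omega> * k \<tau> + X \<tau>)"
    by (rule energy_step[OF less_imp_le[OF T]]) blast
  have ki: "integrable (lebesgue_on {c..d}) k" if "0 \<le> c" for c d using k_integrable[OF that] .
  have kpi: "integrable (lebesgue_on {c..d}) (\<lambda>\<tau>. k \<tau> powr p)" if "0 \<le> c" for c d
    unfolding p_def using k_powr_integrable[OF that] .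
  have ci: "integrable (lebesgue_on {c..d}) (\<lambda>\<tau>. r::real)" for c d r :: real
    by (intro integrable_lebesgue_on_continuous) auto
  have k1i: "integrable (lebesgue_on {c..d}) (\<lambda>\<tau>. 1 + k \<tau> powr p)" if "0 \<le> c" for c d
    by (intro Bochner_Integration.integrable_add ci kpi that)
  define I where "I = (LINT \<tau>|lebesgue_on {a..b}. 1 + k \<tau> powr p)"
  have I0: "0 \<le> I" unfolding I_def by (intro integral_nonneg_AE AE_I2) (simp add: add_nonneg_nonneg)
  have kI: "(LINT \<tau>|lebesgue_on {a..b}. k \<tau>) \<le> I"
    unfolding I_def using powr_le_one_plus[OF gnorm_nonneg, of 1 p] p ab
    by (intro integral_mono ki k1i) (auto simp: gnorm_nonneg)
  have "energy h (U b) - energy h (U a) + (LINT \<tau>|lebesgue_on {a..b}. k \<tau> powr p) \<le> 0 + e" if e: "0 < e" for e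
  proof -
    \<comment> \<open>Six error terms: two from the ends of the steps after averaging, and four in
      the integral of \<open>g\<close>, namely the oscillation of \<open>u\<close>, the share
      \<open>\<eta>\<close> of the dissipation, the mean of \<open>\<rho>\<close>, and the
      oscillation of \<open>c\<close>.\<close>
    define e6 where "e6 = e / 6"
    have e6: "e6 > 0" using e by (simp add: e6_def)
    define \<eta> where "\<eta> = e6 / (I + 1)"
    have eta: "\<eta> > 0" "\<eta> * I \<le> e6" using e6 I0 by (auto simp: \<eta>_def field_simps)
    obtain C where C: "C \<ge> 0" and young: "\<And>y x. 0 \<le> y \<Longrightarrow> 0 \<le> x \<Longrightarrow>
        (B + y powr (\<alpha> + 1)) * x \<le> \<eta> * (1 + y powr (\<alpha> + 2)) + C * x powr (\<alpha> + 2)"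
      by (rule damped_Young[OF B eta(1) alpha]) blast
    \<comment> \<open>The p-th power of a sum of four terms is split by two rounds of
      \<open>powr_sum_le\<close>, each of which costs \<open>2 powr p\<close>.\<close>
    define D where "D = C * (2 powr p * 2 powr p)"
    have D: "D \<ge> 0" using C by (simp add: D_def)
    define e1 where "e1 = e6 / (D + 1)"
    have e1: "e1 > 0" "D * e1 \<le> e6" using e6 D by (auto simp: e1_def field_simps)
    obtain c \<rho> where cH: "\<And>t. c t \<in> H10 \<Omega>"
      and c_unif: "\<And>\<eta>. \<eta> > 0 \<Longrightarrow> \<exists>\<delta>>0. \<forall>s\<in>{0..T}. \<forall>t\<in>{0..T}. \<bar>s - t\<bar> < \<delta> \<longrightarrow> gnorm (\<lambda>x. c s x - c t x) < \<eta>"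
      and \<rho>i: "integrable (lebesgue_on {0..T}) \<rho>" and \<rho>0: "\<And>t. 0 \<le> \<rho> t"
      and \<rho>e: "(LINT t|lebesgue_on {0..T}. \<rho> t) \<le> e1"
      and \<rho>b: "AE t in lebesgue_on {0..T}. gnorm (\<lambda>x. v t x - c t x) powr (\<alpha> + 2) \<le> \<rho> t"
      by (rule Bochner_continuous_approx[OF T e1(1)]) blast
    \<comment> \<open>The tolerance for the oscillation of \<open>c\<close>, chosen so that
      \<open>D * T\<close> times its p-th power is at most \<open>e6\<close>.\<close>
    define \<omega>c where "\<omega>c = (e6 / (D * T + 1)) powr (1 / p)"
    have DT: "0 < D * T + 1" using D T by (simp add: add_nonneg_pos)
    have "\<omega>c powr p = (e6 / (D * T + 1)) powr (1 / p * p)" unfolding \<omega>c_def by (rule powr_powr)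
    also have "\<dots> = e6 / (D * T + 1)" using e6 DT p by simp
    finally have ocp: "\<omega>c powr p = e6 / (D * T + 1)" .
    have oc: "\<omega>c > 0" using e6 DT by (simp add: \<omega>c_def)
    have oc_small: "D * (\<omega>c powr p) * (b - a) \<le> e6"
    proof -
      have "D * (\<omega>c powr p) * (b - a) \<le> D * (\<omega>c powr p) * T"
        using D ab by (intro mult_left_mono) (auto simp: T_def)
      also have "\<dots> = e6 * (D * T) / (D * T + 1)" by (simp add: ocp)
      also have "\<dots> \<le> e6" using e6 DT by (simp add: divide_le_eq)
      finally show ?thesis .
    qed
    obtain \<delta>c where \<delta>c: "\<delta>c > 0" "\<And>s t. s \<in> {0..T} \<Longrightarrow> t \<in> {0..T} \<Longrightarrow> \<bar>s - t\<bar> < \<delta>c \<Longrightarrow> gnorm (\<lambda>x. c s x - c t x) < \<omega>c"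
      using c_unif[OF oc] by blast
    define \<omega> where "\<omega> = e6 / (B * I + 1)"
    have BI: "0 \<le> B * I" using B I0 by simp
    have om: "\<omega> > 0" "B * \<omega> * I \<le> e6" using e6 BI by (auto simp: \<omega>_def divide_le_eq mult_ac add_nonneg_pos)
    obtain \<delta>u where \<delta>u: "\<delta>u > 0" "\<And>s t. s \<in> {0..T} \<Longrightarrow> t \<in> {0..T} \<Longrightarrow> \<bar>s - t\<bar> < \<delta>u \<Longrightarrow> gnorm (\<lambda>x. u s x - u t x) < \<omega>"
      using u_uniform[OF om(1)] by blast
    define d0 where "d0 = min (min \<delta>c \<delta>u) 1"
    have d0: "d0 > 0" "d0 \<le> \<delta>c" "d0 \<le> \<delta>u" "d0 \<le> 1" using \<delta>c(1) \<delta>u(1) by (auto simp: d0_def)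
    \<comment> \<open>The part of the testing error that depends on the inner time
      \<open>\<tau>\<close>; the contributions \<open>D * \<rho>\<close> of the two ends are
      constant in \<open>\<tau>\<close> and are kept apart.\<close>
    define Y where "Y \<tau> = \<eta> * (1 + k \<tau> powr p) + D * (\<rho> \<tau> + \<omega>c powr p)" for \<tau>
    define g where "g \<tau> = B * \<omega> * k \<tau> + Y \<tau> - k \<tau> powr p" for \<tau>
    have \<rho>i': "integrable (lebesgue_on {s..t}) \<rho>" if "0 \<le> s" "t \<le> T" for s t
      using interval_integrable_subset[OF \<rho>i that] .
    have Yi: "integrable (lebesgue_on {s..t}) Y" if "0 \<le> s" "t \<le> T" for s t
      unfolding Y_def by (intro Bochner_Integration.integrable_add integrable_mult_right k1i ci \<rho>i' that)
    have gi: "integrable (lebesgue_on {s..t}) g" if "0 \<le> s" "t \<le> T" for s t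
      unfolding g_def by (intro Bochner_Integration.integrable_add Bochner_Integration.integrable_diff
          integrable_mult_right ki kpi Yi that)
    \<comment> \<open>\<open>g\<close> contains the negative dissipation, so a bound on the
      increment of \<open>Z\<close> is an energy inequality with error.\<close>
    define Z where "Z t = energy h (U t) - integral {a..t} g" for t
    have Zc: "continuous_on {a..b + d0} Z"
      unfolding Z_def using ab d0 gi[of a "b + d0"]
      by (intro continuous_on_diff continuous_on_subset[OF energy_U_continuous] indefinite_integral_continuous_1
          integrable_on_lebesgue_on) (auto simp: T_def)
    have "Z b - Z a \<le> 2 * (LINT t|lebesgue_on {a..b + d0}. D * \<rho> t)"
    proof (rule averaging_bound[OF ab(2) d0(1) Zc])
      show "integrable (lebesgue_on {a..b + d0}) (\<lambda>t. D * \<rho> t)"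
        using ab d0 by (intro integrable_mult_right \<rho>i') (auto simp: T_def)
      show "0 \<le> D * \<rho> t" for t using D \<rho>0 by simp
      fix \<delta> assume \<delta>: "0 < \<delta>" "\<delta> < d0"
      let ?good = "\<lambda>t. v t \<in> H10 \<Omega> \<and> gnorm (\<lambda>x. v t x - c t x) powr p \<le> \<rho> t"
      have good: "AE t in lebesgue_on {0..T}. ?good t"
        using v_H10_AE[of 0 T] \<rho>b unfolding p_def by auto
      have g1: "AE t in lebesgue_on {a..b}. ?good t"
        by (rule AE_subinterval[OF good]) (use ab in \<open>auto simp: T_def\<close>)
      have g2: "AE t in lebesgue_on {a..b}. ?good (t + \<delta>)"
        by (rule AE_shift, rule AE_subinterval[OF good]) (use ab \<delta> d0 in \<open>auto simp: T_def\<close>)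
      show "AE t in lebesgue_on {a..b}. Z (t + \<delta>) - Z t \<le> \<delta> * (D * \<rho> t + D * \<rho> (t + \<delta>))"
        using g1 g2 AE_space
      proof eventually_elim
        case (elim t)
        define b' where "b' = t + \<delta>"
        have t: "a \<le> t" "t \<le> b" using elim(3) by auto
        have tb: "0 \<le> t" "t \<le> b'" "b' \<le> T" using t ab \<delta> d0 by (auto simp: b'_def T_def)
        have gt: "v t \<in> H10 \<Omega>" "gnorm (\<lambda>x. v t x - c t x) powr p \<le> \<rho> t" using elim(1) by auto
        have gb: "v b' \<in> H10 \<Omega>" "gnorm (\<lambda>x. v b' x - c b' x) powr p \<le> \<rho> b'" using elim(2) by (auto simp: b'_def)
        have goodT: "AE \<tau> in lebesgue_on {t..b'}. ?good \<tau>"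
          by (rule AE_subinterval[OF good]) (use tb in auto)
        let ?X = "\<lambda>\<tau>. Y \<tau> + (D * \<rho> t + D * \<rho> b')"
        have Xi: "integrable (lebesgue_on {t..b'}) ?X"
          by (intro Bochner_Integration.integrable_add Yi ci tb)
        have X: "AE \<tau> in lebesgue_on {t..b'}. (B + k \<tau> powr (\<alpha> + 1)) * gnorm (\<lambda>x. v \<tau> x - 1 / 2 * (v t x + v b' x)) \<le> ?X \<tau>"
          using goodT AE_space
        proof eventually_elim
          case (elim \<tau>)
          then have v\<tau>: "v \<tau> \<in> H10 \<Omega>" "gnorm (\<lambda>x. v \<tau> x - c \<tau> x) powr p \<le> \<rho> \<tau>" and \<tau>: "t \<le> \<tau>" "\<tau> \<le> b'" by auto
          let ?r = "\<lambda>s. gnorm (\<lambda>x. v s x - c s x)"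
          have cc: "gnorm (\<lambda>x. c \<tau> x - c s x) \<le> \<omega>c" if "t \<le> s" "s \<le> b'" for s
            using \<delta>c(2)[of \<tau> s] \<tau> that tb \<delta> d0 by (force simp: b'_def intro: less_imp_le)
          \<comment> \<open>The comparison runs from \<open>v \<tau>\<close> over
            \<open>c \<tau>\<close> and \<open>c s\<close> to \<open>v s\<close>; \<open>v\<close>
            itself has no modulus of continuity in the gradient norm.\<close>
          have r3: "gnorm (\<lambda>x. v \<tau> x - v s x) \<le> ?r \<tau> + \<omega>c + ?r s" if s: "t \<le> s" "s \<le> b'" "v s \<in> H10 \<Omega>" for s
            using gnorm_triangle_diff[OF v\<tau>(1) s(3) cH[of \<tau>]] gnorm_triangle_diff[OF cH[of \<tau>] s(3) cH[of s]]
              cc[OF s(1,2)] gnorm_minus_commute[OF s(3) cH[of s]] by linarith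
          define \<xi> where "\<xi> = gnorm (\<lambda>x. v \<tau> x - 1 / 2 * (v t x + v b' x))"
          have "\<xi> \<le> (?r \<tau> + \<omega>c) + (?r t + ?r b')"
            using gnorm_average[OF gt(1) gb(1) v\<tau>(1)] r3[OF _ _ gt(1)] r3[OF _ _ gb(1)] tb
              gnorm_nonneg[of "\<lambda>x. v t x - c t x"] gnorm_nonneg[of "\<lambda>x. v b' x - c b' x"] by (simp add: \<xi>_def)
          then have "\<xi> powr p \<le> ((?r \<tau> + \<omega>c) + (?r t + ?r b')) powr p"
            using p by (intro powr_mono2) (auto simp: \<xi>_def gnorm_nonneg)
          also have "\<dots> \<le> 2 powr p * ((?r \<tau> + \<omega>c) powr p + (?r t + ?r b') powr p)"
            using p oc by (intro powr_sum_le add_nonneg_nonneg gnorm_nonneg) auto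
          also have "\<dots> \<le> 2 powr p * (2 powr p * (?r \<tau> powr p + \<omega>c powr p) + 2 powr p * (?r t powr p + ?r b' powr p))"
            using p oc by (intro mult_left_mono add_mono powr_sum_le gnorm_nonneg) auto
          also have "\<dots> \<le> 2 powr p * (2 powr p * (\<rho> \<tau> + \<omega>c powr p) + 2 powr p * (\<rho> t + \<rho> b'))"
            using v\<tau>(2) gt(2) gb(2) by (intro mult_left_mono add_mono) auto
          finally have "C * \<xi> powr p \<le> C * (2 powr p * (2 powr p * (\<rho> \<tau> + \<omega>c powr p) + 2 powr p * (\<rho> t + \<rho> b')))"
            using C by (rule mult_left_mono)
          also have "\<dots> = D * (\<rho> \<tau> + \<omega>c powr p) + (D * \<rho> t + D * \<rho> b')"
            by (simp add: D_def algebra_simps)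
          finally have "C * \<xi> powr p \<le> D * (\<rho> \<tau> + \<omega>c powr p) + (D * \<rho> t + D * \<rho> b')" .
          moreover have "(B + k \<tau> powr (\<alpha> + 1)) * \<xi> \<le> \<eta> * (1 + k \<tau> powr p) + C * \<xi> powr p"
            unfolding p_def by (intro young) (auto simp: \<xi>_def gnorm_nonneg)
          ultimately show ?case unfolding \<xi>_def Y_def by linarith
        qed
        have osc: "gnorm (\<lambda>x. u \<sigma> x - u \<tau> x) \<le> \<omega>" if "\<sigma> \<in> {t..b'}" "\<tau> \<in> {t..b'}" for \<sigma> \<tau>
          using \<delta>u(2)[of \<sigma> \<tau>] that tb \<delta> d0 by (force simp: b'_def intro: less_imp_le)
        have "energy h (U b') - energy h (U t) + (LINT \<tau>|lebesgue_on {t..b'}. k \<tau> powr p)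
            \<le> (LINT \<tau>|lebesgue_on {t..b'}. B * \<omega> * k \<tau> + ?X \<tau>)"
          unfolding p_def by (rule step[OF tb gt(1) gb(1) less_imp_le[OF om(1)] osc Xi X])
        also have "\<dots> = (LINT \<tau>|lebesgue_on {t..b'}. g \<tau> + k \<tau> powr p + (D * \<rho> t + D * \<rho> b'))"
          by (intro Bochner_Integration.integral_cong refl) (simp add: g_def)
        also have "\<dots> = (LINT \<tau>|lebesgue_on {t..b'}. g \<tau>) + (LINT \<tau>|lebesgue_on {t..b'}. k \<tau> powr p) + \<delta> * (D * \<rho> t + D * \<rho> b')"
        proof -
          note i = gi[OF tb(1,3)] kpi[OF tb(1), of b'] ci[of t b' "D * \<rho> t + D * \<rho> b'"]
          have "(LINT \<tau>|lebesgue_on {t..b'}. D * \<rho> t + D * \<rho> b') = \<delta> * (D * \<rho> t + D * \<rho> b')"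
            unfolding LINT_const_interval[OF tb(2)] by (simp add: b'_def)
          then show ?thesis
            unfolding Bochner_Integration.integral_add[OF Bochner_Integration.integrable_add[OF i(1,2)] i(3)]
              Bochner_Integration.integral_add[OF i(1,2)] by linarith
        qed
        finally have le: "energy h (U b') - energy h (U t) \<le> (LINT \<tau>|lebesgue_on {t..b'}. g \<tau>) + \<delta> * (D * \<rho> t + D * \<rho> b')"
          by linarith
        have "integral {a..t} g + integral {t..b'} g = integral {a..b'} g"
          using t tb ab gi[of a b'] by (intro Henstock_Kurzweil_Integration.integral_combine integrable_on_lebesgue_on) auto
        moreover have "(LINT \<tau>|lebesgue_on {t..b'}. g \<tau>) = integral {t..b'} g"
          by (intro lebesgue_integral_eq_integral gi tb) simp
        ultimately show ?case using le unfolding Z_def b'_def by linarith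
      qed
    qed
    also have "\<dots> \<le> 2 * (D * e1)"
    proof -
      have "(LINT t|lebesgue_on {a..b + d0}. \<rho> t) \<le> (LINT t|lebesgue_on {0..T}. \<rho> t)"
        using ab d0 by (intro integral_mono_lebesgue_on_AE \<rho>i) (auto simp: T_def \<rho>0)
      then have "D * (LINT t|lebesgue_on {a..b + d0}. \<rho> t) \<le> D * e1"
        using \<rho>e D by (intro mult_left_mono) auto
      then show ?thesis by simp
    qed
    finally have ZZ: "Z b - Z a \<le> 2 * e6" using e1(2) by linarith
    have gab: "integral {a..b} g = (LINT \<tau>|lebesgue_on {a..b}. g \<tau>)"
      using ab gi[of a b] by (intro lebesgue_integral_eq_integral[symmetric]) (auto simp: T_def)
    have "(LINT \<tau>|lebesgue_on {a..b}. g \<tau>) = B * \<omega> * (LINT \<tau>|lebesgue_on {a..b}. k \<tau>) + (\<eta> * I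
       + D * ((LINT \<tau>|lebesgue_on {a..b}. \<rho> \<tau>) + (b - a) * \<omega>c powr p)) - (LINT \<tau>|lebesgue_on {a..b}. k \<tau> powr p)"
    proof -
      have bT: "b \<le> T" by (simp add: T_def)
      note i1 = integrable_mult_right[OF ki[OF ab(1), of b], of "B * \<omega>"]
      note i2 = integrable_mult_right[OF k1i[OF ab(1), of b], of \<eta>]
      note i3 = Bochner_Integration.integrable_add[OF \<rho>i'[OF ab(1) bT] ci[of a b "\<omega>c powr p"]]
      note i4 = integrable_mult_right[OF i3, of D]
      note i5 = Bochner_Integration.integrable_add[OF i2 i4]
      show ?thesis
        unfolding g_def Y_def Bochner_Integration.integral_diff[OF Bochner_Integration.integrable_add[OF i1 i5] kpi[OF ab(1)]]
          Bochner_Integration.integral_add[OF i1 i5] Bochner_Integration.integral_add[OF i2 i4]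
          Bochner_Integration.integral_mult_right_zero Bochner_Integration.integral_add[OF \<rho>i'[OF ab(1) bT] ci] I_def
          LINT_const_interval[OF ab(2)] ..
    qed
    moreover have "B * \<omega> * (LINT \<tau>|lebesgue_on {a..b}. k \<tau>) \<le> B * \<omega> * I"
      using B om(1) by (intro mult_left_mono kI) auto
    moreover have "D * ((LINT \<tau>|lebesgue_on {a..b}. \<rho> \<tau>) + (b - a) * \<omega>c powr p) \<le> e6 + e6"
    proof -
      have "(LINT t|lebesgue_on {a..b}. \<rho> t) \<le> (LINT t|lebesgue_on {0..T}. \<rho> t)"
        using ab by (intro integral_mono_lebesgue_on_AE \<rho>i) (auto simp: T_def \<rho>0)
      then have "D * (LINT t|lebesgue_on {a..b}. \<rho> t) \<le> D * e1"
        using \<rho>e D by (intro mult_left_mono) auto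
      then show ?thesis using e1(2) oc_small by (simp add: algebra_simps)
    qed
    ultimately have "(LINT \<tau>|lebesgue_on {a..b}. g \<tau>) \<le> 4 * e6 - (LINT \<tau>|lebesgue_on {a..b}. k \<tau> powr p)"
      using om(2) eta(2) by linarith
    moreover have "Z a = energy h (U a)" by (simp add: Z_def)
    ultimately show ?thesis using ZZ gab unfolding Z_def by (simp add: e6_def)
  qed
  then have "energy h (U b) - energy h (U a) + (LINT \<tau>|lebesgue_on {a..b}. k \<tau> powr p) \<le> 0"
    by (rule field_le_epsilon)
  then show ?thesis by (simp add: p_def)
qed

end

section \<open>The gradient system\<close>

lemma tendsto_shift_half_line:
  fixes g :: "real \<Rightarrow> real"
  assumes "(g \<longlongrightarrow> l) (at (t + s) within {0..})" "0 \<le> s"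
  shows "((\<lambda>r. g (r + s)) \<longlongrightarrow> l) (at t within {0..})"
  unfolding Lim_within
proof (intro allI impI)
  fix e :: real assume "e > 0"
  with assms(1) obtain d where "d > 0"
    and d: "\<And>x. x \<in> {0..} \<Longrightarrow> 0 < dist x (t + s) \<Longrightarrow> dist x (t + s) < d \<Longrightarrow> dist (g x) l < e"
    unfolding Lim_within by blast
  moreover have "dist (r + s) (t + s) = dist r t" for r by (simp add: dist_real_def)
  ultimately show "\<exists>d>0. \<forall>r\<in>{0..}. 0 < dist r t \<and> dist r t < d \<longrightarrow> dist (g (r + s)) l < e"
    using assms(2) by (intro exI[of _ d]) auto
qed

text \<open>The approximating simple functions are shifted along; their level sets are translates,
  cut down to the interval.\<close>

lemma Bochner_Lp_H10_shift:
  assumes B: "Bochner_Lp_H10 \<Omega> p (T + s) w" and s: "0 \<le> s"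
  shows "Bochner_Lp_H10 \<Omega> p T (\<lambda>t. w (t + s))"
proof -
  from B obtain q where q1: "\<And>n::nat. finite (range (q n))" "\<And>n. range (q n) \<subseteq> H10 \<Omega>"
    and q2: "\<And>n z. {t\<in>{0..T + s}. q n t = z} \<in> sets lebesgue"
    and q3: "AE t in lebesgue_on {0..T + s}. (\<lambda>n. L2_norm \<Omega> (weak_grad \<Omega> (\<lambda>x. q n t x - w t x))) \<longlonglongrightarrow> 0"
    unfolding Bochner_Lp_H10_def by blast
  have ae: "AE t in lebesgue_on {0..T}. P (t + s)" if "AE t in lebesgue_on {0..T + s}. P t" for P
    by (rule AE_shift, rule AE_subinterval[OF that]) (use s in auto)
  have m: "{t\<in>{0..T}. q n (t + s) = z} \<in> sets lebesgue" for n z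
  proof -
    have eq: "{t\<in>{0..T}. q n (t + s) = z} = {0..T} \<inter> (\<lambda>x. - s + x) ` {t\<in>{0..T + s}. q n t = z}"
    proof -
      have "t \<in> (\<lambda>x. - s + x) ` A \<longleftrightarrow> t + s \<in> A" for t A
        by (auto simp: image_iff intro: bexI[of _ "t + s"])
      then show ?thesis using s by auto
    qed
    show ?thesis unfolding eq by (intro sets.Int lebesgue_sets_translation q2) simp
  qed
  have r: "range (\<lambda>t. q n (t + s)) \<subseteq> range (q n)" for n by auto
  have "\<exists>q. (\<forall>n::nat. finite (range (q n)) \<and> range (q n) \<subseteq> H10 \<Omega> \<and> (\<forall>z. {t\<in>{0..T}. q n t = z} \<in> sets lebesgue)) \<and>
      (AE t in lebesgue_on {0..T}. (\<lambda>n. L2_norm \<Omega> (weak_grad \<Omega> (\<lambda>x. q n t x - w (t + s) x))) \<longlonglongrightarrow> 0)"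
    by (intro exI[of _ "\<lambda>n t. q n (t + s)"] conjI allI m ae[OF q3] finite_subset[OF r q1(1)]
        order_trans[OF r q1(2)])
  moreover have "AE t in lebesgue_on {0..T}. w (t + s) \<in> H10 \<Omega>"
    using B by (intro ae) (simp add: Bochner_Lp_H10_def)
  moreover have "integrable (lebesgue_on {0..T}) (\<lambda>t. L2_norm \<Omega> (weak_grad \<Omega> (w (t + s))) powr p)"
  proof -
    have "integrable (lebesgue_on {0..T + s}) (\<lambda>t. L2_norm \<Omega> (weak_grad \<Omega> (w t)) powr p)"
      using B by (simp add: Bochner_Lp_H10_def)
    then have "integrable (lebesgue_on {0 + s..T + s}) (\<lambda>t. L2_norm \<Omega> (weak_grad \<Omega> (w t)) powr p)"
      using integrable_subinterval[of 0 "T + s"] s by auto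
    then show ?thesis
      by (simp only: integrable_shift[where g = "\<lambda>t. L2_norm \<Omega> (weak_grad \<Omega> (w t)) powr p"])
  qed
  ultimately show ?thesis unfolding Bochner_Lp_H10_def by blast
qed

lemma phase_dist_zero_iff:
  "phase_dist \<Omega> V W = 0 \<longleftrightarrow> L2_norm \<Omega> (weak_grad \<Omega> (\<lambda>x. fst V x - fst W x)) = 0
    \<and> L2_norm \<Omega> (\<lambda>x. snd V x - snd W x) = 0"
  by (simp add: phase_dist_def phase_norm_def sum_power2_eq_zero_iff)

context quintic_nonlinearity
begin

text \<open>A point at distance zero lies in every neighbourhood, so continuity leaves no room for a
  different value.\<close>

lemma energy_cong:
  assumes "h \<in> L2 \<Omega>" "V \<in> phase_space \<Omega>" "W \<in> phase_space \<Omega>" "phase_dist \<Omega> W V = 0"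
  shows "energy h W = energy h V"
proof (rule ccontr)
  assume "energy h W \<noteq> energy h V"
  then have "\<bar>energy h W - energy h V\<bar> > 0" by simp
  from energy_continuous[OF assms(1,2) this] obtain \<delta> where \<delta>: "\<delta> > 0"
    "\<And>Z. Z \<in> phase_space \<Omega> \<Longrightarrow> phase_dist \<Omega> Z V < \<delta> \<Longrightarrow> \<bar>energy h Z - energy h V\<bar> < \<bar>energy h W - energy h V\<bar>"
    by blast
  from \<delta>(2)[OF assms(3)] assms(4) \<delta>(1) show False by simp
qed

end

context weak_solution_setting
begin

text \<open>The equation is autonomous: the increment of the weak form from \<open>s\<close> to
  \<open>t + s\<close> is the weak form of the shifted curve. Together with uniqueness this gives
  the semigroup property.\<close>

lemma weak_solution_shift:
  assumes s: "0 \<le> s"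
  shows "weak_solution \<Omega> \<alpha> f h (U s) (\<lambda>t. U (t + s))"
  unfolding weak_solution_def Let_def
proof (intro conjI allI impI ballI)
  fix t :: real assume t: "0 \<le> t"
  show "U (t + s) \<in> phase_space \<Omega>" using phase_space_U s t by simp
  show "((\<lambda>r. phase_dist \<Omega> (U (r + s)) (U (t + s))) \<longlongrightarrow> 0) (at t within {0..})"
    by (rule tendsto_shift_half_line[OF phase_dist_tendsto s]) (use s t in simp)
  have "((\<lambda>r. L2_norm \<Omega> (\<lambda>x. (u r x - u (t + s) x) / (r - (t + s)) - v (t + s) x)) \<longlongrightarrow> 0) (at (t + s) within {0..})"
    using sol s t by (simp add: weak_solution_def Let_def)
  from tendsto_shift_half_line[OF this s]
  show "((\<lambda>r. L2_norm \<Omega> (\<lambda>x. (u (r + s) x - u (t + s) x) / (r - t) - v (t + s) x)) \<longlongrightarrow> 0) (at t within {0..})"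
    by simp
next
  fix T :: real assume "0 < T"
  then show "Bochner_Lp_H10 \<Omega> (\<alpha> + 2) T (\<lambda>t. v (t + s))"
    by (intro Bochner_Lp_H10_shift Bochner s) (use s in simp)
next
  show "phase_dist \<Omega> (U (0 + s)) (U s) = 0"
    by (simp add: phase_dist_zero_iff gnorm_zero) (simp add: L2_norm_def L2_inner_def)
next
  fix \<psi> and t :: real assume psi: "\<psi> \<in> H10 \<Omega>" and t: "0 \<le> t"
  let ?G = "\<lambda>\<tau>. gip (u \<tau>) \<psi> + damping_power (k \<tau>) \<alpha> * gip (v \<tau>) \<psi> + fip (u \<tau>) \<psi>"
  have "(LINT \<tau>|lebesgue_on {0..t}. ?G (\<tau> + s)) = (LINT \<tau>|lebesgue_on {s..t + s}. ?G \<tau>)"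
    using integral_shift[of 0 t ?G s] by simp
  moreover have "L2_inner \<Omega> (v (t + s)) \<psi> - L2_inner \<Omega> (v s) \<psi> = t * L2_inner \<Omega> h \<psi> - (LINT \<tau>|lebesgue_on {s..t + s}. ?G \<tau>)"
    using weak_form_increment[OF psi s, of "t + s"] t by simp
  moreover have "(LINT \<tau>|lebesgue_on {0..t}. L2_inner \<Omega> h \<psi>) = t * L2_inner \<Omega> h \<psi>"
    unfolding LINT_const_interval[OF t] by simp
  ultimately show "L2_inner \<Omega> (v (t + s)) \<psi> + (LINT \<tau>|lebesgue_on {0..t}. ?G (\<tau> + s))
      = L2_inner \<Omega> (v s) \<psi> + (LINT \<tau>|lebesgue_on {0..t}. L2_inner \<Omega> h \<psi>)"
    by (simp only: algebra_simps)
qed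

lemma constant_energy_imp_stationary:
  assumes const: "\<And>t. t > 0 \<Longrightarrow> energy h (U t) = energy h (U 0)" and t: "t > 0"
  shows "gnorm (\<lambda>x. u t x - u 0 x) = 0" "L2_norm \<Omega> (\<lambda>x. v t x - v 0 x) = 0"
proof -
  let ?\<mu> = "lebesgue_on {0..t}"
  have i: "integrable ?\<mu> (\<lambda>\<tau>. k \<tau> powr (\<alpha> + 2))" by (rule k_powr_integrable) simp
  have "(LINT \<tau>|?\<mu>. k \<tau> powr (\<alpha> + 2)) \<le> 0"
    using energy_inequality[of 0 t] const[OF t] t by simp
  moreover have "0 \<le> (LINT \<tau>|?\<mu>. k \<tau> powr (\<alpha> + 2))" by simp
  ultimately have "(LINT \<tau>|?\<mu>. k \<tau> powr (\<alpha> + 2)) = 0" by linarith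
  then have "AE \<tau> in ?\<mu>. k \<tau> powr (\<alpha> + 2) = 0"
    by (subst (asm) integral_nonneg_eq_0_iff_AE[OF i]) auto
  then have k0: "AE \<tau> in ?\<mu>. k \<tau> = 0" by simp
  have vH: "AE \<tau> in ?\<mu>. v \<tau> \<in> H10 \<Omega>" by (rule v_H10_AE) simp
  obtain P where P: "P \<ge> 0" "\<And>u. u \<in> H10 \<Omega> \<Longrightarrow> L2_norm \<Omega> u \<le> P * gnorm u"
    using Poincare by blast
  have ae: "AE \<tau> in ?\<mu>. L2_norm \<Omega> (v \<tau>) = 0"
    using k0 vH by eventually_elim (use P(2) L2_norm_nonneg in \<open>metis antisym mult_zero_right\<close>)
  \<comment> \<open>From almost all times to all times: a nonnegative continuous function with
    integral zero vanishes.\<close>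
  have c: "continuous_on {0..t} (\<lambda>\<tau>. L2_norm \<Omega> (v \<tau>))"
    by (rule continuous_on_subset[OF continuous_L2_norm_v]) auto
  have ci: "integrable ?\<mu> (\<lambda>\<tau>. L2_norm \<Omega> (v \<tau>))"
    by (rule integrable_lebesgue_on_continuous[OF c])
  have "(LINT \<tau>|?\<mu>. L2_norm \<Omega> (v \<tau>)) = 0"
    using ae by (rule integral_eq_zero_AE)
  then have hi: "((\<lambda>\<tau>. L2_norm \<Omega> (v \<tau>)) has_integral 0) (cbox 0 t)"
    using has_integral_integral_lebesgue_on[OF ci] by simp
  have v0: "L2_norm \<Omega> (v \<tau>) = 0" if "\<tau> \<in> {0..t}" for \<tau>
    by (rule has_integral_0_cbox_imp_0[OF _ _ hi]) (use c that t L2_norm_nonneg in auto)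
  have "L2_norm \<Omega> (\<lambda>x. v t x - v 0 x) \<le> L2_norm \<Omega> (v t) + L2_norm \<Omega> (\<lambda>x. - 1 *\<^sub>R v 0 x)"
    using L2_norm_triangle[OF v_L2[of t] L2_scale[OF v_L2[of 0], of "- 1"]] t by simp
  also have "\<dots> = 0" unfolding L2_norm_scale using v0[of t] v0[of 0] t by simp
  finally show "L2_norm \<Omega> (\<lambda>x. v t x - v 0 x) = 0" using L2_norm_nonneg by (intro antisym)
  let ?w = "\<lambda>x. u t x - u 0 x"
  have w: "?w \<in> H10 \<Omega>" using t by (intro H10_diff u_H10) auto
  \<comment> \<open>The increment of \<open>u\<close> is tested with itself, so that its gradient
    norm is governed by the vanishing gradient of \<open>v\<close>.\<close>
  have "(gnorm ?w)\<^sup>2 = (LINT \<tau>|?\<mu>. gip (v \<tau>) ?w)"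
    using L2_approximable_increment(2)[OF L2_approximable_gip[OF w], of 0 t] t by (simp add: gnorm_sq)
  also have "\<dots> = 0"
  proof (rule integral_eq_zero_AE)
    show "AE \<tau> in ?\<mu>. gip (v \<tau>) ?w = 0"
      using k0 vH by eventually_elim (use gip_bound[OF _ w] in fastforce)
  qed
  finally show "gnorm ?w = 0" by simp
qed

end

theorem proposition4p9:
  fixes \<Omega> :: "(real^3) set" and h :: "real^3 \<Rightarrow> real" and f :: "real \<Rightarrow> real" and \<alpha> :: real
  assumes "smooth_bounded_domain \<Omega>"
    and "h \<in> L2 \<Omega>"
    and "admissible_nonlinearity \<Omega> f"
    and "\<alpha> \<ge> 0"
    and "well_posed \<Omega> \<alpha> f h"
  shows "gradient_system (phase_space \<Omega>) (phase_dist \<Omega>) (solution_operator \<Omega> \<alpha> f h)"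
proof -
  obtain K where K: "K \<ge> 0" "\<And>a b. \<bar>f a - f b\<bar> \<le> K * (1 + a^4 + b^4) * \<bar>a - b\<bar>"
    using admissible_nonlinearity_Lipschitz[OF assms(3)] by blast
  have f: "f 0 = 0" "Ck_on 2 f UNIV" using assms(3) by (auto simp: admissible_nonlinearity_def)
  obtain F where F: "\<And>x. (F has_real_derivative f x) (at x)" "F 0 = 0"
    using primitive_exists[OF Ck_on_continuous[OF f(2)]] by blast
  interpret quintic_nonlinearity \<Omega> f F K
    using assms(1) K f F Ck_on_continuous[OF f(2)]
    by unfold_locales (auto simp: smooth_bounded_domain_def)
  let ?X = "phase_space \<Omega>" and ?d = "phase_dist \<Omega>" and ?S = "solution_operator \<Omega> \<alpha> f h"
  define U where "U y = (SOME V. weak_solution \<Omega> \<alpha> f h y V)" for y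
  have S: "?S t y = U y t" for t y by (simp add: solution_operator_def U_def)
  have U: "weak_solution \<Omega> \<alpha> f h y (U y)" if "y \<in> ?X" for y
    unfolding U_def
    by (rule someI_ex[of "weak_solution \<Omega> \<alpha> f h y"])
      (rule conjunct1[OF bspec[OF assms(5)[unfolded well_posed_def] that]])
  have setting: "weak_solution_setting \<Omega> f F K \<alpha> h y (U y)" if "y \<in> ?X" for y
    by unfold_locales (rule assms U[OF that])+
  note in_X = weak_solution_setting.phase_space_U[OF setting]
  have U0: "?d (U y 0) y = 0" if "y \<in> ?X" for y
    using U[OF that] by (simp add: weak_solution_def Let_def)
  have "evolution_semigroup ?X ?d ?S"
    unfolding evolution_semigroup_def S
  proof (intro conjI allI impI ballI)
    fix s t y assume s: "(0::real) \<le> s" and t: "(0::real) \<le> t" and y: "y \<in> ?X"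
    \<comment> \<open>Each value of the solution operator uses its own choice of a solution;
      uniqueness identifies the shifted solution with the one chosen for the starting point
      \<open>U y s\<close>.\<close>
    have "weak_solution \<Omega> \<alpha> f h (U y s) (\<lambda>r. U y (r + s))"
      by (rule weak_solution_setting.weak_solution_shift[OF setting[OF y] s])
    from conjunct2[OF bspec[OF assms(5)[unfolded well_posed_def] in_X[OF y s]], rule_format, OF this U[OF in_X[OF y s]] t]
    show "?d (U y (t + s)) (U (U y s) t) = 0" .
  qed (simp_all add: in_X U0 weak_solution_setting.phase_dist_tendsto[OF setting])
  moreover have "strict_lyapunov ?X ?d ?S (energy h)"
    unfolding strict_lyapunov_def S
  proof (intro conjI ballI allI impI)
    fix y and \<epsilon> :: real assume "y \<in> ?X" "0 < \<epsilon>"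
    then show "\<exists>\<delta>>0. \<forall>z\<in>?X. ?d z y < \<delta> \<longrightarrow> \<bar>energy h z - energy h y\<bar> < \<epsilon>"
      using energy_continuous[OF assms(2)] by metis
  next
    fix y and s t :: real assume y: "y \<in> ?X" and st: "0 \<le> s" "s \<le> t"
    have "0 \<le> (LINT \<tau>|lebesgue_on {s..t}. gnorm (snd (U y \<tau>)) powr (\<alpha> + 2))" by simp
    with weak_solution_setting.energy_inequality[OF setting[OF y] st]
    show "energy h (U y t) \<le> energy h (U y s)" by linarith
  next
    fix y and t :: real assume y: "y \<in> ?X" and const: "\<forall>t>0. energy h (U y t) = energy h y" and t: "0 < t"
    interpret weak_solution_setting \<Omega> f F K \<alpha> h y "U y" by (rule setting[OF y])
    have y12: "fst y \<in> H10 \<Omega>" "snd y \<in> L2 \<Omega>" using y by (auto simp: phase_space_def)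
    \<comment> \<open>At time 0 the chosen solution represents \<open>y\<close> only up to distance
      zero, so the energy has to be carried over.\<close>
    have "energy h (U y 0) = energy h y"
      by (rule energy_cong[OF assms(2) y in_X[OF y] U0[OF y]]) simp
    then have "gnorm (\<lambda>x. u t x - u 0 x) = 0" "L2_norm \<Omega> (\<lambda>x. v t x - v 0 x) = 0"
      using constant_energy_imp_stationary[OF _ t] const by auto
    moreover have "gnorm (\<lambda>x. u 0 x - fst y x) = 0" "L2_norm \<Omega> (\<lambda>x. v 0 x - snd y x) = 0"
      using U0[OF y] by (simp_all add: phase_dist_zero_iff)
    \<comment> \<open>The triangle inequality passes through \<open>U y 0\<close>, which is at
      distance zero from both ends.\<close>
    ultimately have le: "gnorm (\<lambda>x. u t x - fst y x) \<le> 0" "L2_norm \<Omega> (\<lambda>x. v t x - snd y x) \<le> 0"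
      using gnorm_triangle_diff[OF u_H10[of t] y12(1) u_H10[of 0]] t
        L2_norm_triangle_diff[OF v_L2[of t] y12(2) v_L2[of 0]] by auto
    show "?d (U y t) y = 0"
      unfolding phase_dist_zero_iff using antisym[OF le(1) gnorm_nonneg] antisym[OF le(2) L2_norm_nonneg] ..
  qed
  ultimately show ?thesis unfolding gradient_system_def by blast
qed

end
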